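(* Let $K$ be a compact metrizable space and let $T \colon C(K) \to C(K)$ be a bounded linear operator which preserves a copy of an asymptotic $\ell_1$ space. Then $T$ preserves a copy of $C(K)$.
   Context: All Banach spaces are real; "subspace" means infinite-dimensional closed linear subspace. $C(K)$ is the Banach space of real continuous functions on $K$ with the supremum norm. Preserving a copy: given separable Banach spaces $X,Y,Z$, a bounded linear operator $T\colon X\to Y$ preserves a copy of $Z$ if there is a closed linear subspace $Z'$ of $X$ isomorphic to $Z$ such that the restriction of $T$ to $Z'$ is an isomorphism onto its image (an into isomorphism). Block basis: given a Schauder basis $(e_n)$, a finite sequence $u_1<\dots<u_m$ is a block basis of $(e_n)$ if there are finite sets $F_1<\dots<F_m$ of positive integers ($\max F_i<\min F_{i+1}$) and non-zero scalars $\lambda_j$ with $u_i=\sum_{j\in F_i}\lambda_j e_j\neq 0$; one writes $\mathrm{supp}\,u_i=F_i$. Asymptotic $\ell_1$: an infinite-dimensional Banach space with a Schauder basis $(e_n)$ is asymptotic $\ell_1$ with respect to $(e_n)$ if there is a constant $C>0$ such that for every block basis $u_1<\dots<u_m$ of $(e_n)$ with $m\le\min\mathrm{supp}\,u_1$ one has $\|\sum_{i=1}^m u_i\|\ge C\sum_{i=1}^m\|u_i\|$. An asymptotic $\ell_1$ space is a Banach space that is asymptotic $\ell_1$ with respect to some Schauder basis of it. *)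

theory Defs
  imports "HOL-Analysis.Analysis"
begin

text \<open>The map \<open>f\<close> restricted to the linear subspace \<open>S\<close> is an isomorphism (linear homeomorphism) onto
  its image; \<open>f\<close> is only ever applied here to linear maps.\<close>

definition into_isomorphism_on ::
    "'a::real_normed_vector set \<Rightarrow> ('a \<Rightarrow> 'b::real_normed_vector) \<Rightarrow> bool" where
  "into_isomorphism_on S f \<longleftrightarrow> (\<exists>g. homeomorphism S (f ` S) f g)"

definition isomorphic_to_subspace ::
    "'z::real_normed_vector itself \<Rightarrow> 'x::real_normed_vector set \<Rightarrow> bool" where
  "isomorphic_to_subspace Z S \<longleftrightarrow>
     (\<exists>J :: 'z \<Rightarrow> 'x. linear J \<and> range J = S \<and> into_isomorphism_on UNIV J)"

text \<open>The sorts are \<open>real_normed_vector\<close> rather than \<open>banach\<close> because the library declares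
  \<open>'k \<Rightarrow>\<^sub>C real\<close> to be a \<open>banach\<close> instance only for \<open>'k\<close> of class \<open>metric_space\<close>.\<close>

definition preserves_copy ::
    "('x::real_normed_vector \<Rightarrow>\<^sub>L 'y::real_normed_vector) \<Rightarrow> 'z::real_normed_vector itself \<Rightarrow> bool" where
  "preserves_copy T Z \<longleftrightarrow>
     (\<exists>S. subspace S \<and> closed S \<and> isomorphic_to_subspace Z S \<and>
          into_isomorphism_on S (blinfun_apply T))"

definition schauder_basis :: "(nat \<Rightarrow> 'z::banach) \<Rightarrow> bool" where
  "schauder_basis e \<longleftrightarrow> (\<forall>x. \<exists>!a :: nat \<Rightarrow> real. (\<lambda>n. a n *\<^sub>R e n) sums x)"

text \<open>\<open>u 0, \<dots>, u (m - 1)\<close> is a block basis of \<open>e\<close> and \<open>F i\<close> is the support of \<open>u i\<close>. A single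
  family \<open>c\<close> of coefficients suffices because the sets \<open>F i\<close> are successive, hence disjoint.\<close>

definition block_basis ::
    "(nat \<Rightarrow> 'z::real_normed_vector) \<Rightarrow> nat \<Rightarrow> (nat \<Rightarrow> nat set) \<Rightarrow> (nat \<Rightarrow> 'z) \<Rightarrow> bool" where
  "block_basis e m F u \<longleftrightarrow>
     (\<forall>i<m. finite (F i) \<and> F i \<noteq> {}) \<and>
     (\<forall>i. Suc i < m \<longrightarrow> Max (F i) < Min (F (Suc i))) \<and>
     (\<exists>c :: nat \<Rightarrow> real. \<forall>i<m.
        (\<forall>j\<in>F i. c j \<noteq> 0) \<and> u i = (\<Sum>j\<in>F i. c j *\<^sub>R e j) \<and> u i \<noteq> 0)"

text \<open>Basis vectors are numbered from \<open>0\<close> here, so \<open>e j\<close> is the \<open>(j + 1)\<close>-st basis vector. With the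
  usual numbering by positive integers the least element of the support of \<open>u 0\<close> is therefore
  \<open>Suc (Min (F 0))\<close>.\<close>

definition asymptotic_l1_wrt :: "(nat \<Rightarrow> 'z::banach) \<Rightarrow> bool" where
  "asymptotic_l1_wrt e \<longleftrightarrow>
     schauder_basis e \<and>
     (\<exists>C>0. \<forall>m F u. 1 \<le> m \<and> block_basis e m F u \<and> m \<le> Suc (Min (F 0)) \<longrightarrow>
        norm (\<Sum>i<m. u i) \<ge> C * (\<Sum>i<m. norm (u i)))"

definition asymptotic_l1_space :: "'z::banach itself \<Rightarrow> bool" where
  "asymptotic_l1_space Z \<longleftrightarrow>
     \<not> (\<exists>B :: 'z set. finite B \<and> span B = UNIV) \<and>
     (\<exists>e :: nat \<Rightarrow> 'z. asymptotic_l1_wrt e)"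

end

theory Submission
  imports Defs
begin

text \<open>Let \<open>\<mu>\<^sub>t\<close> be the measure representing \<open>f \<mapsto> T f t\<close> and \<open>\<bar>\<mu>\<^sub>t\<bar>\<close> its total variation. Divide the points
  \<open>t\<close> into finitely many strata on which the mass \<open>\<bar>\<mu>\<^sub>t\<bar>(1)\<close> is almost constant. If on some part of a
  stratum the measures keep concentrating, that is, if on every open portion and for every finite set
  of points \<open>s\<close> some \<open>\<bar>\<mu>\<^sub>t\<bar>\<close> gives mass \<open>> \<epsilon>\<close> to a function \<open>0 \<le> \<phi> \<le> 1\<close> that is almost invisible to all the
  \<open>\<bar>\<mu>\<^sub>s\<bar>\<close>, then one builds a finitely branching tree of functions, disjoint at every level, whose nodes
  keep mass along the whole tree. Telescoping sums over the tree embed \<open>C(K)\<close> so that \<open>T\<close> is bounded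
  below on the image.

  Otherwise, by the Lindelof property, a countable set \<open>R\<close> of points suffices: sequences of functions that are null
  for all \<open>\<bar>\<mu>\<^sub>s\<bar>\<close>, \<open>s \<in> R\<close>, are locally eventually of mass at most \<open>\<epsilon>\<close>. Averaging over signs in the
  asymptotic \<open>\<ell>\<^sub>1\<close> space yields normalized blocks \<open>z\<^sub>i\<close> that are null for all \<open>\<bar>\<mu>\<^sub>s\<bar>\<close>, \<open>s \<in> R\<close>. By the
  asymptotic \<open>\<ell>\<^sub>1\<close> property, averages of long families of blocks can be corrected to vectors \<open>\<Sum>a\<^sub>i z\<^sub>i\<close> of
  norm one whose restrictions to sets \<open>A\<close> of indices have norm at most \<open>2 b(A) + \<tau>\<close> for a probability
  weight \<open>b\<close>; such averages can be iterated. Exhausting the strata one after the other produces a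
  unit vector \<open>u\<close> of this form with \<open>\<bar>T u t\<bar>\<close> small at every point \<open>t\<close>, so that \<open>T\<close> is not bounded below
  on the given copy.\<close>

subsection \<open>Total variation\<close>

text \<open>No measure is constructed: \<open>\<bar>\<mu>\<^sub>t\<bar>\<close> is met only through
  its values \<open>tv t f\<close> at continuous f \<ge> 0, suprema of T h t over |h| \<le> f. Such
  suprema are lower but not upper semicontinuous in t, and this is the reason for the strata: where
  the total mass is almost constant, one h almost norms all nearby measures, \<open>tv\<close> can
  be exchanged for the continuous quantity \<open>nu h t\<close>, and lower semicontinuity at 1 - f
  is almost upper semicontinuity at f. The obstacle in the second half is the loss of constants. A
  stratum is exhausted transfinitely, and the number of strata depends on the lower bound \<delta>
  of T on the copy, so averages whose estimates deteriorate by a factor 1/C at each pass would be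
  useless. Passing to a subset of indices on which the ratio of norm to weight is nearly extremal
  restores the bound 2 b(A) + \<tau> with the same factor 2 each time. With \<epsilon> =
  \<delta>/20, masses at most 3 \<epsilon> contribute at most 6 \<epsilon> to |T u t|, and together
  with all errors this stays below 3 \<delta>/4.\<close>

lemma apply_Bcontfun_compact:
  fixes f :: "'k::topological_space \<Rightarrow> real"
  assumes "compact (UNIV :: 'k set)" "continuous_on UNIV f"
  shows "apply_bcontfun (Bcontfun f) = f"
proof -
  have "compact (range f)" using assms by (simp add: compact_continuous_image)
  then have "f \<in> bcontfun" using assms(2) by (simp add: bcontfun_def compact_imp_bounded)
  then show ?thesis by (rule Bcontfun_inverse)
qed

lemma norm_bcontfun_le:
  fixes f :: "'k::topological_space \<Rightarrow>\<^sub>C real"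
  assumes "\<And>x. \<bar>f x\<bar> \<le> b"
  shows "norm f \<le> b"
  using assms norm_bound[of f b] by simp

lemma abs_le_norm_bcontfun:
  fixes f :: "'k::topological_space \<Rightarrow>\<^sub>C real"
  shows "\<bar>f x\<bar> \<le> norm f"
  using norm_bounded[of f x] by simp

lemma apply_sum_bcontfun:
  fixes f :: "'i \<Rightarrow> 'k::topological_space \<Rightarrow>\<^sub>C real"
  shows "apply_bcontfun (\<Sum>i\<in>A. f i) x = (\<Sum>i\<in>A. f i x)"
  by (induction A rule: infinite_finite_induct) auto

lemma compact_real_bound:
  fixes f :: "'k::topological_space \<Rightarrow> real"
  assumes "compact (UNIV :: 'k set)" "continuous_on UNIV f"
  obtains B where "\<And>x. \<bar>f x\<bar> \<le> B" "0 \<le> B"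
proof
  show "\<bar>f x\<bar> \<le> norm (Bcontfun f)" for x
    using abs_le_norm_bcontfun[of "Bcontfun f" x] apply_Bcontfun_compact[OF assms] by simp
qed simp

locale ck_operator =
  fixes T :: "('k::topological_space \<Rightarrow>\<^sub>C real) \<Rightarrow>\<^sub>L ('k \<Rightarrow>\<^sub>C real)"
  assumes compact_UNIV: "compact (UNIV :: 'k set)"
begin

text \<open>Total variation of the measure representing \<open>h \<mapsto> T h t\<close>, evaluated at \<open>f \<ge> 0\<close>.\<close>

definition tv :: "'k \<Rightarrow> ('k \<Rightarrow> real) \<Rightarrow> real" where
  "tv t f = (SUP h\<in>{h :: 'k \<Rightarrow>\<^sub>C real. \<forall>x. \<bar>h x\<bar> \<le> f x}. T h t)"

lemmas apply_Bc = apply_Bcontfun_compact[OF compact_UNIV]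

lemma abs_T_le: "\<bar>T h t\<bar> \<le> norm T * norm h"
  using abs_le_norm_bcontfun[of "T h" t] norm_blinfun[of T h] by linarith

lemma abs_T_le_bound:
  assumes "\<And>x. \<bar>apply_bcontfun h x\<bar> \<le> B"
  shows "\<bar>T h t\<bar> \<le> norm T * B"
proof -
  have "norm T * norm h \<le> norm T * B"
    by (intro mult_left_mono norm_bcontfun_le assms) auto
  then show ?thesis using abs_T_le[of h t] by linarith
qed

lemma tv_bdd:
  assumes "continuous_on UNIV f"
  shows "bdd_above ((\<lambda>h. T h t) ` {h. \<forall>x. \<bar>apply_bcontfun h x\<bar> \<le> f x})"
proof -
  obtain B where B: "\<And>x. \<bar>f x\<bar> \<le> B" using compact_real_bound[OF compact_UNIV assms] by blast
  show ?thesis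
  proof (intro bdd_aboveI2)
    fix h assume "h \<in> {h. \<forall>x. \<bar>apply_bcontfun h x\<bar> \<le> f x}"
    then have "\<And>x. \<bar>apply_bcontfun h x\<bar> \<le> B" using B abs_le_D1 order_trans by blast
    then have "\<bar>T h t\<bar> \<le> norm T * B" by (rule abs_T_le_bound)
    then show "T h t \<le> norm T * B" by linarith
  qed
qed

lemma tv_ne:
  assumes "\<And>x. 0 \<le> f x"
  shows "{h :: 'k \<Rightarrow>\<^sub>C real. \<forall>x. \<bar>h x\<bar> \<le> f x} \<noteq> {}"
proof -
  have "0 \<in> {h :: 'k \<Rightarrow>\<^sub>C real. \<forall>x. \<bar>h x\<bar> \<le> f x}" using assms by simp
  then show ?thesis by blast
qed

lemma T_le_tv:
  assumes "continuous_on UNIV f" "\<And>x. \<bar>apply_bcontfun h x\<bar> \<le> f x"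
  shows "\<bar>T h t\<bar> \<le> tv t f"
proof -
  have "T g t \<le> tv t f" if "\<And>x. \<bar>apply_bcontfun g x\<bar> \<le> f x" for g
    unfolding tv_def by (rule cSUP_upper[OF _ tv_bdd]) (use assms that in auto)
  from this[of h] this[of "-h"] show ?thesis using assms
    by (auto simp: blinfun.minus_right abs_le_iff)
qed

lemma tv_witness:
  assumes "continuous_on UNIV f" "\<And>x. 0 \<le> f x" "c < tv t f"
  obtains h where "\<And>x. \<bar>apply_bcontfun h x\<bar> \<le> f x" "c < T h t"
  using assms(3) unfolding tv_def
  by (subst (asm) less_cSUP_iff[OF tv_ne tv_bdd]) (use assms in auto)

lemma tv_least:
  assumes "\<And>x. 0 \<le> f x" "\<And>h. (\<And>x. \<bar>apply_bcontfun h x\<bar> \<le> f x) \<Longrightarrow> T h t \<le> c"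
  shows "tv t f \<le> c"
  unfolding tv_def by (rule cSUP_least[OF tv_ne]) (use assms in auto)

lemma tv_nonneg:
  assumes "continuous_on UNIV f" "\<And>x. 0 \<le> f x"
  shows "0 \<le> tv t f"
  using T_le_tv[of f 0 t] assms by auto

lemma tv_mono:
  assumes "continuous_on UNIV g" "\<And>x. 0 \<le> f x" "\<And>x. f x \<le> g x"
  shows "tv t f \<le> tv t g"
proof (rule tv_least)
  fix h assume "\<And>x. \<bar>apply_bcontfun h x\<bar> \<le> f x"
  then have "\<bar>T h t\<bar> \<le> tv t g" by (intro T_le_tv assms) (use assms(3) order_trans in blast)
  then show "T h t \<le> tv t g" by linarith
qed (use assms in auto)

lemma tv_bound:
  assumes "\<And>x. 0 \<le> f x" "\<And>x. f x \<le> B"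
  shows "tv t f \<le> norm T * B"
proof (rule tv_least)
  fix h assume "\<And>x. \<bar>apply_bcontfun h x\<bar> \<le> f x"
  then have "\<And>x. \<bar>apply_bcontfun h x\<bar> \<le> B" using assms(2) order_trans by blast
  then have "\<bar>T h t\<bar> \<le> norm T * B" by (rule abs_T_le_bound)
  then show "T h t \<le> norm T * B" by linarith
qed (use assms in auto)

text \<open>Additivity makes \<open>tv t\<close> behave as a positive measure. For \<le>, a function
  with |h| \<le> f + g is clipped to [-f, f], and the remainder is bounded by g; for \<ge>, almost
  optimal functions for f and for g are added.\<close>

lemma tv_add:
  assumes f: "continuous_on UNIV f" "\<And>x. 0 \<le> f x" and g: "continuous_on UNIV g" "\<And>x. 0 \<le> g x"
  shows "tv t (\<lambda>x. f x + g x) = tv t f + tv t g"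
proof (rule antisym)
  have fg: "continuous_on UNIV (\<lambda>x. f x + g x)" "\<And>x. 0 \<le> f x + g x"
    using f g by (auto intro!: continuous_intros)
  show "tv t (\<lambda>x. f x + g x) \<le> tv t f + tv t g"
  proof (rule tv_least)
    fix h :: "'k \<Rightarrow>\<^sub>C real" assume h: "\<And>x. \<bar>h x\<bar> \<le> f x + g x"
    define h1 where "h1 = (\<lambda>x. max (min (h x) (f x)) (- f x))"
    have c1: "continuous_on UNIV h1" unfolding h1_def
      by (intro continuous_intros continuous_on_apply_bcontfun f)
    define H1 where "H1 = Bcontfun h1"
    have H1: "apply_bcontfun H1 = h1" unfolding H1_def by (rule apply_Bc[OF c1])
    have a1: "\<bar>H1 x\<bar> \<le> f x" for x using f(2)[of x] unfolding H1 h1_def by (auto simp: max_def min_def)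
    have a2: "\<bar>(h - H1) x\<bar> \<le> g x" for x
      using h[of x] f(2)[of x] g(2)[of x] unfolding minus_bcontfun.rep_eq H1 h1_def
      by (auto simp: max_def min_def abs_le_iff)
    have "T h t = T H1 t + T (h - H1) t" by (simp add: blinfun.diff_right)
    then show "T h t \<le> tv t f + tv t g"
      using T_le_tv[OF f(1) a1, of t] T_le_tv[OF g(1) a2, of t] by linarith
  qed (rule fg)
  show "tv t f + tv t g \<le> tv t (\<lambda>x. f x + g x)"
  proof (rule field_le_epsilon)
    fix e :: real assume e: "e > 0"
    obtain h where h: "\<And>x. \<bar>apply_bcontfun h x\<bar> \<le> f x" "tv t f - e/2 < T h t"
      using tv_witness[OF f, of "tv t f - e/2" t] e by force
    obtain k where k: "\<And>x. \<bar>apply_bcontfun k x\<bar> \<le> g x" "tv t g - e/2 < T k t"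
      using tv_witness[OF g, of "tv t g - e/2" t] e by force
    have "\<bar>T (h + k) t\<bar> \<le> tv t (\<lambda>x. f x + g x)"
    proof (rule T_le_tv[OF fg(1)])
      fix x show "\<bar>(h + k) x\<bar> \<le> f x + g x" using h(1)[of x] k(1)[of x] by (auto simp: abs_le_iff)
    qed
    then show "tv t f + tv t g \<le> tv t (\<lambda>x. f x + g x) + e"
      using h(2) k(2) by (simp add: blinfun.add_right)
  qed
qed

lemma tv_zero [simp]: "tv t (\<lambda>_. 0) = 0"
  using tv_add[of "\<lambda>_. 0" "\<lambda>_. 0" t] by simp

lemma tv_scale:
  assumes f: "continuous_on UNIV f" "\<And>x. 0 \<le> f x" and c: "0 \<le> c"
  shows "tv t (\<lambda>x. c * f x) = c * tv t f"
proof -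
  have le: "c * tv t f \<le> tv t (\<lambda>x. c * f x)" if f: "continuous_on UNIV f" "\<And>x. 0 \<le> f x" and c: "0 < c"
    for f c
  proof -
    have "tv t f \<le> tv t (\<lambda>x. c * f x) / c"
    proof (rule tv_least[OF f(2)])
      fix h :: "'k \<Rightarrow>\<^sub>C real" assume h: "\<And>x. \<bar>h x\<bar> \<le> f x"
      have "\<bar>T (c *\<^sub>R h) t\<bar> \<le> tv t (\<lambda>x. c * f x)"
        by (rule T_le_tv) (use f c h in \<open>auto intro!: continuous_intros simp: abs_mult\<close>)
      then show "T h t \<le> tv t (\<lambda>x. c * f x) / c"
        using c by (simp add: blinfun.scaleR_right field_simps)
    qed
    then show ?thesis using c by (simp add: field_simps)
  qed
  show ?thesis
  proof (cases "c = 0")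
    case False
    then have c: "c > 0" using c by simp
    \<comment> \<open>The opposite inequality is \<open>le\<close> again, for the factor
      \<open>inverse c\<close> and the function c f.\<close>
    have "inverse c * tv t (\<lambda>x. c * f x) \<le> tv t (\<lambda>x. inverse c * (c * f x))"
      by (rule le) (use f c in \<open>auto intro!: continuous_intros\<close>)
    also have "(\<lambda>x. inverse c * (c * f x)) = f" using c by (auto simp: field_simps)
    finally have "tv t (\<lambda>x. c * f x) \<le> c * tv t f" using c by (simp add: field_simps)
    then show ?thesis using le[OF f c] by linarith
  qed simp
qed

lemma tv_diff:
  assumes "continuous_on UNIV f" "\<And>x. 0 \<le> f x" "continuous_on UNIV g" "\<And>x. f x \<le> g x"
  shows "tv t (\<lambda>x. g x - f x) = tv t g - tv t f"
  using tv_add[of f "\<lambda>x. g x - f x" t] assms continuous_on_diff[OF assms(3,1)] by auto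

lemma tv_sum:
  assumes "\<And>i. i \<in> I \<Longrightarrow> continuous_on UNIV (f i)" "\<And>i x. i \<in> I \<Longrightarrow> 0 \<le> f i x"
  shows "tv t (\<lambda>x. \<Sum>i\<in>I. f i x) = (\<Sum>i\<in>I. tv t (f i))"
  using assms
proof (induction I rule: infinite_finite_induct)
  case (insert i I)
  have "tv t (\<lambda>x. f i x + (\<Sum>i\<in>I. f i x)) = tv t (f i) + tv t (\<lambda>x. \<Sum>i\<in>I. f i x)"
    by (rule tv_add) (use insert in \<open>auto intro!: continuous_on_sum sum_nonneg\<close>)
  then show ?case using insert by auto
qed auto

lemma open_T_gt: "open {t. c < apply_bcontfun (T h) t}"
  by (intro open_Collect_less continuous_intros continuous_on_apply_bcontfun)

text \<open>Lower semicontinuity in t, as a supremum of the continuous functions T h.\<close>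

lemma open_tv_gt:
  assumes "continuous_on UNIV f" "\<And>x. 0 \<le> f x"
  shows "open {t. c < tv t f}"
proof (subst openin_subopen[of euclidean, simplified], intro ballI)
  fix t assume "t \<in> {t. c < tv t f}"
  then obtain h where h: "\<And>x. \<bar>apply_bcontfun h x\<bar> \<le> f x" "c < T h t" using tv_witness[OF assms] by blast
  have "{t. c < T h t} \<subseteq> {t. c < tv t f}"
  proof
    fix s assume "s \<in> {t. c < T h t}"
    then show "s \<in> {t. c < tv t f}" using T_le_tv[OF assms(1) h(1), of s] by auto
  qed
  then show "\<exists>U. open U \<and> t \<in> U \<and> U \<subseteq> {t. c < tv t f}" using open_T_gt h(2) by blast
qed

definition tvnorm :: "'k \<Rightarrow> real" where "tvnorm t = tv t (\<lambda>_. 1)"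

lemma tvnorm_le: "tvnorm t \<le> norm T"
  unfolding tvnorm_def using tv_bound[of "\<lambda>_. 1" 1] by simp

lemma tv_le_tvnorm:
  assumes "\<And>x. 0 \<le> f x" "\<And>x. f x \<le> 1"
  shows "tv t f \<le> tvnorm t"
  unfolding tvnorm_def by (rule tv_mono) (use assms in auto)

end

subsection \<open>Concentration\<close>

text \<open>Dependent choice on initial segments, so that each term may depend on all its
  predecessors. \<open>P\<close> has to be satisfiable after every list, even after lists that never
  arise; where this fails, \<open>P\<close> is guarded by an implication in the
  applications.\<close>

lemma history_choice:
  assumes "\<And>xs. \<exists>x. P xs x"
  obtains g where "\<And>i::nat. P (map g [0..<i]) (g i)"
proof -
  have "\<exists>f. \<forall>n. length (f n) = n \<and> (\<exists>x. P (f n) x \<and> f (Suc n) = f n @ [x])"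
  proof (intro dependent_nat_choice)
    show "\<exists>x. length x = (0::nat)" by simp
    show "\<exists>y. length y = Suc n \<and> (\<exists>x'. P x x' \<and> y = x @ [x'])" if "length x = n" for x :: "'a list" and n
    proof -
      obtain x' where "P x x'" using assms by blast
      then show ?thesis using that by (intro exI[of _ "x @ [x']"]) auto
    qed
  qed
  then obtain f where len: "\<And>n. length (f n) = n" and f: "\<And>n. \<exists>x. P (f n) x \<and> f (Suc n) = f n @ [x]"
    by blast
  define g where "g i = last (f (Suc i))" for i
  have step: "P (f n) (g n) \<and> f (Suc n) = f n @ [g n]" for n
    using f[of n] unfolding g_def by auto
  have "f n = map g [0..<n]" for n
    by (induction n) (use len[of 0] step in auto)
  then show ?thesis using that[of g] step by metis
qed

context ck_operator
begin

definition test :: "('k \<Rightarrow> real) \<Rightarrow> bool" where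
  "test f \<longleftrightarrow> continuous_on UNIV f \<and> (\<forall>x. 0 \<le> f x \<and> f x \<le> 1)"

lemma testD: "test f \<Longrightarrow> continuous_on UNIV f" "test f \<Longrightarrow> 0 \<le> f x" "test f \<Longrightarrow> f x \<le> 1"
  by (auto simp: test_def)

lemma test_max: "test f \<Longrightarrow> test g \<Longrightarrow> test (\<lambda>x. max (f x) (g x))"
  and test_min: "test f \<Longrightarrow> test g \<Longrightarrow> test (\<lambda>x. min (f x) (g x))"
  by (auto simp: test_def intro!: continuous_intros intro: min.coboundedI1 max.coboundedI1)

text \<open>The sum of the measures at the points of a finite set: one inequality
  \<open>tvs S f < \<kappa>\<close> makes f almost invisible at all points of S
  simultaneously.\<close>

definition tvs :: "'k set \<Rightarrow> ('k \<Rightarrow> real) \<Rightarrow> real" where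
  "tvs S f = (\<Sum>t\<in>S. tv t f)"

lemma tvs_mono:
  assumes "test g" "\<And>x. 0 \<le> f x" "\<And>x. f x \<le> g x"
  shows "tvs S f \<le> tvs S g"
  unfolding tvs_def using assms by (intro sum_mono tv_mono) (auto dest: testD)

lemma tvs_mono_set: "test f \<Longrightarrow> finite S' \<Longrightarrow> S \<subseteq> S' \<Longrightarrow> tvs S f \<le> tvs S' f"
  unfolding tvs_def by (intro sum_mono2 tv_nonneg) (auto dest: testD)

lemma tvs_max:
  assumes "test f" "test g"
  shows "tvs S (\<lambda>x. max (f x) (g x)) \<le> tvs S f + tvs S g"
  unfolding tvs_def sum.distrib[symmetric]
proof (rule sum_mono)
  fix t
  have "tv t (\<lambda>x. max (f x) (g x)) \<le> tv t (\<lambda>x. f x + g x)"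
    using assms by (intro tv_mono) (auto simp: test_def intro!: continuous_intros intro: max.coboundedI1)
  also have "\<dots> = tv t f + tv t g" using assms by (intro tv_add) (auto dest: testD)
  finally show "tv t (\<lambda>x. max (f x) (g x)) \<le> tv t f + tv t g" .
qed

text \<open>The representing measure at t multiplied by the density h. Unlike \<open>tv t f\<close>
  it is linear in f and continuous in t, so that strict inequalities for it are open conditions on
  t.\<close>

definition nu :: "('k \<Rightarrow>\<^sub>C real) \<Rightarrow> 'k \<Rightarrow> ('k \<Rightarrow> real) \<Rightarrow> real" where
  "nu h t f = T (Bcontfun (\<lambda>x. h x * f x)) t"

lemma Bc_mult:
  fixes h :: "'k \<Rightarrow>\<^sub>C real"
  shows "continuous_on UNIV f \<Longrightarrow> apply_bcontfun (Bcontfun (\<lambda>x. h x * f x)) = (\<lambda>x. h x * f x)"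
  by (intro apply_Bc continuous_intros continuous_on_apply_bcontfun)

lemma nu_add:
  assumes "continuous_on UNIV f" "continuous_on UNIV g"
  shows "nu h t (\<lambda>x. f x + g x) = nu h t f + nu h t g"
proof -
  have "Bcontfun (\<lambda>x. h x * (f x + g x)) = Bcontfun (\<lambda>x. h x * f x) + Bcontfun (\<lambda>x. h x * g x)"
    by (intro bcontfun_eqI, unfold plus_bcontfun.rep_eq Bc_mult[OF continuous_on_add[OF assms]]
      Bc_mult[OF assms(1)] Bc_mult[OF assms(2)]) (rule distrib_left)
  then show ?thesis unfolding nu_def by (simp add: blinfun.add_right)
qed

lemma nu_diff:
  assumes "continuous_on UNIV f" "continuous_on UNIV g"
  shows "nu h t (\<lambda>x. f x - g x) = nu h t f - nu h t g"
  using nu_add[OF continuous_on_diff[OF assms] assms(2), of h t] by simp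

lemma nu_cmult:
  assumes "continuous_on UNIV f"
  shows "nu h t (\<lambda>x. c * f x) = c * nu h t f"
proof -
  have "Bcontfun (\<lambda>x. h x * (c * f x)) = c *\<^sub>R Bcontfun (\<lambda>x. h x * f x)"
    using assms by (intro bcontfun_eqI) (simp add: Bc_mult continuous_on_mult_left)
  then show ?thesis unfolding nu_def by (simp add: blinfun.scaleR_right)
qed

text \<open>Modularity. An upper bound at the maximum together with lower bounds at f and g yields a
  lower bound at the minimum; this is how mass is handed on from a node to its children.\<close>

lemma nu_max_min:
  assumes "continuous_on UNIV f" "continuous_on UNIV g"
  shows "nu h t (\<lambda>x. max (f x) (g x)) + nu h t (\<lambda>x. min (f x) (g x)) = nu h t f + nu h t g"
proof -
  have "nu h t (\<lambda>x. max (f x) (g x)) + nu h t (\<lambda>x. min (f x) (g x))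
    = nu h t (\<lambda>x. max (f x) (g x) + min (f x) (g x))"
    using assms by (intro nu_add[symmetric] continuous_intros)
  also have "(\<lambda>x. max (f x) (g x) + min (f x) (g x)) = (\<lambda>x. f x + g x)"
    by (auto simp: max_def min_def)
  finally show ?thesis using nu_add[OF assms] by simp
qed

lemma abs_nu_le_tv:
  assumes h: "\<And>x. \<bar>apply_bcontfun h x\<bar> \<le> 1" and f: "continuous_on UNIV f" "continuous_on UNIV g" "\<And>x. \<bar>f x\<bar> \<le> g x"
  shows "\<bar>nu h t f\<bar> \<le> tv t g"
  unfolding nu_def
proof (rule T_le_tv[OF f(2)])
  fix x show "\<bar>apply_bcontfun (Bcontfun (\<lambda>x. h x * f x)) x\<bar> \<le> g x"
    unfolding Bc_mult[OF f(1)] abs_mult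
    using mult_mono[OF h[of x] f(3)[of x]] by simp
qed

lemma open_nu_gt: "open {t. c < nu h t f}"
  unfolding nu_def by (rule open_T_gt)

text \<open>The deficits \<open>tv t - nu h t\<close> at f and at 1 - f are both nonnegative and add
  up to the deficit at 1, which is at most g.\<close>

lemma tv_le_nu:
  assumes h: "\<And>x. \<bar>apply_bcontfun h x\<bar> \<le> 1" "tvnorm t - g \<le> T h t" and f: "test f"
  shows "tv t f \<le> nu h t f + g"
proof -
  have "nu h t (\<lambda>_. 1) = T h t" unfolding nu_def by (simp add: apply_bcontfun_inverse)
  moreover have "nu h t (\<lambda>_. 1) = nu h t f + nu h t (\<lambda>x. 1 - f x)"
    using nu_add[OF testD(1)[OF f] continuous_on_diff[OF continuous_on_const testD(1)[OF f]], of h t 1] by simp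
  moreover have "nu h t (\<lambda>x. 1 - f x) \<le> tv t (\<lambda>x. 1 - f x)"
  proof -
    have "\<bar>nu h t (\<lambda>x. 1 - f x)\<bar> \<le> tv t (\<lambda>x. 1 - f x)"
      by (rule abs_nu_le_tv[OF h(1)]) (use f in \<open>auto simp: test_def intro!: continuous_intros\<close>)
    then show ?thesis by linarith
  qed
  moreover have "tv t (\<lambda>x. 1 - f x) = tvnorm t - tv t f"
    unfolding tvnorm_def using f by (intro tv_diff) (auto simp: test_def)
  ultimately show ?thesis using h(2) by linarith
qed

text \<open>Failure, at level c, of uniform absolute continuity of the family \<open>m t\<close>, t
  \<in> V, with respect to finite sums of total variations. It is used for \<open>m = tv\<close> and
  for \<open>m = nu h\<close>.\<close>

definition conc :: "('k \<Rightarrow> ('k \<Rightarrow> real) \<Rightarrow> real) \<Rightarrow> 'k set \<Rightarrow> real \<Rightarrow> bool" where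
  "conc m V c \<longleftrightarrow> (\<forall>S \<kappa>. finite S \<and> 0 < \<kappa> \<longrightarrow> (\<exists>\<phi> t. test \<phi> \<and> t \<in> V \<and> tvs S \<phi> < \<kappa> \<and> c < m t \<phi>))"

lemma concD:
  assumes "conc m V c" "finite S" "0 < \<kappa>"
  obtains \<phi> t where "test \<phi>" "t \<in> V" "tvs S \<phi> < \<kappa>" "c < m t \<phi>"
  using assms unfolding conc_def by blast

lemma conc_mono: "conc m V c \<Longrightarrow> V \<subseteq> V' \<Longrightarrow> c' \<le> c \<Longrightarrow> conc m V' c'"
  unfolding conc_def by (meson order.strict_trans1 subset_iff)

text \<open>Shrinking \<open>V\<close> makes the supremum of the levels of concentration on \<open>V\<close> almost
  stable under further shrinking.\<close>

lemma stable_concentration: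
  assumes m: "\<And>t \<phi>. test \<phi> \<Longrightarrow> m t \<phi> \<le> M"
    and conc: "\<And>V. open V \<Longrightarrow> V \<inter> L \<noteq> {} \<Longrightarrow> conc m (V \<inter> L) c0"
    and V: "open V" "V \<inter> L \<noteq> {}" and \<theta>: "0 < \<theta>"
  obtains V' c where "open V'" "V' \<subseteq> V" "V' \<inter> L \<noteq> {}" "c0 - \<theta> \<le> c"
    "\<And>V''. open V'' \<Longrightarrow> V'' \<subseteq> V' \<Longrightarrow> V'' \<inter> L \<noteq> {} \<Longrightarrow> conc m (V'' \<inter> L) c"
    "\<not> conc m (V' \<inter> L) (c + \<theta>)"
proof -
  define C where "C = {c. \<exists>V'. open V' \<and> V' \<subseteq> V \<and> V' \<inter> L \<noteq> {} \<and> \<not> conc m (V' \<inter> L) c}"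
  have lb: "c0 \<le> c" if "c \<in> C" for c
    using that conc conc_mono[of m _ c0 _ c] unfolding C_def by force
  have "\<not> conc m (V \<inter> L) M"
  proof
    assume "conc m (V \<inter> L) M"
    then obtain \<phi> t where "test \<phi>" "M < m t \<phi>" by (rule concD[of m "V \<inter> L" M "{}" 1]) auto
    then show False using m[of \<phi> t] by simp
  qed
  then have ne: "C \<noteq> {}" unfolding C_def using V by blast
  have bdd: "bdd_below C" using lb by (rule bdd_belowI)
  have "Inf C < Inf C + \<theta>/2" using \<theta> by simp
  then obtain c1 where c1: "c1 \<in> C" "c1 < Inf C + \<theta>/2" using cInf_lessD[OF ne] by blast
  then obtain V' where V': "open V'" "V' \<subseteq> V" "V' \<inter> L \<noteq> {}" "\<not> conc m (V' \<inter> L) c1"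
    unfolding C_def by blast
  \<comment> \<open>\<open>C\<close> collects the levels at which concentration fails on some
    portion of V. No level below \<open>Inf C\<close> fails anywhere, whereas \<open>c1\<close>
    fails on V' and lies below \<open>Inf C\<close> + \<theta>/2; the level \<open>Inf C\<close> -
    \<theta>/2 keeps \<theta>/2 away from both.\<close>
  show ?thesis
  proof (rule that[of V' "Inf C - \<theta>/2"])
    show "c0 - \<theta> \<le> Inf C - \<theta>/2" using cInf_greatest[OF ne lb] \<theta> by simp
    show "conc m (V'' \<inter> L) (Inf C - \<theta>/2)" if "open V''" "V'' \<subseteq> V'" "V'' \<inter> L \<noteq> {}" for V''
    proof (rule ccontr)
      assume "\<not> conc m (V'' \<inter> L) (Inf C - \<theta>/2)"
      then have "Inf C - \<theta>/2 \<in> C" unfolding C_def using that V' by blast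
      then show False using cInf_lower[OF _ bdd] \<theta> by fastforce
    qed
    show "\<not> conc m (V' \<inter> L) (Inf C - \<theta>/2 + \<theta>)" using V'(4) c1(2) conc_mono by (smt (verit) order_refl field_sum_of_halves)
  qed (use V' in auto)
qed

text \<open>A node carries its function \<phi>, which keeps mass a at all points of V \<inter> L,
  and a level c that is almost optimal: on V \<inter> L nothing nearly invisible to S receives more
  than c + \<theta>, yet concentration at level c survives on every smaller portion. The strict
  inequality \<open>tvs S \<phi> < \<kappa>\<close> leaves room for taking the maximum of \<phi>
  with a further function.\<close>

definition node :: "('k \<Rightarrow>\<^sub>C real) \<Rightarrow> 'k set \<Rightarrow> real \<Rightarrow> real \<Rightarrow>
    'k set \<times> ('k \<Rightarrow> real) \<times> 'k set \<times> real \<times> real \<Rightarrow> bool" where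
  "node h L \<theta> a = (\<lambda>(V, \<phi>, S, \<kappa>, c). open V \<and> V \<inter> L \<noteq> {} \<and> test \<phi> \<and> finite S \<and> tvs S \<phi> < \<kappa> \<and>
     (\<forall>t\<in>V \<inter> L. a < nu h t \<phi>) \<and>
     (\<forall>\<psi>. \<forall>t\<in>V \<inter> L. test \<psi> \<longrightarrow> tvs S \<psi> < \<kappa> \<longrightarrow> nu h t \<psi> \<le> c + \<theta>) \<and>
     (\<forall>V'. open V' \<longrightarrow> V' \<subseteq> V \<longrightarrow> V' \<inter> L \<noteq> {} \<longrightarrow> conc (nu h) (V' \<inter> L) c))"

abbreviation node_fun :: "'k set \<times> ('k \<Rightarrow> real) \<times> 'k set \<times> real \<times> real \<Rightarrow> 'k \<Rightarrow> real" where
  "node_fun n \<equiv> fst (snd n)"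

lemma not_concD:
  assumes "\<not> conc m V c"
  obtains S \<kappa> where "finite S" "0 < \<kappa>" "\<And>\<phi> t. test \<phi> \<Longrightarrow> t \<in> V \<Longrightarrow> tvs S \<phi> < \<kappa> \<Longrightarrow> m t \<phi> \<le> c"
  using assms unfolding conc_def by (meson not_less)

lemma nu_le_norm:
  assumes h: "\<And>x. \<bar>apply_bcontfun h x\<bar> \<le> 1" and "test \<phi>"
  shows "nu h t \<phi> \<le> norm T"
proof -
  have "\<bar>nu h t \<phi>\<bar> \<le> tv t (\<lambda>_. 1)" using assms by (intro abs_nu_le_tv) (auto simp: test_def)
  then show ?thesis using tvnorm_le[of t] unfolding tvnorm_def by linarith
qed

text \<open>Let \<psi> have mass > c at a point t and be nearly invisible to S. Then max \<phi>
  \<psi> is still admissible for the bound c + \<theta>, so by modularity min \<phi> \<psi> keeps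
  mass a + c - (c + \<theta>) = a - \<theta> at t. N such pairs are chosen; making the minima
  disjoint costs at most one more \<theta>. The portion \<open>V1\<close>, with its finer tolerance
  \<theta>', is fixed beforehand and shared by all children.\<close>

lemma node_split:
  fixes N :: nat
  assumes h: "\<And>x. \<bar>apply_bcontfun h x\<bar> \<le> 1"
    and conc: "\<And>V. open V \<Longrightarrow> V \<inter> L \<noteq> {} \<Longrightarrow> conc (nu h) (V \<inter> L) c0"
    and \<theta>: "0 < \<theta>" "0 < \<theta>'" and n: "node h L \<theta> a n"
  shows "\<exists>f. (\<forall>i<N. node h L \<theta>' (a - 2 * \<theta>) (f i) \<and> fst (f i) \<subseteq> fst n \<and> (\<forall>x. node_fun (f i) x \<le> node_fun n x)) \<and>
    (\<forall>i<N. \<forall>j<N. i \<noteq> j \<longrightarrow> (\<forall>x. node_fun (f i) x = 0 \<or> node_fun (f j) x = 0))"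
proof -
  obtain V \<phi> S \<kappa> c where n_eq: "n = (V, \<phi>, S, \<kappa>, c)" by (metis surj_pair)
  have V: "open V" "V \<inter> L \<noteq> {}" and \<phi>: "test \<phi>" and S: "finite S" "tvs S \<phi> < \<kappa>"
    and a: "\<And>t. t \<in> V \<inter> L \<Longrightarrow> a < nu h t \<phi>"
    and up: "\<And>\<psi> t. t \<in> V \<inter> L \<Longrightarrow> test \<psi> \<Longrightarrow> tvs S \<psi> < \<kappa> \<Longrightarrow> nu h t \<psi> \<le> c + \<theta>"
    and cc: "\<And>V'. open V' \<Longrightarrow> V' \<subseteq> V \<Longrightarrow> V' \<inter> L \<noteq> {} \<Longrightarrow> conc (nu h) (V' \<inter> L) c"
    using n unfolding node_def n_eq by auto
  obtain V1 c1 where V1: "open V1" "V1 \<subseteq> V" "V1 \<inter> L \<noteq> {}"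
    and cc1: "\<And>V''. open V'' \<Longrightarrow> V'' \<subseteq> V1 \<Longrightarrow> V'' \<inter> L \<noteq> {} \<Longrightarrow> conc (nu h) (V'' \<inter> L) c1"
    and nc1: "\<not> conc (nu h) (V1 \<inter> L) (c1 + \<theta>')"
    using stable_concentration[OF nu_le_norm[OF h] conc V \<theta>(2)] by (metis (no_types, lifting))
  obtain S1 \<kappa>1 where S1: "finite S1" "0 < \<kappa>1"
    and up1: "\<And>\<psi> t. test \<psi> \<Longrightarrow> t \<in> V1 \<inter> L \<Longrightarrow> tvs S1 \<psi> < \<kappa>1 \<Longrightarrow> nu h t \<psi> \<le> c1 + \<theta>'"
    using not_concD[OF nc1] by metis
  define M where "M = norm T + 1"
  have M: "M > 0" "norm T \<le> M" unfolding M_def by (auto simp: add_nonneg_pos)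
  \<comment> \<open>The correction \<open>R\<close> below has mass at most M \<sigma> = \<theta>/4
    from its constant term, and at most (N + 1) \<rho>/\<sigma> = \<theta>/4 from the later
    functions, whose mass at the point in question is at most \<rho>.\<close>
  define \<sigma> where "\<sigma> = \<theta> / (4 * M)"
  have \<sigma>: "\<sigma> > 0" unfolding \<sigma>_def using \<theta> M by simp
  define \<rho> where "\<rho> = \<theta> * \<sigma> / (4 * (real N + 1))"
  have \<rho>: "\<rho> > 0" unfolding \<rho>_def using \<theta> \<sigma> by simp
  define \<kappa>' where "\<kappa>' = Min {\<kappa> - tvs S \<phi>, \<kappa>1, \<rho>}"
  have \<kappa>': "\<kappa>' > 0" "\<kappa>' \<le> \<kappa> - tvs S \<phi>" "\<kappa>' \<le> \<kappa>1" "\<kappa>' \<le> \<rho>" unfolding \<kappa>'_def using S S1 \<rho> by auto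
  \<comment> \<open>Every function is almost invisible at the points chosen before it. At its own
    point only the later functions are known to be small, so the disjointification may subtract only
    later functions.\<close>
  have "\<exists>p. test (snd p) \<and> fst p \<in> V1 \<inter> L \<and> tvs (S \<union> S1 \<union> fst ` set xs) (snd p) < \<kappa>' \<and> c < nu h (fst p) (snd p)"
    for xs :: "('k \<times> ('k \<Rightarrow> real)) list"
    using concD[OF cc[OF V1], of "S \<union> S1 \<union> fst ` set xs" \<kappa>'] S S1 \<kappa>' by fastforce
  then obtain g :: "nat \<Rightarrow> 'k \<times> ('k \<Rightarrow> real)" where g:
    "\<And>i. test (snd (g i)) \<and> fst (g i) \<in> V1 \<inter> L \<and> tvs (S \<union> S1 \<union> fst ` set (map g [0..<i])) (snd (g i)) < \<kappa>'
      \<and> c < nu h (fst (g i)) (snd (g i))"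
    using history_choice[of "\<lambda>xs p. test (snd p) \<and> fst p \<in> V1 \<inter> L \<and> tvs (S \<union> S1 \<union> fst ` set xs) (snd p) < \<kappa>'
      \<and> c < nu h (fst p) (snd p)"] by metis
  define t where "t i = fst (g i)" for i
  define \<psi> where "\<psi> i = snd (g i)" for i
  have \<psi>: "test (\<psi> i)" and t: "t i \<in> V1 \<inter> L" and nu: "c < nu h (t i) (\<psi> i)" for i
    using g[of i] unfolding t_def \<psi>_def by auto
  have small: "tvs S' (\<psi> i) < \<kappa>'" if "S' \<subseteq> S \<union> S1 \<union> t ` {..<i}" for S' i
  proof -
    have "S \<union> S1 \<union> fst ` set (map g [0..<i]) = S \<union> S1 \<union> t ` {..<i}" unfolding t_def by force
    then have "tvs (S \<union> S1 \<union> t ` {..<i}) (\<psi> i) < \<kappa>'" using g[of i] unfolding \<psi>_def by simp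
    moreover have "tvs S' (\<psi> i) \<le> tvs (S \<union> S1 \<union> t ` {..<i}) (\<psi> i)"
      by (rule tvs_mono_set[OF \<psi> _ that]) (use S S1 in simp)
    ultimately show ?thesis by linarith
  qed
  \<comment> \<open>Let i < j. Where \<open>\<psi> j\<close> > \<sigma>, \<open>R i\<close> exceeds
    1 and \<open>\<phi>' i\<close> vanishes; where \<open>\<psi> j\<close> \<le> \<sigma>,
    \<open>R j\<close> \<ge> \<sigma> makes \<open>\<phi>' j\<close> vanish.\<close>
  define R where "R i x = \<sigma> + 1/\<sigma> * (\<Sum>j\<in>{i<..<N}. \<psi> j x)" for i x
  define \<phi>' where "\<phi>' i x = max 0 (min (\<phi> x) (\<psi> i x) - R i x)" for i x
  have R0: "0 \<le> R i x" and Rc: "continuous_on UNIV (R i)" for i x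
    unfolding R_def using \<sigma> \<psi>
    by (auto intro!: add_nonneg_nonneg mult_nonneg_nonneg divide_nonneg_pos sum_nonneg continuous_intros dest: testD)
  have \<phi>'_le: "\<phi>' i x \<le> \<phi> x" "\<phi>' i x \<le> \<psi> i x" "0 \<le> \<phi>' i x" for i x
    unfolding \<phi>'_def using R0[of i x] testD(2)[OF \<phi>, of x] testD(2)[OF \<psi>, of i x] by auto
  have c\<phi>': "continuous_on UNIV (\<phi>' i)" for i
    unfolding \<phi>'_def using \<phi> \<psi>[of i] by (auto intro!: continuous_intros Rc dest: testD)
  have test': "test (\<phi>' i)" for i
    unfolding test_def using \<phi>'_le[of i] testD(3)[OF \<phi>] c\<phi>' order_trans by blast
  have disj: "\<phi>' i x = 0 \<or> \<phi>' j x = 0" if ij: "i < j" "j < N" for i j x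
  proof (rule ccontr)
    assume "\<not> ?thesis"
    then have p: "\<phi>' i x > 0" "\<phi>' j x > 0" using \<phi>'_le(3) by (auto simp: order_le_less)
    then have 1: "R i x < 1" unfolding \<phi>'_def using testD(3)[OF \<phi>, of x] by auto
    have 2: "\<sigma> < \<psi> j x"
    proof -
      have "0 \<le> 1/\<sigma> * (\<Sum>k\<in>{j<..<N}. \<psi> k x)"
        using \<sigma> \<psi> by (intro mult_nonneg_nonneg sum_nonneg) (auto dest: testD)
      then show ?thesis using p(2) unfolding \<phi>'_def R_def by auto
    qed
    have "\<psi> j x \<le> (\<Sum>k\<in>{i<..<N}. \<psi> k x)" using ij \<psi> by (intro member_le_sum) (auto dest: testD)
    then have "\<psi> j x / \<sigma> \<le> R i x" unfolding R_def using \<sigma> by (simp add: divide_right_mono add_increasing)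
    moreover have "1 < \<psi> j x / \<sigma>" using 2 \<sigma> by simp
    ultimately show False using 1 by linarith
  qed
  have est: "a - 2 * \<theta> < nu h (t i) (\<phi>' i)" if i: "i < N" for i
  proof -
    let ?m = "\<lambda>x. min (\<phi> x) (\<psi> i x)"
    have tm: "test ?m" by (rule test_min[OF \<phi> \<psi>])
    have tmx: "test (\<lambda>x. max (\<phi> x) (\<psi> i x))" by (rule test_max[OF \<phi> \<psi>])
    have "tvs S (\<lambda>x. max (\<phi> x) (\<psi> i x)) \<le> tvs S \<phi> + tvs S (\<psi> i)" by (rule tvs_max[OF \<phi> \<psi>])
    also have "\<dots> < \<kappa>" using small[of S i, OF le_supI1[OF Un_upper1]] \<kappa>'(2) by linarith
    finally have "nu h (t i) (\<lambda>x. max (\<phi> x) (\<psi> i x)) \<le> c + \<theta>" using up[OF _ tmx] t[of i] V1(2) by auto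
    moreover have "a < nu h (t i) \<phi>" using a t[of i] V1(2) by auto
    ultimately have 1: "a - \<theta> < nu h (t i) ?m"
      using nu_max_min[OF testD(1)[OF \<phi>] testD(1)[OF \<psi>], of h "t i" i] nu[of i] by linarith
    have "\<bar>nu h (t i) (\<lambda>x. ?m x - \<phi>' i x)\<bar> \<le> tv (t i) (R i)"
    proof (rule abs_nu_le_tv[OF h])
      show "continuous_on UNIV (\<lambda>x. ?m x - \<phi>' i x)" using tm c\<phi>' by (intro continuous_on_diff) (auto dest: testD(1))
      fix x show "\<bar>?m x - \<phi>' i x\<bar> \<le> R i x"
        using testD(2)[OF tm, of x] R0[of i x] unfolding \<phi>'_def by (auto simp: abs_if max_def)
    qed (rule Rc)
    also have "tv (t i) (R i) = tv (t i) (\<lambda>_. \<sigma>) + 1/\<sigma> * (\<Sum>j\<in>{i<..<N}. tv (t i) (\<psi> j))"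
    proof -
      have s: "continuous_on UNIV (\<lambda>x. \<Sum>j\<in>{i<..<N}. \<psi> j x)" "\<And>x. 0 \<le> (\<Sum>j\<in>{i<..<N}. \<psi> j x)"
        using \<psi> by (auto intro!: continuous_intros sum_nonneg dest: testD)
      have "tv (t i) (R i) = tv (t i) (\<lambda>_. \<sigma>) + tv (t i) (\<lambda>x. 1/\<sigma> * (\<Sum>j\<in>{i<..<N}. \<psi> j x))"
        unfolding R_def using s \<sigma> by (intro tv_add) (auto intro!: continuous_intros)
      also have "tv (t i) (\<lambda>x. 1/\<sigma> * (\<Sum>j\<in>{i<..<N}. \<psi> j x)) = 1/\<sigma> * tv (t i) (\<lambda>x. \<Sum>j\<in>{i<..<N}. \<psi> j x)"
        using s \<sigma> by (intro tv_scale) auto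
      also have "tv (t i) (\<lambda>x. \<Sum>j\<in>{i<..<N}. \<psi> j x) = (\<Sum>j\<in>{i<..<N}. tv (t i) (\<psi> j))"
        using \<psi> by (intro tv_sum) (auto dest: testD)
      finally show ?thesis .
    qed
    also have "tv (t i) (\<lambda>_. \<sigma>) \<le> M * \<sigma>"
    proof -
      have "tv (t i) (\<lambda>_. \<sigma>) \<le> norm T * \<sigma>" using \<sigma> by (intro tv_bound) auto
      also have "\<dots> \<le> M * \<sigma>" using \<sigma> M by simp
      finally show ?thesis .
    qed
    also have "M * \<sigma> = \<theta> / 4" unfolding \<sigma>_def using M by simp
    also have "1/\<sigma> * (\<Sum>j\<in>{i<..<N}. tv (t i) (\<psi> j)) \<le> \<theta> / 4"
    proof -
      have "tv (t i) (\<psi> j) \<le> \<rho>" if "j \<in> {i<..<N}" for j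
      proof -
        have "tvs {t i} (\<psi> j) < \<kappa>'" by (rule small) (use that in auto)
        then show ?thesis using \<kappa>'(4) by (simp add: tvs_def)
      qed
      then have "(\<Sum>j\<in>{i<..<N}. tv (t i) (\<psi> j)) \<le> real (card {i<..<N}) * \<rho>" by (intro sum_bounded_above)
      also have "\<dots> \<le> (real N + 1) * \<rho>" using \<rho> by (intro mult_right_mono) auto
      also have "\<dots> = \<theta> * \<sigma> / 4" unfolding \<rho>_def by (simp add: divide_simps)
      finally show ?thesis using \<sigma> by (simp add: field_simps)
    qed
    finally have "\<bar>nu h (t i) (\<lambda>x. ?m x - \<phi>' i x)\<bar> \<le> \<theta> / 4 + \<theta> / 4" by simp
    moreover have "nu h (t i) (\<lambda>x. ?m x - \<phi>' i x) = nu h (t i) ?m - nu h (t i) (\<phi>' i)"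
      by (rule nu_diff[OF testD(1)[OF tm] c\<phi>'])
    ultimately show ?thesis using 1 \<theta>(1) by linarith
  qed
  define f where "f i = (V1 \<inter> {s. a - 2 * \<theta> < nu h s (\<phi>' i)}, \<phi>' i, S1, \<kappa>1, c1)" for i
  have "node h L \<theta>' (a - 2 * \<theta>) (f i)" if i: "i < N" for i
    unfolding f_def node_def prod.case
  proof (intro conjI allI ballI impI)
    show "open (V1 \<inter> {s. a - 2 * \<theta> < nu h s (\<phi>' i)})" by (intro open_Int V1 open_nu_gt)
    show "V1 \<inter> {s. a - 2 * \<theta> < nu h s (\<phi>' i)} \<inter> L \<noteq> {}" using t[of i] est[OF i] by blast
    have "tvs S1 (\<phi>' i) \<le> tvs S1 (\<psi> i)" by (rule tvs_mono[OF \<psi>]) (use \<phi>'_le in auto)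
    also have "\<dots> < \<kappa>1" using small[of S1 i, OF le_supI1[OF Un_upper2]] \<kappa>'(3) by linarith
    finally show "tvs S1 (\<phi>' i) < \<kappa>1" .
    show "conc (nu h) (V' \<inter> L) c1" if "open V'" "V' \<subseteq> V1 \<inter> {s. a - 2 * \<theta> < nu h s (\<phi>' i)}" "V' \<inter> L \<noteq> {}" for V'
      using cc1[of V'] that by auto
  qed (use test' S1 up1 in auto)
  moreover have "\<phi>' i x = 0 \<or> \<phi>' j x = 0" if "i < N" "j < N" "i \<noteq> j" for i j x
    using disj[of i j x] disj[of j i x] that by (cases "i < j") auto
  ultimately show ?thesis
    by (intro exI[of _ f]) (use \<phi>'_le V1(2) in \<open>auto simp: f_def n_eq\<close>)
qed

end

subsection \<open>Trees of functions\<close>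

text \<open>A node lists the indices of the children chosen on the way from the root to it, the last choice
  first, so that \<open>i # s\<close> is a child of \<open>s\<close> and \<open>w @ u\<close> is a descendant of \<open>u\<close>.\<close>

fun valid :: "(nat \<Rightarrow> nat) \<Rightarrow> nat list \<Rightarrow> bool" where
  "valid N [] = True"
| "valid N (i # s) = (i < N (length s) \<and> valid N s)"

lemma valid_append: "valid N (w @ s) \<Longrightarrow> valid N s"
  by (induction w) auto

locale function_tree =
  fixes N :: "nat \<Rightarrow> nat" and \<phi> :: "nat list \<Rightarrow> 'k::topological_space \<Rightarrow> real" and k :: "nat list \<Rightarrow> 'c"
  assumes cont: "valid N s \<Longrightarrow> continuous_on UNIV (\<phi> s)"
    and nonneg: "valid N s \<Longrightarrow> 0 \<le> \<phi> s x"
    and le_one: "valid N s \<Longrightarrow> \<phi> s x \<le> 1"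
    and child_le: "valid N (i # s) \<Longrightarrow> \<phi> (i # s) x \<le> \<phi> s x"
    and disjoint: "valid N (i # s) \<Longrightarrow> valid N (j # s) \<Longrightarrow> i \<noteq> j \<Longrightarrow> \<phi> (i # s) x = 0 \<or> \<phi> (j # s) x = 0"
begin

text \<open>\<open>H f n s\<close> is the Abel-summed form of the telescoping sum of \<open>(f (k u) - f (k u')) * \<phi> u\<close>
  over the nodes \<open>u\<close> at most \<open>n\<close> levels below \<open>s\<close>, with \<open>u'\<close> the parent of \<open>u\<close>: at each point it is
  a convex combination, along a single branch, of values of \<open>f\<close>.\<close>

primrec H :: "('c \<Rightarrow> real) \<Rightarrow> nat \<Rightarrow> nat list \<Rightarrow> 'k \<Rightarrow> real" where
  "H f 0 s x = f (k s) * \<phi> s x"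
| "H f (Suc n) s x = f (k s) * (\<phi> s x - (\<Sum>i<N (length s). \<phi> (i # s) x)) + (\<Sum>i<N (length s). H f n (i # s) x)"

text \<open>Siblings have disjoint functions, so at x at most one child matters and both sums
  collapse to one term. The vanishing of \<open>H\<close> at children with \<phi> = 0 is a premise
  because the induction for \<open>H_bound\<close> supplies it from its own hypothesis.\<close>

lemma H_step:
  assumes s: "valid N s" and z: "\<And>i. i < N (length s) \<Longrightarrow> \<phi> (i # s) x = 0 \<Longrightarrow> H f n (i # s) x = 0"
  obtains "\<And>i. i < N (length s) \<Longrightarrow> \<phi> (i # s) x = 0" "H f (Suc n) s x = f (k s) * \<phi> s x"
  | i where "i < N (length s)" "\<And>j. j < N (length s) \<Longrightarrow> j \<noteq> i \<Longrightarrow> \<phi> (j # s) x = 0"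
    "H f (Suc n) s x = f (k s) * (\<phi> s x - \<phi> (i # s) x) + H f n (i # s) x"
proof (cases "\<exists>i<N (length s). \<phi> (i # s) x \<noteq> 0")
  case False
  then show ?thesis using that(1) z by simp
next
  case True
  then obtain i where i: "i < N (length s)" "\<phi> (i # s) x \<noteq> 0" by blast
  have o: "\<phi> (j # s) x = 0" if "j < N (length s)" "j \<noteq> i" for j
    using disjoint[of i s j x] i that s by auto
  have "(\<Sum>j<N (length s). \<phi> (j # s) x) = (\<Sum>j\<in>{i}. \<phi> (j # s) x)"
    using i o by (intro sum.mono_neutral_right) auto
  moreover have "(\<Sum>j<N (length s). H f n (j # s) x) = (\<Sum>j\<in>{i}. H f n (j # s) x)"
    using i o z by (intro sum.mono_neutral_right) auto
  ultimately show ?thesis using that(2)[OF i(1) o] by simp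
qed

text \<open>Along the branch through x the weights of the values of f are the successive decrements
  of \<phi>; they are nonnegative and telescope to \<open>\<phi> s x\<close>.\<close>

lemma H_bound:
  assumes "valid N s" "\<And>w. valid N (w @ s) \<Longrightarrow> \<bar>f (k (w @ s)) - c\<bar> \<le> r"
  shows "\<bar>H f n s x - c * \<phi> s x\<bar> \<le> r * \<phi> s x"
  using assms
proof (induction n arbitrary: s)
  case 0
  have "\<bar>H f 0 s x - c * \<phi> s x\<bar> = \<bar>f (k s) - c\<bar> * \<phi> s x"
    using nonneg[OF 0(1), of x] by (simp add: abs_mult flip: left_diff_distrib)
  also have "\<dots> \<le> r * \<phi> s x" using 0(2)[of "[]"] 0(1) nonneg[OF 0(1), of x] by (intro mult_right_mono) auto
  finally show ?case .
next
  case (Suc n)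
  have IH: "\<bar>H f n (i # s) x - c * \<phi> (i # s) x\<bar> \<le> r * \<phi> (i # s) x" if "i < N (length s)" for i
  proof (rule Suc.IH)
    show "valid N (i # s)" using that Suc.prems by simp
    show "\<bar>f (k (w @ i # s)) - c\<bar> \<le> r" if "valid N (w @ i # s)" for w
      using Suc.prems(2)[of "w @ [i]"] that by simp
  qed
  have r: "\<bar>f (k s) - c\<bar> \<le> r" using Suc.prems(2)[of "[]"] Suc.prems(1) by simp
  show ?case
  proof (rule H_step[OF Suc.prems(1), of x f n])
    show "H f n (i # s) x = 0" if "i < N (length s)" "\<phi> (i # s) x = 0" for i
      using IH[OF that(1)] that(2) by simp
  next
    assume "H f (Suc n) s x = f (k s) * \<phi> s x"
    then have "\<bar>H f (Suc n) s x - c * \<phi> s x\<bar> = \<bar>f (k s) - c\<bar> * \<phi> s x"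
      using nonneg[OF Suc.prems(1), of x] by (simp add: abs_mult flip: left_diff_distrib)
    also have "\<dots> \<le> r * \<phi> s x" using r nonneg[OF Suc.prems(1), of x] by (intro mult_right_mono) auto
    finally show ?thesis .
  next
    fix i assume i: "i < N (length s)" and e: "H f (Suc n) s x = f (k s) * (\<phi> s x - \<phi> (i # s) x) + H f n (i # s) x"
    have d: "0 \<le> \<phi> s x - \<phi> (i # s) x" using child_le[of i s x] i Suc.prems(1) by simp
    have "\<bar>H f (Suc n) s x - c * \<phi> s x\<bar> =
      \<bar>(f (k s) - c) * (\<phi> s x - \<phi> (i # s) x) + (H f n (i # s) x - c * \<phi> (i # s) x)\<bar>"
      unfolding e by (simp add: algebra_simps)
    also have "\<dots> \<le> \<bar>f (k s) - c\<bar> * (\<phi> s x - \<phi> (i # s) x) + \<bar>H f n (i # s) x - c * \<phi> (i # s) x\<bar>"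
      using d abs_triangle_ineq by (metis abs_mult abs_of_nonneg)
    also have "\<dots> \<le> r * (\<phi> s x - \<phi> (i # s) x) + r * \<phi> (i # s) x"
      using r d by (intro add_mono mult_right_mono IH i)
    finally show ?thesis by (simp add: algebra_simps)
  qed
qed

lemma H_bound0:
  assumes "valid N s" "\<And>c. \<bar>f c\<bar> \<le> B"
  shows "\<bar>H f n s x\<bar> \<le> B * \<phi> s x"
  using H_bound[of s f 0 B n x] assms by simp

lemma H_zero: "valid N s \<Longrightarrow> \<phi> s x = 0 \<Longrightarrow> H f n s x = 0"
proof (induction n arbitrary: s)
  case (Suc n)
  have z: "\<phi> (i # s) x = 0" if "i < N (length s)" for i
    using child_le[of i s x] nonneg[of "i # s" x] that Suc.prems by auto
  then show ?case using Suc by simp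
qed simp

text \<open>Truncations at levels n and n + m differ only below level n, where f has almost stopped
  varying. The errors add up without loss since the functions of the children sum to at most
  \<open>\<phi> s\<close>.\<close>

lemma H_cauchy:
  assumes "valid N s" "0 \<le> r"
    "\<And>u w. valid N (w @ u @ s) \<Longrightarrow> length u = n \<Longrightarrow> \<bar>f (k (w @ u @ s)) - f (k (u @ s))\<bar> \<le> r"
  shows "\<bar>H f (n + m) s x - H f n s x\<bar> \<le> r * \<phi> s x"
  using assms
proof (induction n arbitrary: s)
  case 0
  then show ?case using H_bound[of s f "f (k s)" r m x] by simp
next
  case (Suc n)
  have IH: "\<bar>H f (n + m) (i # s) x - H f n (i # s) x\<bar> \<le> r * \<phi> (i # s) x" if "i < N (length s)" for i
  proof (rule Suc.IH)
    show "valid N (i # s)" using that Suc.prems by simp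
    show "\<bar>f (k (w @ u @ i # s)) - f (k (u @ i # s))\<bar> \<le> r"
      if "valid N (w @ u @ i # s)" "length u = n" for w u
      using Suc.prems(3)[of w "u @ [i]"] that by simp
  qed (rule Suc.prems)
  have eq: "H f (Suc n + m) s x - H f (Suc n) s x = (\<Sum>i<N (length s). H f (n + m) (i # s) x - H f n (i # s) x)"
    by (simp add: sum_subtractf)
  have le: "(\<Sum>i<N (length s). \<phi> (i # s) x) \<le> \<phi> s x"
  proof (rule H_step[OF Suc.prems(1), of x "\<lambda>_. 0" 0])
    assume "\<And>i. i < N (length s) \<Longrightarrow> \<phi> (i # s) x = 0"
    then show ?thesis using nonneg[OF Suc.prems(1)] by simp
  next
    fix i assume i: "i < N (length s)" "\<And>j. j < N (length s) \<Longrightarrow> j \<noteq> i \<Longrightarrow> \<phi> (j # s) x = 0"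
    then have "(\<Sum>j<N (length s). \<phi> (j # s) x) = (\<Sum>j\<in>{i}. \<phi> (j # s) x)"
      by (intro sum.mono_neutral_right) auto
    then show ?thesis using child_le[of i s x] i(1) Suc.prems(1) by simp
  qed simp
  have "\<bar>H f (Suc n + m) s x - H f (Suc n) s x\<bar> \<le> (\<Sum>i<N (length s). r * \<phi> (i # s) x)"
    unfolding eq by (rule order_trans[OF sum_abs]) (intro sum_mono IH, simp)
  also have "\<dots> \<le> r * \<phi> s x" using le Suc.prems(2) by (simp add: mult_left_mono flip: sum_distrib_left)
  finally show ?case .
qed

lemma append_le: "valid N (w @ s) \<Longrightarrow> \<phi> (w @ s) x \<le> \<phi> s x"
proof (induction w)
  case (Cons i w)
  then show ?case using child_le[of i "w @ s" x] by fastforce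
qed simp

text \<open>The nodes strictly above \<open>w @ s\<close> receive total weight
  \<open>\<phi> s x - \<phi> (w @ s) x\<close>, charged with the trivial bound B; the remaining
  weight sits on values of f close to the one at \<open>w @ s\<close>. The estimate is good wherever
  \<phi> hardly decreases along the path.\<close>

lemma H_node:
  assumes "valid N (w @ s)" "\<And>c. \<bar>f c\<bar> \<le> B"
    "\<And>v. valid N (v @ w @ s) \<Longrightarrow> \<bar>f (k (v @ w @ s)) - f (k (w @ s))\<bar> \<le> r"
  shows "\<bar>H f (length w + m) s x - f (k (w @ s)) * \<phi> (w @ s) x\<bar>
    \<le> B * (\<phi> s x - \<phi> (w @ s) x) + r * \<phi> (w @ s) x"
  using assms
proof (induction w arbitrary: s rule: rev_induct)
  case Nil
  then show ?case using H_bound[of s f "f (k s)" r m x] by simp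
next
  case (snoc i w)
  have v: "valid N (w @ i # s)" using snoc.prems(1) by simp
  then have vi: "valid N (i # s)" by (rule valid_append)
  then have vs: "valid N s" by simp
  show ?case
  proof (cases "\<phi> (w @ i # s) x = 0")
    case True
    then show ?thesis using H_bound0[OF vs, of f B "length (w @ [i]) + m" x] snoc.prems(2) by simp
  next
    case False
    then have pos: "\<phi> (i # s) x > 0"
      using append_le[OF v, of x] nonneg[OF v, of x] by simp
    have e: "H f (Suc (length w + m)) s x = f (k s) * (\<phi> s x - \<phi> (i # s) x) + H f (length w + m) (i # s) x"
    proof (rule H_step[OF vs, of x f "length w + m"])
      show "H f (length w + m) (j # s) x = 0" if "j < N (length s)" "\<phi> (j # s) x = 0" for j
        using H_zero[of "j # s" x f] that vs by simp
    next
      assume "\<And>j. j < N (length s) \<Longrightarrow> \<phi> (j # s) x = 0"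
      then show ?thesis using pos vi by fastforce
    next
      fix j assume "\<And>i. i < N (length s) \<Longrightarrow> i \<noteq> j \<Longrightarrow> \<phi> (i # s) x = 0"
        and e: "H f (Suc (length w + m)) s x = f (k s) * (\<phi> s x - \<phi> (j # s) x) + H f (length w + m) (j # s) x"
      then have "i = j" using pos vi by fastforce
      then show ?thesis using e by simp
    qed
    have IH: "\<bar>H f (length w + m) (i # s) x - f (k (w @ i # s)) * \<phi> (w @ i # s) x\<bar>
      \<le> B * (\<phi> (i # s) x - \<phi> (w @ i # s) x) + r * \<phi> (w @ i # s) x"
      using snoc.IH[of "i # s"] snoc.prems by simp
    have d: "0 \<le> \<phi> s x - \<phi> (i # s) x" using child_le[OF vi] by simp
    have "\<bar>f (k s) * (\<phi> s x - \<phi> (i # s) x)\<bar> \<le> B * (\<phi> s x - \<phi> (i # s) x)"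
      unfolding abs_mult using d snoc.prems(2) by (simp add: mult_right_mono)
    then show ?thesis using IH e by (simp add: algebra_simps)
  qed
qed

lemma H_cont: "valid N s \<Longrightarrow> continuous_on UNIV (H f n s)"
proof (induction n arbitrary: s)
  case 0
  then show ?case using cont by (auto intro!: continuous_intros)
next
  case (Suc n)
  then show ?case by (auto intro!: continuous_intros cont)
qed

lemma H_add: "H (\<lambda>c. f c + g c) n s x = H f n s x + H g n s x"
  by (induction n arbitrary: s) (auto simp: algebra_simps sum.distrib)

lemma H_cmult: "H (\<lambda>c. a * f c) n s x = a * H f n s x"
  by (induction n arbitrary: s) (auto simp: algebra_simps sum_distrib_left)

text \<open>The limit exists, uniformly in x, as soon as for every r > 0 f varies by at most r below
  some level of the tree; this replaces continuity of f.\<close>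

definition J :: "('c \<Rightarrow> real) \<Rightarrow> 'k \<Rightarrow> real" where
  "J f x = lim (\<lambda>n. H f n [] x)"

definition settled :: "('c \<Rightarrow> real) \<Rightarrow> real \<Rightarrow> nat \<Rightarrow> bool" where
  "settled f r n \<longleftrightarrow> (\<forall>u w. valid N (w @ u) \<longrightarrow> length u = n \<longrightarrow> \<bar>f (k (w @ u)) - f (k u)\<bar> \<le> r)"

lemma H_uniform:
  assumes "settled f r n" "0 \<le> r"
  shows "\<bar>H f (n + m) [] x - H f n [] x\<bar> \<le> r"
proof -
  have "\<bar>H f (n + m) [] x - H f n [] x\<bar> \<le> r * \<phi> [] x"
    using assms by (intro H_cauchy) (auto simp: settled_def)
  also have "\<dots> \<le> r" using assms(2) le_one[of "[]" x] by (simp add: mult_left_le)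
  finally show ?thesis .
qed

lemma H_tendsto_J:
  assumes "\<And>r. 0 < r \<Longrightarrow> \<exists>n. settled f r n"
  shows "(\<lambda>n. H f n [] x) \<longlonglongrightarrow> J f x"
proof -
  have "Cauchy (\<lambda>n. H f n [] x)"
  proof (rule metric_CauchyI)
    fix e :: real assume e: "e > 0"
    then obtain n where n: "settled f (e/3) n" using assms[of "e/3"] by auto
    have a: "\<bar>H f p [] x - H f n [] x\<bar> \<le> e/3" if "p \<ge> n" for p
      using H_uniform[OF n, of "p - n" x] that e by simp
    have "dist (H f p [] x) (H f q [] x) < e" if "p \<ge> n" "q \<ge> n" for p q
      using a[OF that(1)] a[OF that(2)] e unfolding dist_real_def by linarith
    then show "\<exists>M. \<forall>m\<ge>M. \<forall>n\<ge>M. dist (H f m [] x) (H f n [] x) < e" by blast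
  qed
  then show ?thesis unfolding J_def by (simp add: Cauchy_convergent_iff convergent_LIMSEQ_iff)
qed

lemma J_near_H:
  assumes "\<And>r. 0 < r \<Longrightarrow> \<exists>n. settled f r n" "settled f r n" "0 \<le> r"
  shows "\<bar>J f x - H f n [] x\<bar> \<le> r"
proof (rule tendsto_le[OF _ tendsto_const])
  have "(\<lambda>m. H f (n + m) [] x) \<longlonglongrightarrow> J f x"
    using LIMSEQ_ignore_initial_segment[OF H_tendsto_J[OF assms(1), of x], of n] by (simp add: add.commute)
  then show "(\<lambda>m. \<bar>H f (n + m) [] x - H f n [] x\<bar>) \<longlonglongrightarrow> \<bar>J f x - H f n [] x\<bar>"
    by (intro tendsto_intros)
qed (use H_uniform[OF assms(2,3)] in auto)

lemma J_cont:
  assumes "\<And>r. 0 < r \<Longrightarrow> \<exists>n. settled f r n"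
  shows "continuous_on UNIV (J f)"
proof (rule uniform_limit_theorem)
  show "uniform_limit UNIV (\<lambda>n. H f n []) (J f) sequentially"
    unfolding uniform_limit_iff
  proof (intro allI impI)
    fix e :: real assume e: "e > 0"
    then obtain n where n: "settled f (e/3) n" using assms[of "e/3"] by auto
    have a: "\<bar>H f p [] x - H f n [] x\<bar> \<le> e/3" if "p \<ge> n" for p x
      using H_uniform[OF n, of "p - n" x] that e by simp
    have b: "\<bar>J f x - H f n [] x\<bar> \<le> e/3" for x using J_near_H[OF assms n, of x] e by simp
    have "dist (H f p [] x) (J f x) < e" if "p \<ge> n" for p x
      using a[OF that, of x] b[of x] e unfolding dist_real_def by linarith
    then show "\<forall>\<^sub>F n in sequentially. \<forall>x\<in>UNIV. dist (H f n [] x) (J f x) < e"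
      unfolding eventually_sequentially by blast
  qed
qed (use H_cont in auto)

lemma J_add:
  assumes "\<And>r. 0 < r \<Longrightarrow> \<exists>n. settled f r n" "\<And>r. 0 < r \<Longrightarrow> \<exists>n. settled g r n"
  shows "J (\<lambda>c. f c + g c) x = J f x + J g x"
  unfolding J_def[of "\<lambda>c. f c + g c"] H_add
  by (rule limI) (intro tendsto_intros H_tendsto_J assms)

lemma J_cmult:
  assumes "\<And>r. 0 < r \<Longrightarrow> \<exists>n. settled f r n"
  shows "J (\<lambda>c. a * f c) x = a * J f x"
  unfolding J_def[of "\<lambda>c. a * f c"] H_cmult
  by (rule limI) (intro tendsto_intros H_tendsto_J assms)

lemma J_bound:
  assumes "\<And>r. 0 < r \<Longrightarrow> \<exists>n. settled f r n" "\<And>c. \<bar>f c\<bar> \<le> B"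
  shows "\<bar>J f x\<bar> \<le> B * \<phi> [] x"
  by (rule tendsto_le[OF _ tendsto_const tendsto_rabs[OF H_tendsto_J]])
    (use assms H_bound0 in auto)

lemma J_node:
  assumes "\<And>r. 0 < r \<Longrightarrow> \<exists>n. settled f r n" "\<And>c. \<bar>f c\<bar> \<le> B" "settled f r (length w)" "valid N w"
  shows "\<bar>J f x - f (k w) * \<phi> w x\<bar> \<le> B * (\<phi> [] x - \<phi> w x) + r * \<phi> w x"
proof (rule tendsto_le[OF _ tendsto_const])
  have "(\<lambda>m. H f (length w + m) [] x) \<longlonglongrightarrow> J f x"
    using LIMSEQ_ignore_initial_segment[OF H_tendsto_J[OF assms(1), of x], of "length w"] by (simp add: add.commute)
  then show "(\<lambda>m. \<bar>H f (length w + m) [] x - f (k w) * \<phi> w x\<bar>) \<longlonglongrightarrow> \<bar>J f x - f (k w) * \<phi> w x\<bar>"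
    by (intro tendsto_intros)
  have "\<bar>H f (length w + m) [] x - f (k w) * \<phi> w x\<bar> \<le> B * (\<phi> [] x - \<phi> w x) + r * \<phi> w x" for m
    using H_node[of w "[]" f B r m x] assms by (auto simp: settled_def)
  then show "\<forall>\<^sub>F m in sequentially. \<bar>H f (length w + m) [] x - f (k w) * \<phi> w x\<bar> \<le> B * (\<phi> [] x - \<phi> w x) + r * \<phi> w x"
    by simp
qed simp

end

section \<open>The tree produced by persistent concentration\<close>

context ck_operator
begin

text \<open>At depth n the tolerance is \<theta>/2^n and a split loses twice that, so the total loss
  stays below 4 \<theta>; the mass kept at depth n is c - 4 \<theta> + 4 \<theta>/2^n. The open sets
  of all nodes lie in that of the root, so the bound c + \<theta> for the root holds at the very
  point where the deep node keeps more than c - 4 \<theta>. Hence little mass is lost between the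
  two.\<close>

lemma concentration_tree:
  fixes N :: "nat \<Rightarrow> nat"
  assumes h: "\<And>x. \<bar>apply_bcontfun h x\<bar> \<le> 1" and L: "L \<noteq> {}"
    and conc: "\<And>V. open V \<Longrightarrow> V \<inter> L \<noteq> {} \<Longrightarrow> conc (nu h) (V \<inter> L) c0"
    and \<theta>: "0 < \<theta>"
  obtains \<phi> :: "nat list \<Rightarrow> 'k \<Rightarrow> real" and c where "c0 - \<theta> \<le> c"
    "\<And>s. valid N s \<Longrightarrow> test (\<phi> s)"
    "\<And>i s x. valid N (i # s) \<Longrightarrow> \<phi> (i # s) x \<le> \<phi> s x"
    "\<And>i j s x. valid N (i # s) \<Longrightarrow> valid N (j # s) \<Longrightarrow> i \<noteq> j \<Longrightarrow> \<phi> (i # s) x = 0 \<or> \<phi> (j # s) x = 0"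
    "\<And>s. valid N s \<Longrightarrow> \<exists>t\<in>L. c - 4 * \<theta> < nu h t (\<phi> s) \<and> nu h t (\<phi> []) \<le> c + \<theta>"
proof -
  obtain V1 c where V1: "open V1" "V1 \<inter> L \<noteq> {}" and c: "c0 - \<theta> \<le> c"
    and cc1: "\<And>V''. open V'' \<Longrightarrow> V'' \<subseteq> V1 \<Longrightarrow> V'' \<inter> L \<noteq> {} \<Longrightarrow> conc (nu h) (V'' \<inter> L) c"
    and nc1: "\<not> conc (nu h) (V1 \<inter> L) (c + \<theta>)"
    using stable_concentration[OF nu_le_norm[OF h] conc open_UNIV _ \<theta>] L by (metis (no_types, lifting) inf_top_left)
  obtain S \<kappa> where S: "finite S" "0 < \<kappa>"
    and up: "\<And>\<psi> t. test \<psi> \<Longrightarrow> t \<in> V1 \<inter> L \<Longrightarrow> tvs S \<psi> < \<kappa> \<Longrightarrow> nu h t \<psi> \<le> c + \<theta>"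
    using not_concD[OF nc1] by metis
  obtain \<psi> t where \<psi>: "test \<psi>" "t \<in> V1 \<inter> L" "tvs S \<psi> < \<kappa>" "c < nu h t \<psi>"
    using concD[OF cc1[OF V1(1) order_refl V1(2)] S] by blast
  define root where "root = (V1 \<inter> {s. c < nu h s \<psi>}, \<psi>, S, \<kappa>, c)"
  have root: "node h L (\<theta> / 2^0) (c - 4 * \<theta> + 4 * \<theta> / 2^0) root"
    unfolding root_def node_def prod.case
    using V1(1) \<psi> S up cc1 open_nu_gt by (auto intro!: open_Int)
  define Q where "Q n m f \<longleftrightarrow> (\<forall>i<N n. node h L (\<theta> / 2^Suc n) (c - 4 * \<theta> + 4 * \<theta> / 2^Suc n) (f i)
      \<and> fst (f i) \<subseteq> fst m \<and> (\<forall>x. node_fun (f i) x \<le> node_fun m x)) \<and>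
    (\<forall>i<N n. \<forall>j<N n. i \<noteq> j \<longrightarrow> (\<forall>x. node_fun (f i) x = 0 \<or> node_fun (f j) x = 0))" for n m f
  \<comment> \<open>All children of a node come from one choice of the whole family f, since
    disjointness concerns siblings jointly.\<close>
  define tr where "tr = rec_list root (\<lambda>i s m. (SOME f. Q (length s) m f) i)"
  have tr: "tr [] = root" "tr (i # s) = (SOME f. Q (length s) (tr s) f) i" for i s
    unfolding tr_def by auto
  have Q: "Q (length s) (tr s) (\<lambda>i. tr (i # s))" if "node h L (\<theta> / 2^length s) (c - 4 * \<theta> + 4 * \<theta> / 2^length s) (tr s)" for s
  proof -
    have e: "c - 4 * \<theta> + 4 * \<theta> / 2^length s - 2 * (\<theta> / 2^length s) = c - 4 * \<theta> + 4 * \<theta> / 2^Suc (length s)"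
      by simp
    have "\<exists>f. Q (length s) (tr s) f"
      unfolding Q_def e[symmetric] by (rule node_split[OF h conc _ _ that]) (use \<theta> in auto)
    then have "Q (length s) (tr s) (SOME f. Q (length s) (tr s) f)" by (rule someI_ex)
    then show ?thesis unfolding tr .
  qed
  have nodes: "node h L (\<theta> / 2^length s) (c - 4 * \<theta> + 4 * \<theta> / 2^length s) (tr s) \<and> fst (tr s) \<subseteq> fst root"
    if "valid N s" for s
    using that
  proof (induction s)
    case Nil
    then show ?case using root tr by simp
  next
    case (Cons i s)
    then show ?case using Q[of s] unfolding Q_def by auto
  qed
  show ?thesis
  proof (rule that[of c "\<lambda>s. node_fun (tr s)"])
    show "test (node_fun (tr s))" if "valid N s" for s
      using nodes[OF that] unfolding node_def by (auto split: prod.splits)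
    show "node_fun (tr (i # s)) x \<le> node_fun (tr s) x" if "valid N (i # s)" for i s x
      using Q[of s] nodes[of s] that unfolding Q_def by auto
    show "node_fun (tr (i # s)) x = 0 \<or> node_fun (tr (j # s)) x = 0"
      if "valid N (i # s)" "valid N (j # s)" "i \<noteq> j" for i j s x
      using Q[of s] nodes[of s] that unfolding Q_def by auto
    show "\<exists>t\<in>L. c - 4 * \<theta> < nu h t (node_fun (tr s)) \<and> nu h t (node_fun (tr [])) \<le> c + \<theta>" if "valid N s" for s
    proof -
      obtain V \<phi> S' \<kappa>' c' where e: "tr s = (V, \<phi>, S', \<kappa>', c')" by (metis surj_pair)
      have n: "node h L (\<theta> / 2^length s) (c - 4 * \<theta> + 4 * \<theta> / 2^length s) (tr s)" and sub: "V \<subseteq> V1"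
        using nodes[OF that] unfolding e root_def by auto
      obtain t where t: "t \<in> V \<inter> L" using n unfolding e node_def by auto
      have "c - 4 * \<theta> + 4 * \<theta> / 2^length s < nu h t \<phi>" using n t unfolding e node_def by auto
      moreover have "0 < 4 * \<theta> / 2^length s" using \<theta> by simp
      ultimately have "c - 4 * \<theta> < nu h t \<phi>" by linarith
      moreover have "nu h t \<psi> \<le> c + \<theta>" using up[OF \<psi>(1) _ \<psi>(3)] t sub by auto
      ultimately show ?thesis using t unfolding tr e root_def by auto
    qed
  qed (rule c)
qed

end

section \<open>Finite nets and trees of points\<close>

lemma metrizable_net:
  assumes "compact (UNIV :: 'k::topological_space set)" "metrizable_space (euclidean :: 'k::topological_space topology)"
  obtains d :: "'k::topological_space \<Rightarrow> 'k::topological_space \<Rightarrow> real" where "Metric_space UNIV d"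
    "\<And>f r. continuous_on UNIV (f :: 'k::topological_space \<Rightarrow> real) \<Longrightarrow> 0 < r \<Longrightarrow> \<exists>\<delta>>0. \<forall>x y. d x y < \<delta> \<longrightarrow> \<bar>f x - f y\<bar> < r"
    "\<And>r. 0 < r \<Longrightarrow> \<exists>N p. \<forall>x. \<exists>i<N::nat. d (p i) x < r"
proof -
  obtain M d where M: "Metric_space M d" and top: "(euclidean :: 'k topology) = Metric_space.mtopology M d"
    using assms(2) unfolding metrizable_space_def by blast
  have "M = UNIV" using Metric_space.topspace_mtopology[OF M] top by (metis topspace_euclidean)
  then interpret Metric_space UNIV d using M by simp
  have top: "mtopology = euclidean" using top \<open>M = UNIV\<close> by simp
  have comp: "compactin mtopology UNIV" using assms(1) top by (simp add: compactin_euclidean_iff)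
  show ?thesis
  proof (rule that[OF M[unfolded \<open>M = UNIV\<close>]])
    fix f :: "'k \<Rightarrow> real" and r :: real assume f: "continuous_on UNIV f" and r: "0 < r"
    define m where "m = metric (UNIV, d)"
    have m: "mspace m = UNIV" "mdist m = d"
      unfolding m_def by (simp_all add: Metric_space_axioms)
    have mt: "mtopology_of m = euclidean" unfolding mtopology_of_def m by (rule top)
    have "uniformly_continuous_map m euclidean_metric f"
      using f comp top
      by (intro continuous_imp_uniformly_continuous_map)
        (auto simp: mt mtopology_of_euclidean compact_space_def)
    then obtain \<delta> where "\<delta> > 0" "\<And>x y. d x y < \<delta> \<Longrightarrow> dist (f y) (f x) < r"
      unfolding uniformly_continuous_map_def m using r
      by (auto simp: commute)
    then show "\<exists>\<delta>>0. \<forall>x y. d x y < \<delta> \<longrightarrow> \<bar>f x - f y\<bar> < r"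
      by (metis abs_minus_commute dist_real_def)
  next
    fix r :: real assume "0 < r"
    then obtain K where K: "finite K" "UNIV \<subseteq> (\<Union>x\<in>K. mball x r)"
      using compactin_imp_mtotally_bounded[OF comp] unfolding mtotally_bounded_def by blast
    obtain p where p: "bij_betw p {0..<card K} K" using ex_bij_betw_nat_finite[OF K(1)] by blast
    have "\<exists>i<card K. d (p i) x < r" for x
    proof -
      obtain y where y: "y \<in> K" "d y x < r" using K(2) by (auto simp: mball_def)
      then obtain i where "i < card K" "p i = y" using p unfolding bij_betw_def by (metis atLeastLessThan_iff imageE)
      then show ?thesis using y by blast
    qed
    then show "\<exists>N p. \<forall>x. \<exists>i<N::nat. d (p i) x < r" by blast
  qed
qed

text \<open>Since \<open>'k\<close> carries no distance, closeness of points is measured by continuous functions.\<close>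

lemma dense_tree:
  assumes "compact (UNIV :: 'k::topological_space set)" "metrizable_space (euclidean :: 'k::topological_space topology)"
  obtains N and k :: "nat list \<Rightarrow> 'k::topological_space" where
    "\<And>f r. continuous_on UNIV (f :: 'k::topological_space \<Rightarrow> real) \<Longrightarrow> 0 < r \<Longrightarrow>
      \<exists>n. (\<forall>u w. valid N (w @ u) \<longrightarrow> length u = n \<longrightarrow> \<bar>f (k (w @ u)) - f (k u)\<bar> \<le> r) \<and>
          (\<forall>x. \<exists>u. valid N u \<and> length u = n \<and> \<bar>f (k u) - f x\<bar> \<le> r)"
proof -
  obtain d :: "'k \<Rightarrow> 'k \<Rightarrow> real" where d: "Metric_space UNIV d"
    and uc: "\<And>f r. continuous_on UNIV (f :: 'k \<Rightarrow> real) \<Longrightarrow> 0 < r \<Longrightarrow> \<exists>\<delta>>0. \<forall>x y. d x y < \<delta> \<longrightarrow> \<bar>f x - f y\<bar> < r"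
    and net: "\<And>r. 0 < r \<Longrightarrow> \<exists>N p. \<forall>x. \<exists>i<N::nat. d (p i) x < r"
    by (rule metrizable_net[OF assms]) blast
  interpret Metric_space UNIV d by (rule d)
  have "\<forall>n. \<exists>q. \<forall>x. \<exists>i<fst q::nat. d (snd q i) x < 1/2^n" using net by simp
  then obtain q where q: "\<And>n x. \<exists>i<fst (q n)::nat. d (snd (q n) i) x < 1/2^n" by (metis (no_types, lifting))
  define N where "N n = fst (q n)" for n
  define p where "p n = snd (q n)" for n
  have p: "\<exists>i<N n. d (p n i) x < 1/2^n" for n x using q unfolding N_def p_def .
  \<comment> \<open>A child takes the net point of its index only when that point is within 4/2^n of
    its parent's, and repeats the parent otherwise; so labels converge along branches. Level 0 has
    no constraint. The radius leaves room for approximation: if the parent is within 2/2^n of x, a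
    net point within 1/2^n of x is at distance at most 3/2^n from the parent.\<close>
  define k where "k = rec_list (p 0 0) (\<lambda>i s y. if s = [] \<or> d (p (length s) i) y < 4/2^length s then p (length s) i else y)"
  have k: "k (i # s) = (if s = [] \<or> d (p (length s) i) (k s) < 4/2^length s then p (length s) i else k s)" for i s
    unfolding k_def by simp
  have step: "d (k (i # s)) (k s) < 4/2^length s" if "s \<noteq> []" for i s
    using that unfolding k by (auto simp: mdist_zero)
  \<comment> \<open>8/2^n is the sum of the steps 4/2^l over l \<ge> n; the factor 1 - 1/2^(length
    w) makes the induction close.\<close>
  have far: "d (k (w @ u)) (k u) \<le> 8/2^length u * (1 - 1/2^length w)" if "u \<noteq> []" for w u :: "nat list"
  proof (induction w)
    case (Cons i w)
    have "d (k ((i # w) @ u)) (k u) \<le> d (k (i # (w @ u))) (k (w @ u)) + d (k (w @ u)) (k u)"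
      using triangle[of "k (i # (w @ u))" "k (w @ u)" "k u"] by simp
    also have "\<dots> \<le> 4/2^length (w @ u) + 8/2^length u * (1 - 1/2^length w)"
      using step[of "w @ u" i] Cons that by simp
    also have "\<dots> = 8/2^length u * (1 - 1/2^length (i # w))"
      by (simp add: field_simps power_add)
    finally show ?case .
  qed simp
  have near: "\<exists>u. valid N u \<and> length u = Suc n \<and> d (k u) x < 2/2^Suc n" for n x
  proof (induction n)
    case 0
    obtain i where "i < N 0" "d (p 0 i) x < 1/2^0" using p[of 0 x] by blast
    then show ?case by (intro exI[of _ "[i]"]) (simp add: k)
  next
    case (Suc n)
    then obtain u where u: "valid N u" "length u = Suc n" "d (k u) x < 2/2^Suc n" by blast
    obtain i where i: "i < N (Suc n)" "d (p (Suc n) i) x < 1/2^Suc n" using p[of "Suc n" x] by blast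
    have "d (p (Suc n) i) (k u) \<le> d (p (Suc n) i) x + d (k u) x"
      using triangle[of "p (Suc n) i" x "k u"] commute[of x "k u"] by simp
    also have "\<dots> < 4/2^Suc n" using i u by (simp add: field_simps)
    finally have "k (i # u) = p (Suc n) i" unfolding k using u by simp
    then show ?case using u i by (intro exI[of _ "i # u"]) auto
  qed
  show ?thesis
  proof (rule that[of N k])
    fix f :: "'k \<Rightarrow> real" and r :: real assume "continuous_on UNIV f" "0 < r"
    then obtain \<delta> where \<delta>: "\<delta> > 0" "\<And>x y. d x y < \<delta> \<Longrightarrow> \<bar>f x - f y\<bar> < r" using uc by blast
    obtain n where "(1/2)^n < \<delta>/8" using real_arch_pow_inv[of "\<delta>/8" "1/2"] \<delta> by auto
    then have n: "8/2^Suc n < \<delta>" by (simp add: field_simps power_one_over)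
    show "\<exists>n. (\<forall>u w. valid N (w @ u) \<longrightarrow> length u = n \<longrightarrow> \<bar>f (k (w @ u)) - f (k u)\<bar> \<le> r) \<and>
          (\<forall>x. \<exists>u. valid N u \<and> length u = n \<and> \<bar>f (k u) - f x\<bar> \<le> r)"
    proof (intro exI[of _ "Suc n"] conjI allI impI)
      fix u w :: "nat list" assume u: "length u = Suc n"
      then have "d (k (w @ u)) (k u) \<le> 8/2^Suc n * (1 - 1/2^length w)" using far[of u w] by force
      also have "\<dots> \<le> 8/2^Suc n" by (intro mult_left_le) auto
      finally show "\<bar>f (k (w @ u)) - f (k u)\<bar> \<le> r" using \<delta>(2) n by (smt (verit))
    next
      fix x
      obtain u where u: "valid N u" "length u = Suc n" "d (k u) x < 2/2^Suc n" using near by blast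
      have "2/2^Suc n \<le> (8/2^Suc n :: real)" by (simp add: divide_right_mono)
      then have "d (k u) x < \<delta>" using u(3) n by linarith
      then show "\<exists>u. valid N u \<and> length u = Suc n \<and> \<bar>f (k u) - f x\<bar> \<le> r"
        using u \<delta>(2)[of "k u" x] by auto
    qed
  qed
qed

section \<open>From norm estimates to copies of C(K)\<close>

lemma bcontfun_complete:
  fixes X :: "nat \<Rightarrow> 'k::topological_space \<Rightarrow>\<^sub>C real"
  assumes "Cauchy X" obtains L where "X \<longlonglongrightarrow> L"
proof -
  have diff: "\<bar>X m x - X n x\<bar> \<le> norm (X m - X n)" for m n x
    using abs_le_norm_bcontfun[of "X m - X n" x] by simp
  have "Cauchy (\<lambda>n. X n x)" for x
  proof (rule metric_CauchyI)
    fix e :: real assume "e > 0"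
    then obtain M where "\<forall>m\<ge>M. \<forall>n\<ge>M. dist (X m) (X n) < e" using metric_CauchyD[OF assms] by blast
    then show "\<exists>M. \<forall>m\<ge>M. \<forall>n\<ge>M. dist (X m x) (X n x) < e"
      using diff by (metis dist_norm order_le_less_trans real_norm_def)
  qed
  then have "\<forall>x. \<exists>l. (\<lambda>n. X n x) \<longlonglongrightarrow> l" by (simp add: Cauchy_convergent_iff convergent_def)
  then obtain l where l: "\<And>x. (\<lambda>n. X n x) \<longlonglongrightarrow> l x" by metis
  have unif: "\<exists>M. \<forall>n\<ge>M. \<forall>x. \<bar>X n x - l x\<bar> \<le> e" if e: "e > 0" for e
  proof -
    obtain M where M: "\<And>m n. m \<ge> M \<Longrightarrow> n \<ge> M \<Longrightarrow> dist (X m) (X n) < e" using metric_CauchyD[OF assms e] by blast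
    have "\<bar>X n x - l x\<bar> \<le> e" if n: "n \<ge> M" for n x
    proof (rule tendsto_le[OF _ tendsto_const])
      show "(\<lambda>m. \<bar>X n x - X m x\<bar>) \<longlonglongrightarrow> \<bar>X n x - l x\<bar>" by (intro tendsto_intros l)
      show "\<forall>\<^sub>F m in sequentially. \<bar>X n x - X m x\<bar> \<le> e"
        unfolding eventually_sequentially using M[OF n] diff[of n x] by (metis dist_norm less_imp_le order.trans)
    qed simp
    then show ?thesis by blast
  qed
  have "continuous_on UNIV l"
  proof (rule uniform_limit_theorem)
    show "uniform_limit UNIV (\<lambda>n. apply_bcontfun (X n)) l sequentially"
      unfolding uniform_limit_iff eventually_sequentially dist_real_def
    proof (intro allI impI)
      fix e :: real assume e: "e > 0"
      then obtain M where "\<forall>n\<ge>M. \<forall>x. \<bar>X n x - l x\<bar> \<le> e/2" using unif[of "e/2"] by auto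
      moreover have "e/2 < e" using e by simp
      ultimately show "\<exists>M. \<forall>n\<ge>M. \<forall>x\<in>UNIV. \<bar>X n x - l x\<bar> < e"
        using order_le_less_trans by blast
    qed
  qed auto
  moreover obtain M where M: "\<And>x. \<bar>X M x - l x\<bar> \<le> 1" using unif[of 1] by auto
  have "norm (l x) \<le> norm (X M) + 1" for x
    using M[of x] abs_le_norm_bcontfun[of "X M" x] by auto
  ultimately have l': "apply_bcontfun (Bcontfun l) = l" by (intro Bcontfun_inverse bcontfun_normI)
  have "X \<longlonglongrightarrow> Bcontfun l"
  proof (rule LIMSEQ_I)
    fix e :: real assume e: "e > 0"
    then obtain M where M: "\<And>n x. n \<ge> M \<Longrightarrow> \<bar>X n x - l x\<bar> \<le> e/2" using unif[of "e/2"] by auto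
    have "norm (X n - Bcontfun l) < e" if "n \<ge> M" for n
    proof -
      have "norm (X n - Bcontfun l) \<le> e/2"
        by (rule norm_bcontfun_le) (use M[OF that] in \<open>simp add: l'\<close>)
      then show ?thesis using e by simp
    qed
    then show "\<exists>M. \<forall>n\<ge>M. norm (X n - Bcontfun l) < e" by blast
  qed
  then show ?thesis by (rule that)
qed

lemma into_isomorphism_onI:
  fixes F :: "'a::real_normed_vector \<Rightarrow> 'b::real_normed_vector"
  assumes "\<And>x y. x \<in> S \<Longrightarrow> y \<in> S \<Longrightarrow> norm (F x - F y) \<le> b * norm (x - y)"
    "\<And>x y. x \<in> S \<Longrightarrow> y \<in> S \<Longrightarrow> c * norm (x - y) \<le> norm (F x - F y)" "c > 0" "b \<ge> 0"
  shows "into_isomorphism_on S F"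
proof -
  have inj: "inj_on F S"
  proof (rule inj_onI)
    fix x y assume "x \<in> S" "y \<in> S" "F x = F y"
    then show "x = y" using assms(2)[of x y] assms(3) by (simp add: mult_le_0_iff)
  qed
  have "homeomorphism S (F ` S) F (inv_into S F)"
  proof (rule homeomorphismI)
    have "b-lipschitz_on S F" using assms by (intro lipschitz_onI) (auto simp: dist_norm)
    then show "continuous_on S F" by (rule lipschitz_on_continuous_on)
    have "(1/c)-lipschitz_on (F ` S) (inv_into S F)"
    proof (rule lipschitz_onI)
      fix u v assume "u \<in> F ` S" "v \<in> F ` S"
      then obtain x y where "x \<in> S" "y \<in> S" "u = F x" "v = F y" by blast
      then show "dist (inv_into S F u) (inv_into S F v) \<le> 1/c * dist u v"
        using assms(2)[of x y] assms(3) inj by (simp add: dist_norm field_simps)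
    qed (use assms in simp)
    then show "continuous_on (F ` S) (inv_into S F)" by (rule lipschitz_on_continuous_on)
  qed (use inj in auto)
  then show ?thesis unfolding into_isomorphism_on_def by blast
qed

text \<open>One lower bound for T composed with E serves twice: E is bounded below because T is
  bounded, and T is bounded below on the range because E does not increase norms. The range is
  closed by completeness of the domain of E.\<close>

lemma preserves_copyI:
  fixes T :: "('k::topological_space \<Rightarrow>\<^sub>C real) \<Rightarrow>\<^sub>L ('k \<Rightarrow>\<^sub>C real)"
    and E :: "('k \<Rightarrow>\<^sub>C real) \<Rightarrow> ('k \<Rightarrow>\<^sub>C real)"
  assumes lin: "linear E" and le: "\<And>f. norm (E f) \<le> norm f" and c: "c > 0" "\<And>f. c * norm f \<le> norm (T (E f))"
  shows "preserves_copy T TYPE('k \<Rightarrow>\<^sub>C real)"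
proof -
  interpret E: linear E by (rule lin)
  have le2: "c * norm f \<le> norm T * norm (E f)" for f
    using c(2)[of f] norm_blinfun[of T "E f"] by linarith
  have b: "c / (norm T + 1) * norm f \<le> norm (E f)" for f
  proof -
    have "norm T * norm (E f) \<le> (norm T + 1) * norm (E f)" by (simp add: mult_right_mono)
    then have "c * norm f \<le> (norm T + 1) * norm (E f)" using le2[of f] by linarith
    then show ?thesis by (simp add: pos_divide_le_eq add_nonneg_pos mult.commute)
  qed
  have pos: "c / (norm T + 1) > 0" using c(1) by (simp add: add_nonneg_pos)
  have "into_isomorphism_on UNIV E"
    using le b pos by (intro into_isomorphism_onI[where b = 1]) (auto simp flip: E.diff)
  then have 1: "isomorphic_to_subspace TYPE('k \<Rightarrow>\<^sub>C real) (range E)"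
    unfolding isomorphic_to_subspace_def using lin by blast
  have 2: "subspace (range E)" by (rule linear_subspace_image[OF lin subspace_UNIV])
  have 3: "into_isomorphism_on (range E) (blinfun_apply T)"
  proof (rule into_isomorphism_onI)
    fix x y assume "x \<in> range E" "y \<in> range E"
    then obtain f where f: "x - y = E f" by (auto simp flip: E.diff)
    show "norm (T x - T y) \<le> norm T * norm (x - y)" by (metis blinfun.diff_right norm_blinfun)
    have "c * norm (E f) \<le> c * norm f" using le c by simp
    then show "c * norm (x - y) \<le> norm (T x - T y)"
      using c(2)[of f] f by (metis blinfun.diff_right order_trans)
  qed (use c in auto)
  have 4: "closed (range E)"
    unfolding closed_sequential_limits
  proof (intro allI impI)
    fix x l assume "(\<forall>n. x n \<in> range E) \<and> x \<longlonglongrightarrow> l"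
    then have l: "x \<longlonglongrightarrow> l" and "\<forall>n. \<exists>g. x n = E g" by blast+
    then obtain f where "\<And>n. x n = E (f n)" by metis
    then have f: "x = (\<lambda>n. E (f n))" by blast
    have "Cauchy f"
    proof (rule metric_CauchyI)
      fix e :: real assume e: "e > 0"
      have "Cauchy x" using l by (rule LIMSEQ_imp_Cauchy)
      then obtain M where M: "\<And>m n. m \<ge> M \<Longrightarrow> n \<ge> M \<Longrightarrow> dist (x m) (x n) < c / (norm T + 1) * e"
        using metric_CauchyD[of x "c / (norm T + 1) * e"] pos e by (meson mult_pos_pos)
      have "dist (f m) (f n) < e" if "m \<ge> M" "n \<ge> M" for m n
      proof -
        have "c / (norm T + 1) * norm (f m - f n) \<le> norm (x m - x n)"
          using b[of "f m - f n"] unfolding f E.diff .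
        then have "c / (norm T + 1) * norm (f m - f n) < c / (norm T + 1) * e"
          using M[OF that] by (simp add: dist_norm)
        then show ?thesis using pos mult_less_cancel_left_pos unfolding dist_norm by blast
      qed
      then show "\<exists>M. \<forall>m\<ge>M. \<forall>n\<ge>M. dist (f m) (f n) < e" by blast
    qed
    then obtain g where g: "f \<longlonglongrightarrow> g" using bcontfun_complete by blast
    have "bounded_linear E" using lin le by (intro bounded_linear_intro[where K = 1]) (auto simp: E.add E.scale)
    then have "x \<longlonglongrightarrow> E g" unfolding f using g by (rule bounded_linear.tendsto)
    then show "l \<in> range E" using l LIMSEQ_unique by blast
  qed
  show ?thesis unfolding preserves_copy_def using 1 2 3 4 by blast
qed

context ck_operator
begin

text \<open>The embedding is f \<mapsto> h J f. At the point t of a node u the difference of the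
  functions at the root and at u has signed mass below (c + \<theta>) - (c - 4 \<theta>), hence
  total variation at most 5 \<theta> + \<gamma>. So T applied to h J f is at t, up to (5 \<theta> +
  \<gamma>) times the norm of f, the value of f at the label of u times a mass exceeding c - 4
  \<theta>. The resulting lower bound c - 9 \<theta> - \<gamma> is at least c0 - 10 \<theta> -
  \<gamma> \<ge> \<theta>.\<close>

lemma concentration_fixes_CK:
  assumes met: "metrizable_space (euclidean :: 'k topology)"
    and h: "\<And>x. \<bar>apply_bcontfun h x\<bar> \<le> 1" and L: "L \<noteq> {}"
    and near: "\<And>t \<phi>. t \<in> L \<Longrightarrow> test \<phi> \<Longrightarrow> tv t \<phi> \<le> nu h t \<phi> + \<gamma>"
    and conc: "\<And>V. open V \<Longrightarrow> V \<inter> L \<noteq> {} \<Longrightarrow> conc (nu h) (V \<inter> L) c0"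
    and \<theta>: "0 < \<theta>" and c0: "\<gamma> + 11 * \<theta> \<le> c0"
  shows "preserves_copy T TYPE('k \<Rightarrow>\<^sub>C real)"
proof -
  obtain N and k :: "nat list \<Rightarrow> 'k" where Nk:
    "\<And>f r. continuous_on UNIV (f :: 'k \<Rightarrow> real) \<Longrightarrow> 0 < r \<Longrightarrow>
      \<exists>n. (\<forall>u w. valid N (w @ u) \<longrightarrow> length u = n \<longrightarrow> \<bar>f (k (w @ u)) - f (k u)\<bar> \<le> r) \<and>
          (\<forall>x. \<exists>u. valid N u \<and> length u = n \<and> \<bar>f (k u) - f x\<bar> \<le> r)"
    by (rule dense_tree[OF compact_UNIV met]) auto
  obtain \<phi> :: "nat list \<Rightarrow> 'k \<Rightarrow> real" and c where c: "c0 - \<theta> \<le> c"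
    and \<phi>: "\<And>s. valid N s \<Longrightarrow> test (\<phi> s)"
    and mono: "\<And>i s x. valid N (i # s) \<Longrightarrow> \<phi> (i # s) x \<le> \<phi> s x"
    and disj: "\<And>i j s x. valid N (i # s) \<Longrightarrow> valid N (j # s) \<Longrightarrow> i \<noteq> j \<Longrightarrow> \<phi> (i # s) x = 0 \<or> \<phi> (j # s) x = 0"
    and tt: "\<And>s. valid N s \<Longrightarrow> \<exists>t\<in>L. c - 4 * \<theta> < nu h t (\<phi> s) \<and> nu h t (\<phi> []) \<le> c + \<theta>"
    by (rule concentration_tree[OF h L conc \<theta>, of N]; (assumption | (rule that; assumption)))
  interpret function_tree N \<phi> k
    using \<phi> mono disj by unfold_locales (auto simp: test_def)
  have settled: "\<exists>n. settled f r n" if "continuous_on UNIV f" "0 < r" for f r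
    using Nk[OF that] unfolding settled_def by blast
  have sb: "\<exists>n. settled (apply_bcontfun f) r n" if "0 < r" for f r
    using that by (intro settled continuous_on_apply_bcontfun)
  have Jc: "continuous_on UNIV (J (apply_bcontfun f))" for f by (intro J_cont sb)
  define E where "E f = Bcontfun (\<lambda>x. h x * J (apply_bcontfun f) x)" for f
  have E: "apply_bcontfun (E f) = (\<lambda>x. h x * J (apply_bcontfun f) x)" for f
    unfolding E_def by (rule Bc_mult[OF Jc])
  have lin: "linear E"
  proof (rule linearI)
    fix f g :: "'k \<Rightarrow>\<^sub>C real" and a :: real
    have "apply_bcontfun (f + g) = (\<lambda>x. f x + g x)" by auto
    then show "E (f + g) = E f + E g"
      by (intro bcontfun_eqI) (simp add: E J_add[OF sb sb] distrib_left)
    have "apply_bcontfun (a *\<^sub>R f) = (\<lambda>x. a * f x)" by auto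
    then show "E (a *\<^sub>R f) = a *\<^sub>R E f"
      by (intro bcontfun_eqI) (simp add: E J_cmult[OF sb])
  qed
  have le: "norm (E f) \<le> norm f" for f
  proof (rule norm_bcontfun_le)
    fix x
    have "\<bar>J (apply_bcontfun f) x\<bar> \<le> norm f * \<phi> [] x" by (rule J_bound[OF sb abs_le_norm_bcontfun])
    also have "\<dots> \<le> norm f" using le_one[of "[]" x] by (intro mult_left_le) auto
    finally have 1: "\<bar>J (apply_bcontfun f) x\<bar> \<le> norm f" .
    show "\<bar>E f x\<bar> \<le> norm f" unfolding E abs_mult using mult_mono[OF h[of x] 1] by simp
  qed
  have main: "(c - 9 * \<theta> - \<gamma>) * norm f \<le> norm (T (E f))" for f
  proof (rule field_le_epsilon)
    fix e :: real assume e: "e > 0"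
    define M where "M = norm T + \<bar>c\<bar> + \<theta> + 10"
    have M: "M > 0" "norm T \<le> M" "c + \<theta> \<le> M" unfolding M_def using \<theta> norm_ge_zero[of T] by linarith+
    \<comment> \<open>The choice of x and of the node costs 2 r (c - 4 \<theta>), the variation of f
      below the node costs r M; together at most 3 r M \<le> e.\<close>
    define r where "r = e / (4 * M)"
    have r: "r > 0" unfolding r_def using e M by simp
    have "\<exists>x. norm f - r < \<bar>f x\<bar>"
    proof (rule ccontr)
      assume "\<not> ?thesis"
      then have "norm f \<le> norm f - r" by (intro norm_bcontfun_le) (auto simp: not_less)
      then show False using r by simp
    qed
    then obtain x where x: "norm f - r < \<bar>f x\<bar>" by blast
    obtain n where n: "settled (apply_bcontfun f) r n"
      and "\<And>x. \<exists>u. valid N u \<and> length u = n \<and> \<bar>f (k u) - f x\<bar> \<le> r"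
      using Nk[OF continuous_on_apply_bcontfun[of UNIV f] r] unfolding settled_def by metis
    then obtain u where u: "valid N u" "length u = n" "\<bar>f (k u) - f x\<bar> \<le> r" by blast
    obtain t where t: "t \<in> L" "c - 4 * \<theta> < nu h t (\<phi> u)" "nu h t (\<phi> []) \<le> c + \<theta>" using tt[OF u(1)] by blast
    have cu: "continuous_on UNIV (\<phi> u)" "continuous_on UNIV (\<phi> [])" using cont u by auto
    have ule: "\<phi> u x \<le> \<phi> [] x" for x using append_le[of u "[]" x] u by simp
    have b: "\<bar>J (apply_bcontfun f) x - f (k u) * \<phi> u x\<bar> \<le> norm f * (\<phi> [] x - \<phi> u x) + r * \<phi> u x" for x
      by (rule J_node[OF sb abs_le_norm_bcontfun]) (use n u in auto)
    have td: "test (\<lambda>x. \<phi> [] x - \<phi> u x)"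
      unfolding test_def using cu ule nonneg[OF u(1)] le_one[of "[]"]
      by (auto intro!: continuous_on_diff simp: algebra_simps intro: order_trans add_increasing2)
    have tvd: "tv t (\<lambda>x. \<phi> [] x - \<phi> u x) \<le> 5 * \<theta> + \<gamma>"
      using near[OF t(1) td] nu_diff[OF cu(2,1), of h t] t by linarith
    have "\<bar>nu h t (\<lambda>x. J (apply_bcontfun f) x - f (k u) * \<phi> u x)\<bar>
      \<le> tv t (\<lambda>x. norm f * (\<phi> [] x - \<phi> u x) + r * \<phi> u x)"
      using b by (intro abs_nu_le_tv[OF h] continuous_intros Jc cu)
    also have "\<dots> = tv t (\<lambda>x. norm f * (\<phi> [] x - \<phi> u x)) + tv t (\<lambda>x. r * \<phi> u x)"
      using ule r nonneg[OF u(1)] by (intro tv_add continuous_intros cu) auto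
    also have "\<dots> = norm f * tv t (\<lambda>x. \<phi> [] x - \<phi> u x) + r * tv t (\<phi> u)"
      using ule r nonneg[OF u(1)] cu by (simp add: tv_scale continuous_on_diff)
    also have "\<dots> \<le> norm f * (5 * \<theta> + \<gamma>) + r * M"
    proof (intro add_mono mult_left_mono tvd)
      have "tv t (\<phi> u) \<le> norm T * 1" using nonneg[OF u(1)] le_one[OF u(1)] by (intro tv_bound)
      then show "tv t (\<phi> u) \<le> M" using M by simp
    qed (use r in auto)
    also have "nu h t (\<lambda>x. J (apply_bcontfun f) x - f (k u) * \<phi> u x) = nu h t (J (apply_bcontfun f)) - f (k u) * nu h t (\<phi> u)"
      using nu_diff[OF Jc continuous_on_mult_left[OF cu(1)], of h t f "f (k u)"] nu_cmult[OF cu(1)] by simp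
    finally have 1: "\<bar>f (k u) * nu h t (\<phi> u)\<bar> \<le> \<bar>nu h t (J (apply_bcontfun f))\<bar> + norm f * (5 * \<theta> + \<gamma>) + r * M"
      by linarith
    have g0: "\<gamma> \<ge> 0" using near[OF t(1), of "\<lambda>_. 0"] nu_cmult[of "\<lambda>_. 0" h t 0] by (simp add: test_def)
    have cpos: "0 \<le> c - 4 * \<theta>" using c c0 \<theta> g0 by linarith
    have cM: "c - 4 * \<theta> \<le> M" using M(3) \<theta> by linarith
    have "(norm f - 2 * r) * (c - 4 * \<theta>) \<le> \<bar>f (k u)\<bar> * (c - 4 * \<theta>)"
      using x u(3) cpos by (intro mult_right_mono) linarith+
    also have "\<dots> \<le> \<bar>f (k u)\<bar> * nu h t (\<phi> u)" using t by (intro mult_left_mono) auto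
    also have "\<dots> \<le> \<bar>f (k u) * nu h t (\<phi> u)\<bar>" unfolding abs_mult by (intro mult_left_mono) auto
    finally have "norm f * (c - 4 * \<theta>) - 2 * r * (c - 4 * \<theta>) \<le> \<bar>nu h t (J (apply_bcontfun f))\<bar> + norm f * (5 * \<theta> + \<gamma>) + r * M"
      using 1 by (simp add: algebra_simps)
    moreover have "2 * r * (c - 4 * \<theta>) \<le> 2 * r * M" using r cM by simp
    moreover have "3 * r * M \<le> e" unfolding r_def using M e by simp
    moreover have "\<bar>nu h t (J (apply_bcontfun f))\<bar> \<le> norm (T (E f))"
      unfolding nu_def E_def by (rule abs_le_norm_bcontfun)
    ultimately show "(c - 9 * \<theta> - \<gamma>) * norm f \<le> norm (T (E f)) + e" by (simp add: algebra_simps)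
  qed
  show ?thesis by (rule preserves_copyI[OF lin le _ main]) (use c c0 \<theta> in linarith)
qed

end

subsection \<open>Absence of concentration\<close>

text \<open>A transfinite derivation of D, with Zorn's lemma in place of ordinals: whenever D is not
  yet covered, a relatively open piece of the remainder D - U can be added, so a maximal U covers
  D.\<close>

lemma open_exhaustion:
  fixes D :: "'k::topological_space set"
  assumes empty: "P {}"
    and chain: "\<And>\<C>. \<C> \<noteq> {} \<Longrightarrow> subset.chain {U. open U \<and> P U} \<C> \<Longrightarrow> P (\<Union>\<C>)"
    and step: "\<And>U. open U \<Longrightarrow> P U \<Longrightarrow> D - U \<noteq> {} \<Longrightarrow> \<exists>V. open V \<and> V \<inter> (D - U) \<noteq> {} \<and> P (U \<union> V)"
  obtains U where "open U" "P U" "D \<subseteq> U"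
proof -
  have "\<exists>M\<in>{U. open U \<and> P U}. \<forall>X\<in>{U. open U \<and> P U}. M \<subseteq> X \<longrightarrow> X = M"
  proof (rule subset_Zorn_nonempty)
    show "{U. open U \<and> P U} \<noteq> {}" using empty by auto
    show "\<Union>\<C> \<in> {U. open U \<and> P U}" if "\<C> \<noteq> {}" "subset.chain {U. open U \<and> P U} \<C>" for \<C>
    proof -
      have "\<C> \<subseteq> {U. open U \<and> P U}" using that(2) unfolding subset.chain_def by blast
      then have "open (\<Union>\<C>)" by (intro open_Union) blast
      then show ?thesis using chain[OF that] by simp
    qed
  qed
  then obtain M where M: "open M" "P M" "\<And>X. open X \<Longrightarrow> P X \<Longrightarrow> M \<subseteq> X \<Longrightarrow> X = M" by blast
  have "D \<subseteq> M"
  proof (rule ccontr)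
    assume "\<not> D \<subseteq> M"
    then obtain V where "open V" "V \<inter> (D - M) \<noteq> {}" "P (M \<union> V)" using step[OF M(1,2)] by blast
    then show False using M(3)[of "M \<union> V"] M(1) by blast
  qed
  then show ?thesis using that M by blast
qed

lemma compact_subset_chain:
  assumes "compact C" "C \<subseteq> \<Union>\<C>" "\<C> \<noteq> {}" "subset.chain {U. open U \<and> P U} \<C>"
  shows "\<exists>X\<in>\<C>. C \<subseteq> X"
proof -
  have op: "\<And>X. X \<in> \<C> \<Longrightarrow> open X" using assms(4) unfolding subset.chain_def by blast
  have "\<exists>E. E \<subseteq> \<C> \<and> finite E \<and> C \<subseteq> \<Union>E"
    using assms(1)[unfolded compact_eq_Heine_Borel, rule_format, of \<C>] op assms(2) by blast
  then obtain E where E: "E \<subseteq> \<C>" "finite E" "C \<subseteq> \<Union>E" by (elim exE conjE)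
  have "finite E \<Longrightarrow> E \<subseteq> \<C> \<Longrightarrow> \<exists>X\<in>\<C>. \<Union>E \<subseteq> X"
  proof (induction E rule: finite_induct)
    case empty
    obtain X where "X \<in> \<C>" using assms(3) by (meson ex_in_conv)
    then show ?case by (intro bexI[of _ X]) simp_all
  next
    case (insert Y F)
    then have Y: "Y \<in> \<C>" and "F \<subseteq> \<C>" by simp_all
    then obtain X where X: "X \<in> \<C>" "\<Union>F \<subseteq> X" using insert.IH[OF \<open>F \<subseteq> \<C>\<close>] by (elim bexE)
    have "X \<subseteq> Y \<or> Y \<subseteq> X" using assms(4) X(1) Y unfolding subset.chain_def by blast
    then show ?case
    proof
      assume "X \<subseteq> Y"
      then have "\<Union>(insert Y F) \<subseteq> Y" using X(2) by blast
      then show ?thesis using Y by blast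
    next
      assume "Y \<subseteq> X"
      then have "\<Union>(insert Y F) \<subseteq> X" using X(2) by blast
      then show ?thesis using X(1) by blast
    qed
  qed
  then show ?thesis using E by (meson order_trans)
qed

text \<open>In a compact space each of the closed pieces is compact and therefore lies in a single
  member of any chain of open sets with union U; countably many members of the chain then
  suffice.\<close>

lemma open_ascending_closed:
  fixes U :: "'k::topological_space set"
  assumes "metrizable_space (euclidean :: 'k topology)" "open U"
  obtains C :: "nat \<Rightarrow> 'k set" where "\<And>n. closed (C n)" "\<And>n. C n \<subseteq> C (Suc n)" "(\<Union>n. C n) = U"
proof -
  have "fsigma_in euclidean U" using open_imp_fsigma_in[OF assms(1)] assms(2) by simp
  then obtain C where "\<forall>n. closedin euclidean (C n)" "\<forall>n. C n \<subseteq> C (Suc n)" "\<Union> (range C) = U"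
    unfolding fsigma_in_ascending by blast
  then show ?thesis using that[of C] by simp
qed

context ck_operator
begin

text \<open>The negation of \<open>conc tv A \<epsilon>\<close> with its witnesses exposed.\<close>

definition thin :: "real \<Rightarrow> 'k set \<Rightarrow> 'k set \<Rightarrow> real \<Rightarrow> bool" where
  "thin \<epsilon> A S \<kappa> \<longleftrightarrow> finite S \<and> 0 < \<kappa> \<and> (\<forall>\<phi> t. test \<phi> \<longrightarrow> t \<in> A \<longrightarrow> tvs S \<phi> < \<kappa> \<longrightarrow> tv t \<phi> \<le> \<epsilon>)"

lemma thin_mono: "thin \<epsilon> A S \<kappa> \<Longrightarrow> B \<subseteq> A \<Longrightarrow> thin \<epsilon> B S \<kappa>"
  unfolding thin_def by blast

text \<open>Otherwise L concentrates everywhere. A function h almost norming the measure at one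
  point of L still has value above a - \<epsilon>/100 on a neighbourhood, where the masses of L are
  at most a + \<epsilon>/100; so \<open>nu h\<close> replaces \<open>tv\<close> there up to 2
  \<epsilon>/100 and concentrates at level 98 \<epsilon>/100. With \<theta> = \<epsilon>/100 the
  embedding needs only 2 + 11 \<le> 98.\<close>

lemma exists_thin_part:
  assumes met: "metrizable_space (euclidean :: 'k topology)"
    and np: "\<not> preserves_copy T TYPE('k \<Rightarrow>\<^sub>C real)"
    and \<epsilon>: "0 < \<epsilon>" and L: "L \<noteq> {}" "\<And>t. t \<in> L \<Longrightarrow> a < tvnorm t \<and> tvnorm t \<le> a + \<epsilon>/100"
  shows "\<exists>V S \<kappa>. open V \<and> V \<inter> L \<noteq> {} \<and> thin \<epsilon> (V \<inter> L) S \<kappa>"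
proof (rule ccontr)
  assume contr: "\<not> ?thesis"
  have conc: "conc tv (V \<inter> L) \<epsilon>" if "open V" "V \<inter> L \<noteq> {}" for V
  proof (rule ccontr)
    assume "\<not> conc tv (V \<inter> L) \<epsilon>"
    then obtain S \<kappa> where "thin \<epsilon> (V \<inter> L) S \<kappa>" unfolding thin_def conc_def by (meson not_less)
    then show False using contr that by blast
  qed
  obtain t0 where t0: "t0 \<in> L" using L by blast
  have "a - \<epsilon>/100 < tv t0 (\<lambda>_. 1)" using L(2)[OF t0] \<epsilon> unfolding tvnorm_def by linarith
  then obtain h where h: "\<And>x. \<bar>apply_bcontfun h x\<bar> \<le> 1" "a - \<epsilon>/100 < T h t0"
    using tv_witness[of "\<lambda>_. 1" "a - \<epsilon>/100" t0] by auto
  define W where "W = {t. a - \<epsilon>/100 < T h t}"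
  have W: "open W" "t0 \<in> W" unfolding W_def using h open_T_gt by auto
  have near: "tv t \<phi> \<le> nu h t \<phi> + 2 * \<epsilon>/100" if "t \<in> W \<inter> L" "test \<phi>" for t \<phi>
    by (rule tv_le_nu[OF h(1) _ that(2)]) (use that(1) L(2)[of t] in \<open>auto simp: W_def\<close>)
  have "preserves_copy T TYPE('k \<Rightarrow>\<^sub>C real)"
  proof (rule concentration_fixes_CK[OF met h(1) _ near, of "W \<inter> L" "98 * \<epsilon>/100" "\<epsilon>/100"])
    show "W \<inter> L \<noteq> {}" using W t0 by blast
    show "conc (nu h) (V \<inter> (W \<inter> L)) (98 * \<epsilon>/100)" if "open V" "V \<inter> (W \<inter> L) \<noteq> {}" for V
      unfolding conc_def
    proof (intro allI impI)
      fix S :: "'k set" and \<kappa> :: real assume S: "finite S \<and> 0 < \<kappa>"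
      have "conc tv ((V \<inter> W) \<inter> L) \<epsilon>" by (rule conc) (use that W in auto)
      then obtain \<phi> t where p: "test \<phi>" "t \<in> (V \<inter> W) \<inter> L" "tvs S \<phi> < \<kappa>" "\<epsilon> < tv t \<phi>"
        using S by (auto elim: concD)
      then have "98 * \<epsilon>/100 < nu h t \<phi>" using near[of t \<phi>] by auto
      then show "\<exists>\<phi> t. test \<phi> \<and> t \<in> V \<inter> (W \<inter> L) \<and> tvs S \<phi> < \<kappa> \<and> 98 * \<epsilon>/100 < nu h t \<phi>"
        using p by blast
    qed
  qed (use \<epsilon> in auto)
  then show False using np by simp
qed

text \<open>Each thin portion needs a finite set S; the exhaustion keeps their union countable,
  because unions of chains are covered by countably many members. The property is required for all
  subsets L of the part of D treated so far, since later the exhaustion is repeated with remainders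
  D - U that are not known in advance.\<close>

lemma countable_thin_witnesses:
  assumes met: "metrizable_space (euclidean :: 'k topology)"
    and thin: "\<And>L. L \<noteq> {} \<Longrightarrow> L \<subseteq> D \<Longrightarrow> \<exists>V S \<kappa>. open V \<and> V \<inter> L \<noteq> {} \<and> thin \<epsilon> (V \<inter> L) S \<kappa>"
  obtains R where "countable R"
    "\<And>L. L \<noteq> {} \<Longrightarrow> L \<subseteq> D \<Longrightarrow> \<exists>V S \<kappa>. open V \<and> V \<inter> L \<noteq> {} \<and> S \<subseteq> R \<and> thin \<epsilon> (V \<inter> L) S \<kappa>"
proof -
  define P where "P U R \<longleftrightarrow> countable R \<and> (\<forall>L. L \<noteq> {} \<longrightarrow> L \<subseteq> D \<inter> U \<longrightarrow>
    (\<exists>V S \<kappa>. open V \<and> V \<inter> L \<noteq> {} \<and> S \<subseteq> R \<and> thin \<epsilon> (V \<inter> L) S \<kappa>))" for U R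
  have "\<exists>U. open U \<and> (\<exists>R. P U R) \<and> D \<subseteq> U"
  proof (rule open_exhaustion[of "\<lambda>U. \<exists>R. P U R" D])
    show "\<exists>R. P {} R" by (intro exI[of _ "{}"]) (auto simp: P_def)
  next
    fix \<C> assume ne: "\<C> \<noteq> {}" and ch: "subset.chain {U. open U \<and> (\<exists>R. P U R)} \<C>"
    then have op: "open X" "\<exists>R. P X R" if "X \<in> \<C>" for X using that by (auto simp: subset.chain_def)
    have "open (\<Union>\<C>)" using op by blast
    then obtain C :: "nat \<Rightarrow> 'k set" where C: "\<And>n. closed (C n)" "\<And>n. C n \<subseteq> C (Suc n)" "(\<Union>n. C n) = \<Union>\<C>"
      by (rule open_ascending_closed[OF met]) (rule that; assumption)
    have "\<exists>X R. X \<in> \<C> \<and> C n \<subseteq> X \<and> P X R" for n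
    proof -
      have "compact (C n)" using C(1) compact_UNIV by (metis closed_Int_compact inf_top.right_neutral)
      moreover have "C n \<subseteq> \<Union>\<C>" unfolding C(3)[symmetric] by blast
      ultimately have "\<exists>X\<in>\<C>. C n \<subseteq> X" by (rule compact_subset_chain[OF _ _ ne ch])
      then show ?thesis using op by blast
    qed
    then obtain X R where XR: "\<And>n. X n \<in> \<C>" "\<And>n. C n \<subseteq> X n" "\<And>n. P (X n) (R n)" by metis
    have "P (\<Union>\<C>) (\<Union>n. R n)"
      unfolding P_def
    proof (intro conjI allI impI)
      show "countable (\<Union>n. R n)" using XR(3) unfolding P_def by auto
      fix L assume L: "L \<noteq> {}" "L \<subseteq> D \<inter> \<Union>\<C>"
      then obtain n where n: "L \<inter> X n \<noteq> {}" using C(3) XR(2) by blast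
      have "L \<inter> X n \<subseteq> D \<inter> X n" using L(2) by blast
      then have "\<exists>V S \<kappa>. open V \<and> V \<inter> (L \<inter> X n) \<noteq> {} \<and> S \<subseteq> R n \<and> thin \<epsilon> (V \<inter> (L \<inter> X n)) S \<kappa>"
        using XR(3)[of n, unfolded P_def, THEN conjunct2, rule_format, of "L \<inter> X n"] n by simp
      then obtain V S \<kappa> where V: "open V" "V \<inter> (L \<inter> X n) \<noteq> {}" "S \<subseteq> R n" "thin \<epsilon> (V \<inter> (L \<inter> X n)) S \<kappa>"
        by (elim exE conjE)
      then show "\<exists>V S \<kappa>. open V \<and> V \<inter> L \<noteq> {} \<and> S \<subseteq> (\<Union>n. R n) \<and> thin \<epsilon> (V \<inter> L) S \<kappa>"
        using op(1)[OF XR(1)] by (intro exI[of _ "V \<inter> X n"] exI[of _ S] exI[of _ \<kappa>]) (auto simp: Int_ac)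
    qed
    then show "\<exists>R. P (\<Union>\<C>) R" by blast
  next
    fix U assume U: "open U" "\<exists>R. P U R" "D - U \<noteq> {}"
    then obtain R where R: "P U R" by blast
    obtain V S \<kappa> where V: "open V" "V \<inter> (D - U) \<noteq> {}" "thin \<epsilon> (V \<inter> (D - U)) S \<kappa>"
      using thin[OF U(3)] by blast
    have "P (U \<union> V) (R \<union> S)"
      unfolding P_def
    proof (intro conjI allI impI)
      show "countable (R \<union> S)" using R V(3) by (auto simp: P_def thin_def countable_finite)
      fix L assume L: "L \<noteq> {}" "L \<subseteq> D \<inter> (U \<union> V)"
      \<comment> \<open>If L avoids U, it lies entirely in the new thin portion. Otherwise the
        witnesses for L \<inter> U work for L once their open set is intersected with U.\<close>
      show "\<exists>V S'  \<kappa>. open V \<and> V \<inter> L \<noteq> {} \<and> S' \<subseteq> R \<union> S \<and> thin \<epsilon> (V \<inter> L) S' \<kappa>"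
      proof (cases "L \<inter> U = {}")
        case True
        then have "V \<inter> L = L" "L \<subseteq> V \<inter> (D - U)" using L by auto
        then have "thin \<epsilon> (V \<inter> L) S \<kappa>" using V(3) thin_mono by auto
        then show ?thesis using V(1) L(1) \<open>V \<inter> L = L\<close> by blast
      next
        case False
        have "L \<inter> U \<subseteq> D \<inter> U" using L(2) by blast
        then have "\<exists>V' S' \<kappa>'. open V' \<and> V' \<inter> (L \<inter> U) \<noteq> {} \<and> S' \<subseteq> R \<and> thin \<epsilon> (V' \<inter> (L \<inter> U)) S' \<kappa>'"
          using R[unfolded P_def, THEN conjunct2, rule_format, of "L \<inter> U"] False by simp
        then obtain V' S' \<kappa>' where V': "open V'" "V' \<inter> (L \<inter> U) \<noteq> {}" "S' \<subseteq> R" "thin \<epsilon> (V' \<inter> (L \<inter> U)) S' \<kappa>'"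
          by (elim exE conjE)
        then show ?thesis
          using U(1) by (intro exI[of _ "V' \<inter> U"] exI[of _ S'] exI[of _ \<kappa>']) (auto simp: Int_ac)
      qed
    qed
    then show "\<exists>V. open V \<and> V \<inter> (D - U) \<noteq> {} \<and> (\<exists>R. P (U \<union> V) R)" using V by blast
  next
    fix U assume "open U" "\<exists>R. P U R" "D \<subseteq> U"
    then show "\<exists>U. open U \<and> (\<exists>R. P U R) \<and> D \<subseteq> U" by blast
  qed
  then obtain U R where "P U R" "D \<subseteq> U" by blast
  then have "countable R" and R: "\<And>L. L \<noteq> {} \<Longrightarrow> L \<subseteq> D \<inter> U \<Longrightarrow>
    \<exists>V S \<kappa>. open V \<and> V \<inter> L \<noteq> {} \<and> S \<subseteq> R \<and> thin \<epsilon> (V \<inter> L) S \<kappa>"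
    unfolding P_def by blast+
  have "D \<inter> U = D" using \<open>D \<subseteq> U\<close> by blast
  then show ?thesis using that[of R] \<open>countable R\<close> R by simp
qed

end

subsection \<open>Averages of blocks\<close>

text \<open>Maximality of the scale \<open>2 ^ j * C\<close> of the ratio \<open>G / \<beta>\<close> replaces a lower bound on that ratio
  by one that, up to a factor \<open>2\<close>, cannot be exceeded on subsets.\<close>

lemma extremal_subset:
  fixes G \<beta> :: "'i set \<Rightarrow> real"
  assumes \<beta>: "\<And>A. A \<subseteq> U \<Longrightarrow> 0 \<le> \<beta> A" "\<beta> U = m" and m: "0 < m"
    and C: "0 < C" and \<tau>: "0 < \<tau>" "\<tau> \<le> 1" "C \<le> 1" and k0: "3 < 2 ^ k0 * C" and w: "w = \<tau> * C / 4"
    and GU: "C * m \<le> G U" and G: "\<And>A. A \<subseteq> U \<Longrightarrow> G A \<le> 2 * \<beta> A + m * w ^ Suc k0"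
  obtains A where "A \<subseteq> U" "w ^ k0 * m \<le> \<beta> A" "C * \<beta> A \<le> G A"
    "\<And>B. B \<subseteq> A \<Longrightarrow> G B \<le> G A * (2 * (\<beta> B / \<beta> A) + \<tau>)"
proof -
  have "\<tau> * C \<le> 1" using C \<tau> by (intro mult_le_one) auto
  then have w01: "0 < w" "w \<le> 1" using C \<tau> unfolding w by auto
  \<comment> \<open>Passing to the next level lets the subset shrink by the factor w and asks for
    twice the ratio. Level 0 is attained by U. Level k0 is impossible, since G \<le> 3 \<beta> on
    subsets of weight at least w^k0 m; so some level is attained whose successor is not.\<close>
  define P where "P k \<longleftrightarrow> (\<exists>A\<subseteq>U. w ^ k * m \<le> \<beta> A \<and> 2 ^ k * C * \<beta> A \<le> G A)" for k
  have P0: "P 0" unfolding P_def using \<beta>(2) GU by auto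
  have nP: "\<not> P k0"
  proof
    assume "P k0"
    then obtain A where A: "A \<subseteq> U" "w ^ k0 * m \<le> \<beta> A" "2 ^ k0 * C * \<beta> A \<le> G A" unfolding P_def by blast
    have pos: "0 < \<beta> A" using A(2) w01 m by (meson less_le_trans mult_pos_pos zero_less_power)
    have "m * w ^ Suc k0 \<le> w ^ k0 * m" using w01 m by (simp add: mult_left_le_one_le)
    then have "G A \<le> 3 * \<beta> A" using G[OF A(1)] A(2) by linarith
    moreover have "3 * \<beta> A < 2 ^ k0 * C * \<beta> A" using k0 pos by simp
    ultimately show False using A(3) by linarith
  qed
  have "\<exists>k<k0. P k \<and> \<not> P (Suc k)"
  proof (rule ccontr)
    assume "\<not> ?thesis"
    then have "P k" if "k \<le> k0" for k using that by (induction k) (use P0 in auto)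
    then show False using nP by blast
  qed
  then obtain k where k: "k < k0" "P k" "\<not> P (Suc k)" by blast
  then obtain A where A: "A \<subseteq> U" "w ^ k * m \<le> \<beta> A" "2 ^ k * C * \<beta> A \<le> G A" unfolding P_def by blast
  have "w ^ k0 \<le> w ^ k" using w01 k by (intro power_decreasing) auto
  then have Ak0: "w ^ k0 * m \<le> \<beta> A" using A(2) m by (meson mult_right_mono less_imp_le order_trans)
  have pos: "0 < \<beta> A" using Ak0 w01 m by (meson less_le_trans mult_pos_pos zero_less_power)
  have CA: "C * \<beta> A \<le> G A"
  proof -
    have "1 * (C * \<beta> A) \<le> 2 ^ k * (C * \<beta> A)" using pos C by (intro mult_right_mono) auto
    then show ?thesis using A(3) by (simp add: mult.assoc)
  qed
  then have GA: "0 < G A" using pos C by (meson less_le_trans mult_pos_pos)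
  show ?thesis
  proof (rule that[OF A(1) Ak0 CA])
    fix B assume B: "B \<subseteq> A"
    then have BU: "B \<subseteq> U" using A by blast
    \<comment> \<open>If B has at least the share w of the weight of A, failure of level k + 1
      bounds its ratio by twice that of A. Otherwise the additive error takes over, and w = \<tau>
      C/4 turns 3 w \<beta> A into at most (3/4) \<tau> G A.\<close>
    show "G B \<le> G A * (2 * (\<beta> B / \<beta> A) + \<tau>)"
    proof (cases "w * \<beta> A \<le> \<beta> B")
      case True
      have "w * (w ^ k * m) \<le> w * \<beta> A" using A(2) w01 by (intro mult_left_mono) auto
      then have "w ^ Suc k * m \<le> \<beta> B" using True by (simp add: mult.assoc)
      then have "G B \<le> 2 * (2 ^ k * C) * \<beta> B" using k(3) BU unfolding P_def by force
      also have "2 ^ k * C \<le> G A / \<beta> A" using A(3) pos by (simp add: pos_le_divide_eq)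
      then have "2 * (2 ^ k * C) * \<beta> B \<le> 2 * (G A / \<beta> A) * \<beta> B" using \<beta>(1)[OF BU] by (intro mult_right_mono) auto
      also have "\<dots> = G A * (2 * (\<beta> B / \<beta> A))" by simp
      also have "\<dots> \<le> G A * (2 * (\<beta> B / \<beta> A) + \<tau>)" using GA \<tau> by (intro mult_left_mono) auto
      finally show ?thesis .
    next
      case False
      have "m * w ^ Suc k0 = w * (w ^ k0 * m)" by simp
      also have "\<dots> \<le> w * \<beta> A" using Ak0 w01 by (intro mult_left_mono) auto
      finally have "G B \<le> 3 * (w * \<beta> A)" using G[OF BU] False by linarith
      also have "\<dots> = (3/4) * \<tau> * (C * \<beta> A)" unfolding w by simp
      also have "\<dots> \<le> (3/4) * \<tau> * G A" using CA \<tau> by (intro mult_left_mono) auto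
      also have "\<dots> \<le> \<tau> * G A" using \<tau> GA by simp
      also have "\<dots> \<le> G A * (2 * (\<beta> B / \<beta> A) + \<tau>)"
        using GA \<beta>(1)[OF BU] pos by (simp add: algebra_simps)
      finally show ?thesis .
    qed
  qed
qed

text \<open>The last clause is the admissibility condition of the asymptotic \<ell>1 property: the
  number of blocks does not exceed the least index occurring in them.\<close>

definition successive :: "nat \<Rightarrow> (nat \<Rightarrow> nat set) \<Rightarrow> bool" where
  "successive m Q \<longleftrightarrow> (\<forall>l<m. finite (Q l)) \<and> (\<forall>k l. k < l \<longrightarrow> l < m \<longrightarrow> (\<forall>i\<in>Q k. \<forall>j\<in>Q l. i < j)) \<and>
    (\<forall>l<m. \<forall>i\<in>Q l. m \<le> i)"

lemma successive_disjoint: "successive m Q \<Longrightarrow> k < m \<Longrightarrow> l < m \<Longrightarrow> k \<noteq> l \<Longrightarrow> Q k \<inter> Q l = {}"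
  unfolding successive_def by (metis disjoint_iff less_irrefl nat_neq_iff)

lemma sum_successive:
  assumes suc: "successive m Q" and A: "A \<subseteq> (\<Union>l<m. Q l)"
  shows "sum f A = (\<Sum>l<m. sum f (A \<inter> Q l))"
proof -
  have "A = (\<Union>l<m. A \<inter> Q l)" using A by blast
  moreover have "sum f (\<Union>l<m. A \<inter> Q l) = (\<Sum>l<m. sum f (A \<inter> Q l))"
  proof (rule sum.UNION_disjoint)
    show "\<forall>i\<in>{..<m}. finite (A \<inter> Q i)" using suc unfolding successive_def by simp
    show "\<forall>i\<in>{..<m}. \<forall>j\<in>{..<m}. i \<noteq> j \<longrightarrow> A \<inter> Q i \<inter> (A \<inter> Q j) = {}"
      using successive_disjoint[OF suc] by blast
  qed simp
  ultimately show ?thesis by simp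
qed

text \<open>The \<ell>1 estimate is stated for combinations of norm one only, the form in which
  averages of unit vectors use it.\<close>

locale l1_blocks = ck_operator T for T :: "('k::topological_space \<Rightarrow>\<^sub>C real) \<Rightarrow>\<^sub>L ('k \<Rightarrow>\<^sub>C real)" +
  fixes z :: "nat \<Rightarrow> 'k \<Rightarrow>\<^sub>C real" and C :: real
  assumes norm_z: "norm (z i) = 1" and C: "0 < C" "C \<le> 1"
    and lower_l1: "\<And>m Q a. successive m Q \<Longrightarrow> (\<And>l. l < m \<Longrightarrow> norm (\<Sum>i\<in>Q l. a i *\<^sub>R z i) = 1) \<Longrightarrow>
      C * real m \<le> norm (\<Sum>l<m. \<Sum>i\<in>Q l. a i *\<^sub>R z i)"
begin

definition \<xi> :: "nat \<Rightarrow> real" where "\<xi> i = 1 / (real i + 1)"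

text \<open>A continuous substitute for the indicator of the set where |z i| is at least the
  threshold \<xi> i, which tends to 0. Squares occur because they are what averaging over signs
  controls.\<close>

definition \<phi> :: "nat \<Rightarrow> 'k \<Rightarrow> real" where "\<phi> i x = min 1 ((z i x / \<xi> i)\<^sup>2)"

lemma \<xi>_pos: "0 < \<xi> i"
  unfolding \<xi>_def by simp

lemma test_\<phi>: "test (\<phi> i)"
  unfolding test_def \<phi>_def using \<xi>_pos[of i] by (auto intro!: continuous_intros)

lemma z_le: "\<bar>z i x\<bar> \<le> \<xi> i + \<phi> i x" "\<phi> i x < 1 \<Longrightarrow> \<bar>z i x\<bar> \<le> \<xi> i"
proof -
  show 1: "\<bar>z i x\<bar> \<le> \<xi> i" if "\<phi> i x < 1"
  proof -
    have "(z i x / \<xi> i)\<^sup>2 < 1" using that unfolding \<phi>_def by auto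
    then have "\<bar>z i x / \<xi> i\<bar> < 1" by (simp add: abs_square_less_1)
    then show ?thesis using \<xi>_pos[of i] by (simp add: abs_divide)
  qed
  show "\<bar>z i x\<bar> \<le> \<xi> i + \<phi> i x"
    using 1 abs_le_norm_bcontfun[of "z i" x] norm_z[of i] testD(2,3)[OF test_\<phi>[of i], of x] \<xi>_pos[of i] by force
qed

text \<open>The weights \<open>b\<close> control the norms of all restrictions of the unit vector \<open>\<Sum>a\<^sub>i z\<^sub>i\<close>.\<close>

definition weighted :: "nat set \<Rightarrow> (nat \<Rightarrow> real) \<Rightarrow> (nat \<Rightarrow> real) \<Rightarrow> real \<Rightarrow> bool" where
  "weighted Q a b \<tau> \<longleftrightarrow> finite Q \<and> (\<forall>i\<in>Q. 0 \<le> a i \<and> 0 \<le> b i) \<and> sum b Q = 1 \<and>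
     norm (\<Sum>i\<in>Q. a i *\<^sub>R z i) = 1 \<and> (\<forall>A\<subseteq>Q. norm (\<Sum>i\<in>A. a i *\<^sub>R z i) \<le> 2 * sum b A + \<tau>) \<and>
     (\<Sum>i\<in>Q. a i * \<xi> i) \<le> \<tau>"

lemma weighted_mono: "weighted Q a b \<tau> \<Longrightarrow> \<tau> \<le> \<tau>' \<Longrightarrow> weighted Q a b \<tau>'"
  unfolding weighted_def by (meson add_left_mono order_trans)

lemma weighted_cong:
  assumes "\<And>i. i \<in> Q \<Longrightarrow> a i = a' i" "\<And>i. i \<in> Q \<Longrightarrow> b i = b' i" "weighted Q a b \<tau>"
  shows "weighted Q a' b' \<tau>"
proof -
  have c: "sum b A = sum b' A" "(\<Sum>i\<in>A. a i *\<^sub>R z i) = (\<Sum>i\<in>A. a' i *\<^sub>R z i)" if "A \<subseteq> Q" for A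
    using assms(1,2) that by (auto intro!: sum.cong)
  have x: "(\<Sum>i\<in>Q. a i * \<xi> i) = (\<Sum>i\<in>Q. a' i * \<xi> i)" using assms(1) by (auto intro!: sum.cong)
  show ?thesis
    unfolding weighted_def
  proof (intro conjI ballI allI impI)
    show "norm (\<Sum>i\<in>A. a' i *\<^sub>R z i) \<le> 2 * sum b' A + \<tau>" if "A \<subseteq> Q" for A
      using assms(3) that c[OF that] unfolding weighted_def by auto
  qed (use assms c[OF order_refl] x in \<open>auto simp: weighted_def\<close>)
qed

lemma weighted_singleton: "\<xi> i \<le> \<tau> \<Longrightarrow> weighted {i} (\<lambda>_. 1) (\<lambda>_. 1) \<tau>"
  unfolding weighted_def using norm_z[of i] \<xi>_pos[of i] by (auto simp: subset_singleton_iff)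

text \<open>Key step: the asymptotic \<open>\<ell>\<^sub>1\<close> constant \<open>C\<close> does not enter the estimate of the new
  restrictions, so the construction can be iterated without loss.\<close>

lemma average:
  assumes \<tau>: "0 < \<tau>" "\<tau> \<le> 1"
  obtains w \<tau>1 where "0 < w" "w \<le> 1" "0 < \<tau>1"
    "\<forall>m Q a b. 0 < m \<longrightarrow> successive m Q \<longrightarrow> (\<forall>l<m. weighted (Q l) (a l) (b l) \<tau>1) \<longrightarrow>
      (\<exists>Q' a' b'. Q' \<subseteq> (\<Union>l<m. Q l) \<and> weighted Q' a' b' \<tau> \<and>
        (\<forall>l<m. \<forall>i\<in>Q' \<inter> Q l. a' i \<le> a l i / (w * real m) \<and> b' i \<le> b l i / (w * real m)))"
proof -
  obtain k0 where k0: "3 < 2 ^ k0 * C"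
    using real_arch_pow[of 2 "3 / C"] C by (auto simp: field_simps)
  define v where "v = \<tau> * C / 4"
  have "\<tau> * C \<le> 1" using C \<tau> by (intro mult_le_one) auto
  then have v: "0 < v" "v \<le> 1" using C \<tau> unfolding v_def by auto
  have vk: "0 < v ^ k0" "v ^ k0 \<le> 1" using v by (auto intro: power_le_one)
  \<comment> \<open>The extremal subset has weight at least v^k0 m and norm at least C times its
    weight, so normalizing divides by at least C v^k0 m. The error v^(k0 + 1) of each member is the
    additive error that the extremal argument tolerates.\<close>
  show ?thesis
  proof (rule that[of "C * v ^ k0" "v ^ Suc k0"])
    show "0 < C * v ^ k0" "C * v ^ k0 \<le> 1" "0 < v ^ Suc k0" using C v vk by (auto intro: mult_le_one)
    show "\<forall>m Q a b. 0 < m \<longrightarrow> successive m Q \<longrightarrow> (\<forall>l<m. weighted (Q l) (a l) (b l) (v ^ Suc k0)) \<longrightarrow>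
      (\<exists>Q' a' b'. Q' \<subseteq> (\<Union>l<m. Q l) \<and> weighted Q' a' b' \<tau> \<and>
        (\<forall>l<m. \<forall>i\<in>Q' \<inter> Q l. a' i \<le> a l i / (C * v ^ k0 * real m) \<and> b' i \<le> b l i / (C * v ^ k0 * real m)))"
    proof (intro allI impI)
    fix m :: nat and Q a b
    assume m: "0 < m" and suc: "successive m Q" and W: "\<forall>l<m. weighted (Q l) (a l) (b l) (v ^ Suc k0)"
    define U where "U = (\<Union>l<m. Q l)"
    have finQ: "finite (Q l)" if "l < m" for l using W[rule_format, OF that] unfolding weighted_def by blast
    have finU: "finite U" unfolding U_def using finQ by auto
    \<comment> \<open>The sets Q l are disjoint, so the coefficient families can be merged into one
      by sending i to the unique l with i \<in> Q l.\<close>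
    define l0 where "l0 i = (SOME l. l < m \<and> i \<in> Q l)" for i
    have l0: "l0 i = l" if "l < m" "i \<in> Q l" for i l
    proof -
      have "l0 i < m \<and> i \<in> Q (l0 i)" unfolding l0_def by (rule someI[of _ l]) (use that in simp)
      then show ?thesis using successive_disjoint[OF suc, of "l0 i" l] that by auto
    qed
    define am where "am i = a (l0 i) i" for i
    define bm where "bm i = b (l0 i) i" for i
    have W': "weighted (Q l) am bm (v ^ Suc k0)" if "l < m" for l
      by (rule weighted_cong[OF _ _ W[rule_format, OF that]]) (use l0 that in \<open>auto simp: am_def bm_def\<close>)
    have split: "sum f A = (\<Sum>l<m. sum f (A \<inter> Q l))" if "A \<subseteq> U" for A and f :: "nat \<Rightarrow> real"
      using sum_successive[OF suc] that unfolding U_def by blast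
    have splitv: "sum f A = (\<Sum>l<m. sum f (A \<inter> Q l))" if "A \<subseteq> U" for A and f :: "nat \<Rightarrow> 'k \<Rightarrow>\<^sub>C real"
      using sum_successive[OF suc] that unfolding U_def by blast
    have nonneg: "0 \<le> am i" "0 \<le> bm i" if "i \<in> U" for i
      using that W' unfolding U_def weighted_def by blast+
    define \<beta> where "\<beta> A = sum bm A" for A
    define G where "G A = norm (\<Sum>i\<in>A. am i *\<^sub>R z i)" for A
    have UQ: "U \<inter> Q l = Q l" if "l < m" for l using that unfolding U_def by blast
    have \<beta>U: "\<beta> U = real m"
      unfolding \<beta>_def split[OF order_refl] using W' UQ unfolding weighted_def by simp
    have GU: "C * real m \<le> G U"
      unfolding G_def splitv[OF order_refl] using lower_l1[OF suc, of am] W' UQ unfolding weighted_def by simp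
    have GA: "G A \<le> 2 * \<beta> A + real m * v ^ Suc k0" if A: "A \<subseteq> U" for A
    proof -
      have "G A \<le> (\<Sum>l<m. norm (\<Sum>i\<in>A \<inter> Q l. am i *\<^sub>R z i))"
        unfolding G_def splitv[OF A] by (rule norm_sum)
      also have "\<dots> \<le> (\<Sum>l<m. 2 * sum bm (A \<inter> Q l) + v ^ Suc k0)"
        using W' unfolding weighted_def by (intro sum_mono) auto
      also have "\<dots> = 2 * \<beta> A + real m * v ^ Suc k0"
        unfolding \<beta>_def split[OF A] by (simp add: sum.distrib sum_distrib_left)
      finally show ?thesis .
    qed
    obtain A where A: "A \<subseteq> U" "v ^ k0 * real m \<le> \<beta> A" "C * \<beta> A \<le> G A"
      "\<And>B. B \<subseteq> A \<Longrightarrow> G B \<le> G A * (2 * (\<beta> B / \<beta> A) + \<tau>)"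
    proof (rule extremal_subset[of U \<beta> "real m" C \<tau> k0 v G])
      show "0 \<le> \<beta> A" if "A \<subseteq> U" for A unfolding \<beta>_def using nonneg that by (intro sum_nonneg) auto
    qed (use \<beta>U m C \<tau> k0 v_def GU GA in auto)
    have pos: "0 < \<beta> A" using A(2) vk m by (meson less_le_trans mult_pos_pos of_nat_0_less_iff)
    then have Gpos: "0 < G A" using A(3) C by (meson less_le_trans mult_pos_pos)
    define a' where "a' i = am i / G A" for i
    define b' where "b' i = bm i / \<beta> A" for i
    have scale: "(\<Sum>i\<in>B. a' i *\<^sub>R z i) = (1 / G A) *\<^sub>R (\<Sum>i\<in>B. am i *\<^sub>R z i)" for B
      unfolding a'_def by (simp add: scaleR_sum_right)
    have sumb: "sum b' B = \<beta> B / \<beta> A" for B unfolding b'_def \<beta>_def by (simp add: sum_divide_distrib)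
    have low: "C * v ^ k0 * real m \<le> G A"
      using A(2,3) C by (metis mult.assoc mult_left_mono less_imp_le order_trans)
    have low2: "C * v ^ k0 * real m \<le> \<beta> A"
    proof -
      have "C * (v ^ k0 * real m) \<le> 1 * (v ^ k0 * real m)" using C vk by (intro mult_right_mono) auto
      then show ?thesis using A(2) by (simp add: mult.assoc)
    qed
    have cm: "0 < C * v ^ k0 * real m" using C vk m by simp
    have "weighted A a' b' \<tau>"
      unfolding weighted_def
    proof (intro conjI ballI allI impI)
      show "finite A" using A(1) finU finite_subset by blast
      show "0 \<le> a' i" "0 \<le> b' i" if "i \<in> A" for i
        using nonneg[of i] that A(1) pos Gpos unfolding a'_def b'_def by auto
      show "sum b' A = 1" using sumb pos by simp
      show "norm (\<Sum>i\<in>A. a' i *\<^sub>R z i) = 1" unfolding scale using Gpos by (simp add: G_def)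
      show "norm (\<Sum>i\<in>B. a' i *\<^sub>R z i) \<le> 2 * sum b' B + \<tau>" if "B \<subseteq> A" for B
      proof -
        have "norm (\<Sum>i\<in>B. a' i *\<^sub>R z i) = G B / G A" unfolding scale using Gpos by (simp add: G_def)
        also have "\<dots> \<le> 2 * (\<beta> B / \<beta> A) + \<tau>" using A(4)[OF that] Gpos by (simp add: pos_divide_le_eq mult.commute)
        finally show ?thesis unfolding sumb .
      qed
      have e: "(\<Sum>i\<in>A. a' i * \<xi> i) = (\<Sum>i\<in>A. am i * \<xi> i) / G A"
        unfolding a'_def by (simp add: sum_divide_distrib)
      have "(\<Sum>i\<in>A. am i * \<xi> i) \<le> (\<Sum>i\<in>U. am i * \<xi> i)"
        using A(1) finU nonneg(1) less_imp_le[OF \<xi>_pos] by (intro sum_mono2 mult_nonneg_nonneg) auto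
      also have "(\<Sum>i\<in>U. am i * \<xi> i) = (\<Sum>l<m. \<Sum>i\<in>Q l. am i * \<xi> i)"
        unfolding split[OF order_refl] using UQ by simp
      also have "\<dots> \<le> (\<Sum>l<m. v ^ Suc k0)" using W' unfolding weighted_def by (intro sum_mono) auto
      finally have "(\<Sum>i\<in>A. am i * \<xi> i) / G A \<le> real m * v ^ Suc k0 / G A"
        using Gpos by (simp add: divide_right_mono)
      also have "\<dots> \<le> real m * v ^ Suc k0 / (C * v ^ k0 * real m)"
        by (rule divide_left_mono[OF low]) (use v m Gpos cm in auto)
      \<comment> \<open>The factor v^k0 lost in the normalization cancels against v^(k0 + 1); what
        remains is \<tau>/4.\<close>
      also have "\<dots> = v / C" using m vk C by simp
      also have "\<dots> \<le> \<tau>" unfolding v_def using C \<tau> by simp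
      finally show "(\<Sum>i\<in>A. a' i * \<xi> i) \<le> \<tau>" unfolding e .
    qed
    moreover have "a' i \<le> a l i / (C * v ^ k0 * real m) \<and> b' i \<le> b l i / (C * v ^ k0 * real m)"
      if "l < m" "i \<in> A \<inter> Q l" for l i
    proof -
      have e: "am i = a l i" "bm i = b l i" using l0[of l i] that unfolding am_def bm_def by auto
      have "0 \<le> am i" "0 \<le> bm i" using nonneg[of i] that A(1) by auto
      then show ?thesis unfolding a'_def b'_def e using low low2 cm by (auto intro!: divide_left_mono mult_pos_pos Gpos pos)
    qed
    ultimately show "\<exists>Q' a' b'. Q' \<subseteq> (\<Union>l<m. Q l) \<and> weighted Q' a' b' \<tau> \<and>
        (\<forall>l<m. \<forall>i\<in>Q' \<inter> Q l. a' i \<le> a l i / (C * v ^ k0 * real m) \<and> b' i \<le> b l i / (C * v ^ k0 * real m))"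
      using A(1) unfolding U_def by blast
    qed
  qed
qed

text \<open>A is split at x into the indices with \<phi> = 1 and the rest. For the former, the norm
  estimate for restrictions applies, which is why it has to hold for every set of indices: this set
  depends on x. For the latter |z i| \<le> \<xi> i at x, and the weighted sum of thresholds is at
  most \<tau>.\<close>

lemma weighted_pointwise:
  assumes W: "weighted Q a b \<tau>" and A: "A \<subseteq> Q"
  shows "\<bar>(\<Sum>i\<in>A. a i *\<^sub>R z i) x\<bar> \<le> 2 * (\<Sum>i\<in>A. b i * \<phi> i x) + 2 * \<tau>"
proof -
  define B where "B = {i\<in>A. \<phi> i x = 1}"
  have B: "B \<subseteq> Q" using A unfolding B_def by blast
  have fin: "finite A" using W A unfolding weighted_def by (meson finite_subset)
  have nn: "0 \<le> a i" "0 \<le> b i" if "i \<in> A" for i using W A that unfolding weighted_def by auto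
  have "(\<Sum>i\<in>A. a i *\<^sub>R z i) x = (\<Sum>i\<in>B. a i *\<^sub>R z i) x + (\<Sum>i\<in>A - B. a i *\<^sub>R z i) x"
    using sum.subset_diff[of B A "\<lambda>i. a i *\<^sub>R z i"] fin unfolding B_def by simp
  moreover have "\<bar>(\<Sum>i\<in>B. a i *\<^sub>R z i) x\<bar> \<le> 2 * sum b B + \<tau>"
  proof -
    have "norm (\<Sum>i\<in>B. a i *\<^sub>R z i) \<le> 2 * sum b B + \<tau>" using W A B unfolding weighted_def by blast
    then show ?thesis using abs_le_norm_bcontfun order_trans by blast
  qed
  moreover have "sum b B \<le> (\<Sum>i\<in>A. b i * \<phi> i x)"
  proof -
    have "sum b B = (\<Sum>i\<in>B. b i * \<phi> i x)" unfolding B_def by (intro sum.cong) auto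
    also have "\<dots> \<le> (\<Sum>i\<in>A. b i * \<phi> i x)"
      using fin nn testD(2)[OF test_\<phi>] by (intro sum_mono2) (auto simp: B_def)
    finally show ?thesis .
  qed
  moreover have "\<bar>(\<Sum>i\<in>A - B. a i *\<^sub>R z i) x\<bar> \<le> \<tau>"
  proof -
    have "\<bar>(\<Sum>i\<in>A - B. a i *\<^sub>R z i) x\<bar> \<le> (\<Sum>i\<in>A - B. a i * \<xi> i)"
      unfolding apply_sum_bcontfun
    proof (rule order_trans[OF sum_abs], rule sum_mono)
      fix i assume i: "i \<in> A - B"
      then have "\<phi> i x < 1" using testD(3)[OF test_\<phi>, of i x] unfolding B_def by auto
      then show "\<bar>(a i *\<^sub>R z i) x\<bar> \<le> a i * \<xi> i" using z_le(2)[of i x] nn i by (simp add: abs_mult mult_left_mono)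
    qed
    also have "\<dots> \<le> (\<Sum>i\<in>Q. a i * \<xi> i)"
      using W A less_imp_le[OF \<xi>_pos] unfolding weighted_def by (intro sum_mono2 mult_nonneg_nonneg) auto
    also have "\<dots> \<le> \<tau>" using W unfolding weighted_def by blast
    finally show ?thesis .
  qed
  ultimately show ?thesis by linarith
qed

text \<open>The pointwise bound is integrated against the total variation at t.\<close>

lemma weighted_T_le:
  assumes W: "weighted Q a b \<tau>" and A: "A \<subseteq> Q" and \<tau>: "0 \<le> \<tau>"
  shows "\<bar>T (\<Sum>i\<in>A. a i *\<^sub>R z i) t\<bar> \<le> 2 * (\<Sum>i\<in>A. b i * tv t (\<phi> i)) + 2 * \<tau> * norm T"
proof -
  have nn: "0 \<le> b i" if "i \<in> A" for i using W A that unfolding weighted_def by auto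
  have c: "continuous_on UNIV (\<lambda>x. b i * \<phi> i x)" "0 \<le> b i * \<phi> i x" if "i \<in> A" for i x
    using testD(1,2)[OF test_\<phi>] nn that by (auto intro!: continuous_intros)
  have c2: "continuous_on UNIV (\<lambda>x. \<Sum>i\<in>A. b i * \<phi> i x)" "0 \<le> (\<Sum>i\<in>A. b i * \<phi> i x)" for x
    using c by (auto intro!: continuous_on_sum sum_nonneg)
  have "\<bar>T (\<Sum>i\<in>A. a i *\<^sub>R z i) t\<bar> \<le> tv t (\<lambda>x. 2 * (\<Sum>i\<in>A. b i * \<phi> i x) + 2 * \<tau>)"
    by (rule T_le_tv) (use c2 weighted_pointwise[OF W A] in \<open>auto intro!: continuous_intros\<close>)
  also have "\<dots> = tv t (\<lambda>x. 2 * (\<Sum>i\<in>A. b i * \<phi> i x)) + tv t (\<lambda>_. 2 * \<tau>)"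
    using c2 \<tau> by (intro tv_add) (auto intro!: continuous_intros)
  also have "tv t (\<lambda>x. 2 * (\<Sum>i\<in>A. b i * \<phi> i x)) = 2 * (\<Sum>i\<in>A. b i * tv t (\<phi> i))"
    using c c2 nn testD(1,2)[OF test_\<phi>] by (simp add: tv_scale tv_sum)
  also have "tv t (\<lambda>_. 2 * \<tau>) \<le> norm T * (2 * \<tau>)" using \<tau> by (intro tv_bound) auto
  finally show ?thesis by (simp add: mult.commute)
qed

end

subsection \<open>Small excess on a stratum\<close>

context l1_blocks
begin

text \<open>The average mass of the large parts above 3 \<epsilon>. Thinness uses up \<epsilon> of
  this and upper semicontinuity another \<epsilon>.\<close>

definition excess :: "real \<Rightarrow> 'k \<Rightarrow> nat set \<Rightarrow> (nat \<Rightarrow> real) \<Rightarrow> real" where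
  "excess \<epsilon> t Q b = (\<Sum>i\<in>Q. b i * max 0 (tv t (\<phi> i) - 3 * \<epsilon>))"

text \<open>The material for one round of averaging: successive weighted families with supports W,
  coefficients A and weights B, whose errors \<kappa> tend to 0.\<close>

definition supplies :: "(nat \<Rightarrow> nat set) \<Rightarrow> (nat \<Rightarrow> nat \<Rightarrow> real) \<Rightarrow> (nat \<Rightarrow> nat \<Rightarrow> real) \<Rightarrow> (nat \<Rightarrow> real) \<Rightarrow> bool" where
  "supplies W A B \<kappa> \<longleftrightarrow> (\<forall>j. weighted (W j) (A j) (B j) (\<kappa> j)) \<and>
     (\<forall>j j'. j < j' \<longrightarrow> (\<forall>i\<in>W j. \<forall>i'\<in>W j'. i < i')) \<and> \<kappa> \<longlonglongrightarrow> 0"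

text \<open>Estimates that hold for all members of the supplies with index in \<open>J\<close>, up to \<open>\<kappa>\<close>, pass to
  the composite \<open>(Q, a, b)\<close>, up to \<open>\<eta>\<close>.\<close>

definition composite :: "(nat \<Rightarrow> nat set) \<Rightarrow> (nat \<Rightarrow> nat \<Rightarrow> real) \<Rightarrow> (nat \<Rightarrow> nat \<Rightarrow> real) \<Rightarrow> (nat \<Rightarrow> real) \<Rightarrow>
    nat set \<Rightarrow> nat set \<Rightarrow> (nat \<Rightarrow> real) \<Rightarrow> (nat \<Rightarrow> real) \<Rightarrow> real \<Rightarrow> bool" where
  "composite W A B \<kappa> J Q a b \<eta> \<longleftrightarrow> finite J \<and> Q \<subseteq> (\<Union>j\<in>J. W j) \<and>
     (\<forall>f g. (\<forall>i. 0 \<le> f i \<and> 0 \<le> g i) \<longrightarrow> (\<forall>j\<in>J. (\<Sum>i\<in>W j. A j i * f i + B j i * g i) \<le> \<kappa> j) \<longrightarrow>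
       (\<Sum>i\<in>Q. a i * f i + b i * g i) \<le> \<eta>)"

text \<open>The quantifier over all supplies allows the property to be applied to families that are
  themselves averages, and the one over tails {N..} allows composites to be chosen
  successively.\<close>

definition tame :: "real \<Rightarrow> 'k set \<Rightarrow> bool" where
  "tame \<epsilon> F \<longleftrightarrow> (\<forall>W A B \<kappa> \<tau> N. supplies W A B \<kappa> \<longrightarrow> 0 < \<tau> \<longrightarrow>
     (\<exists>J Q a b. J \<subseteq> {N..} \<and> weighted Q a b \<tau> \<and> composite W A B \<kappa> J Q a b \<tau> \<and> (\<forall>t\<in>F. excess \<epsilon> t Q b \<le> \<tau>)))"

lemma tameD:
  assumes "tame \<epsilon> F" "supplies W A B \<kappa>" "0 < \<tau>"
  shows "\<exists>J Q a b. J \<subseteq> {N..} \<and> weighted Q a b \<tau> \<and> composite W A B \<kappa> J Q a b \<tau> \<and> (\<forall>t\<in>F. excess \<epsilon> t Q b \<le> \<tau>)"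
  using assms(1)[unfolded tame_def, rule_format, OF assms(2,3)] .

lemma suppliesD:
  assumes "supplies W A B \<kappa>"
  shows "weighted (W j) (A j) (B j) (\<kappa> j)"
    and "j < j' \<Longrightarrow> i \<in> W j \<Longrightarrow> i' \<in> W j' \<Longrightarrow> i < i'"
    and "\<kappa> \<longlonglongrightarrow> 0"
  using assms by (simp_all add: supplies_def)

lemma compositeD:
  assumes "composite W A B \<kappa> J Q a b \<eta>"
  shows "finite J" and "i \<in> Q \<Longrightarrow> \<exists>j\<in>J. i \<in> W j"
    and "\<forall>i. 0 \<le> f i \<and> 0 \<le> g i \<Longrightarrow> \<forall>j\<in>J. (\<Sum>i\<in>W j. A j i * f i + B j i * g i) \<le> \<kappa> j \<Longrightarrow>
       (\<Sum>i\<in>Q. a i * f i + b i * g i) \<le> \<eta>"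
  using assms by (auto simp: composite_def)

lemma weightedD:
  assumes "weighted Q a b \<tau>"
  shows "finite Q" and "i \<in> Q \<Longrightarrow> 0 \<le> a i" and "i \<in> Q \<Longrightarrow> 0 \<le> b i" and "sum b Q = 1"
  using assms by (simp_all add: weighted_def)

lemma weighted_nonempty: "weighted Q a b \<tau> \<Longrightarrow> Q \<noteq> {}"
  using weightedD(4)[of Q a b] by force

lemma supplies_index_le:
  assumes "supplies W A B \<kappa>" "i \<in> W j"
  shows "j \<le> i"
  using assms(2)
proof (induction j arbitrary: i)
  case (Suc j)
  obtain i' where i': "i' \<in> W j" using weighted_nonempty[OF suppliesD(1)[OF assms(1), of j]] by (meson ex_in_conv)
  then have "i' < i" using suppliesD(2)[OF assms(1), of j "Suc j"] Suc.prems by simp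
  then show ?case using Suc.IH[OF i'] by simp
qed simp

lemma tame_empty: "tame \<epsilon> {}"
  unfolding tame_def
proof (intro allI impI)
  fix W A B and \<kappa> :: "nat \<Rightarrow> real" and \<tau> :: real and N :: nat
  assume s: "supplies W A B \<kappa>" and \<tau>: "0 < \<tau>"
  have "\<forall>\<^sub>F j in sequentially. \<kappa> j < \<tau>" by (rule order_tendstoD(2)[OF suppliesD(3)[OF s] \<tau>])
  then obtain j where j: "j \<ge> N" "\<kappa> j < \<tau>" unfolding eventually_sequentially by (meson nle_le)
  have "composite W A B \<kappa> {j} (W j) (A j) (B j) \<tau>"
    unfolding composite_def using j by auto
  moreover have "weighted (W j) (A j) (B j) \<tau>"
    using weighted_mono[OF suppliesD(1)[OF s, of j]] j by simp
  ultimately show "\<exists>J Q a b. J \<subseteq> {N..} \<and> weighted Q a b \<tau> \<and> composite W A B \<kappa> J Q a b \<tau> \<and> (\<forall>t\<in>{}. excess \<epsilon> t Q b \<le> \<tau>)"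
    using j by (intro exI[of _ "{j}"] exI[of _ "W j"] exI[of _ "A j"] exI[of _ "B j"]) auto
qed

lemma sum_le_average:
  fixes b' h :: "nat \<Rightarrow> real" and c :: real
  assumes suc: "successive m Q" and Q': "Q' \<subseteq> (\<Union>l<m. Q l)" and c: "0 < c"
    and h: "\<And>i. 0 \<le> h i" and b: "\<And>l i. l < m \<Longrightarrow> i \<in> Q l \<Longrightarrow> 0 \<le> b l i"
    and b': "\<And>l i. l < m \<Longrightarrow> i \<in> Q' \<inter> Q l \<Longrightarrow> b' i \<le> b l i / c"
  shows "(\<Sum>i\<in>Q'. b' i * h i) \<le> (\<Sum>l<m. \<Sum>i\<in>Q l. b l i * h i) / c"
proof -
  have "(\<Sum>i\<in>Q'. b' i * h i) = (\<Sum>l<m. \<Sum>i\<in>Q' \<inter> Q l. b' i * h i)"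
    by (rule sum_successive[OF suc Q'])
  also have "\<dots> \<le> (\<Sum>l<m. (\<Sum>i\<in>Q l. b l i * h i) / c)"
  proof (rule sum_mono)
    fix l assume "l \<in> {..<m}"
    then have l: "l < m" by simp
    have "(\<Sum>i\<in>Q' \<inter> Q l. b' i * h i) \<le> (\<Sum>i\<in>Q' \<inter> Q l. b l i / c * h i)"
      using b'[OF l] h by (intro sum_mono mult_right_mono) auto
    also have "\<dots> \<le> (\<Sum>i\<in>Q l. b l i / c * h i)"
    proof (rule sum_mono2)
      show "finite (Q l)" using suc l unfolding successive_def by simp
      show "0 \<le> b l i / c * h i" if "i \<in> Q l - Q' \<inter> Q l" for i
        using b[OF l, of i] that c h[of i] by simp
    qed simp
    also have "\<dots> = (\<Sum>i\<in>Q l. b l i * h i) / c" by (simp add: sum_divide_distrib)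
    finally show "(\<Sum>i\<in>Q' \<inter> Q l. b' i * h i) \<le> (\<Sum>i\<in>Q l. b l i * h i) / c" .
  qed
  also have "\<dots> = (\<Sum>l<m. \<Sum>i\<in>Q l. b l i * h i) / c" by (simp add: sum_divide_distrib)
  finally show ?thesis .
qed

lemma excess_le_norm:
  assumes "weighted Q a b \<tau>" "0 < \<epsilon>"
  shows "excess \<epsilon> t Q b \<le> norm T"
proof -
  have "excess \<epsilon> t Q b \<le> (\<Sum>i\<in>Q. b i * norm T)"
    unfolding excess_def
  proof (intro sum_mono mult_left_mono)
    fix i assume "i \<in> Q"
    have "tv t (\<phi> i) \<le> norm T"
      using tv_le_tvnorm[of "\<phi> i" t] tvnorm_le[of t] testD[OF test_\<phi>[of i]] by simp
    then show "max 0 (tv t (\<phi> i) - 3 * \<epsilon>) \<le> norm T" using assms(2) by auto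
  qed (use weightedD(3)[OF assms(1)] in auto)
  also have "\<dots> = norm T" using weightedD(4)[OF assms(1)] by (simp flip: sum_distrib_right)
  finally show ?thesis .
qed

lemma excess_zero: "(\<And>i. i \<in> Q \<Longrightarrow> tv t (\<phi> i) \<le> 3 * \<epsilon>) \<Longrightarrow> excess \<epsilon> t Q b = 0"
  unfolding excess_def by (intro sum.neutral) auto

text \<open>Composites are chosen one by one, each with an open neighbourhood X of L = F - U on
  which all its functions have mass at most 3 \<epsilon>, by thinness on L and semicontinuity. The
  points of F outside an earlier neighbourhood form a closed subset of D \<inter> U, where the next
  composite can be made to have small excess. At a given t let k be the first index with t outside X
  k: the excess is 0 before k, small after k, and at most the norm of T at k. Averaging m composites
  divides this one bad term by w m.\<close>

lemma tame_step:
  assumes \<epsilon>: "0 < \<epsilon>"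
    and null: "\<And>t. t \<in> R \<Longrightarrow> (\<lambda>i. tv t (\<phi> i)) \<longlonglongrightarrow> 0"
    and usc: "\<And>t i. t \<in> D \<Longrightarrow> \<exists>U. open U \<and> t \<in> U \<and> (\<forall>t'\<in>U \<inter> D. tv t' (\<phi> i) \<le> tv t (\<phi> i) + \<epsilon>)"
    and U: "open U" "\<And>F. closed F \<Longrightarrow> F \<subseteq> D \<inter> U \<Longrightarrow> tame \<epsilon> F"
    and V: "open V" "S \<subseteq> R" "thin \<epsilon> (V \<inter> (D - U)) S \<kappa>0"
    and F: "closed F" "F \<subseteq> D \<inter> (U \<union> V)"
  shows "tame \<epsilon> F"
  unfolding tame_def
proof (intro allI impI)
  fix W A B and \<kappa> :: "nat \<Rightarrow> real" and \<tau>' :: real and N :: nat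
  assume s: "supplies W A B \<kappa>" and \<tau>': "0 < \<tau>'"
  define \<tau> where "\<tau> = min \<tau>' 1"
  have \<tau>: "0 < \<tau>" "\<tau> \<le> 1" "\<tau> \<le> \<tau>'" unfolding \<tau>_def using \<tau>' by auto
  obtain w \<tau>1 where w: "0 < w" "w \<le> 1" "0 < \<tau>1" and av: "\<forall>m Q a b. 0 < m \<longrightarrow> successive m Q \<longrightarrow>
      (\<forall>l<m. weighted (Q l) (a l) (b l) \<tau>1) \<longrightarrow>
      (\<exists>Q' a' b'. Q' \<subseteq> (\<Union>l<m. Q l) \<and> weighted Q' a' b' \<tau> \<and>
        (\<forall>l<m. \<forall>i\<in>Q' \<inter> Q l. a' i \<le> a l i / (w * real m) \<and> b' i \<le> b l i / (w * real m)))"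
    by (rule average[OF \<tau>(1,2)])
  \<comment> \<open>Half of \<tau> is for the regular terms, which the average inflates by 1/w; m is
    then taken so large that the single bad term costs the other half.\<close>
  define \<tau>2 where "\<tau>2 = min \<tau>1 (w * \<tau> / 2)"
  have \<tau>2: "0 < \<tau>2" "\<tau>2 \<le> \<tau>1" "\<tau>2 \<le> w * \<tau> / 2" unfolding \<tau>2_def using w \<tau> by auto
  obtain m :: nat where m: "2 * norm T / (w * \<tau>) < real m" using reals_Archimedean2 by blast
  have "0 \<le> 2 * norm T / (w * \<tau>)" using w \<tau> by simp
  then have "0 < m" using m by (metis of_nat_0_less_iff order_le_less_trans)
  have Tm: "norm T \<le> w * \<tau> / 2 * real m" using m w \<tau> by (simp add: field_simps)
  have thin: "finite S" "0 < \<kappa>0" "\<And>\<psi> t. test \<psi> \<Longrightarrow> t \<in> V \<inter> (D - U) \<Longrightarrow> tvs S \<psi> < \<kappa>0 \<Longrightarrow> tv t \<psi> \<le> \<epsilon>"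
    using V(3) unfolding thin_def by blast+
  have "(\<lambda>i. tvs S (\<phi> i)) \<longlonglongrightarrow> (\<Sum>t\<in>S. 0)"
    unfolding tvs_def using null V(2) by (intro tendsto_sum) blast
  then have "\<forall>\<^sub>F i in sequentially. tvs S (\<phi> i) < \<kappa>0" using thin(2) by (auto intro: order_tendstoD)
  then obtain i0 where i0: "\<And>i. i0 \<le> i \<Longrightarrow> tvs S (\<phi> i) < \<kappa>0" unfolding eventually_sequentially by blast
  \<comment> \<open>The j-th family of a supply consists of indices \<ge> j. Using only j \<ge>
    \<open>N0\<close> thus ensures both the admissibility bound m and the smallness of
    \<open>tvs S (\<phi> i)\<close> from \<open>i0\<close> on.\<close>
  define N0 where "N0 = max N (max m i0)"
  define L where "L = F - U"
  have LV: "L \<subseteq> V \<inter> (D - U)" using F(2) unfolding L_def by blast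
  have nbhd: "\<exists>X. open X \<and> L \<subseteq> X \<and> (\<forall>t\<in>X \<inter> F. tv t (\<phi> i) \<le> 3 * \<epsilon>)" if i: "i0 \<le> i" for i
  proof -
    have "\<exists>X. open X \<and> t \<in> X \<and> (\<forall>t'\<in>X \<inter> D. tv t' (\<phi> i) \<le> 3 * \<epsilon>)" if "t \<in> L" for t
    proof -
      have t: "t \<in> V \<inter> (D - U)" by (rule subsetD[OF LV that])
      have le: "tv t (\<phi> i) \<le> \<epsilon>" by (rule thin(3)[OF test_\<phi> t i0[OF i]])
      have "t \<in> D" using t by simp
      from usc[OF this, of i] obtain X where X: "open X" "t \<in> X" "\<forall>t'\<in>X \<inter> D. tv t' (\<phi> i) \<le> tv t (\<phi> i) + \<epsilon>"
        by (elim exE conjE)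
      have "tv t' (\<phi> i) \<le> 3 * \<epsilon>" if "t' \<in> X \<inter> D" for t'
        using bspec[OF X(3) that] le \<epsilon> by linarith
      then show ?thesis using X(1,2) by (intro exI[of _ X]) simp
    qed
    then obtain X where X: "\<And>t. t \<in> L \<Longrightarrow> open (X t) \<and> t \<in> X t \<and> (\<forall>t'\<in>X t \<inter> D. tv t' (\<phi> i) \<le> 3 * \<epsilon>)"
      by metis
    show ?thesis
    proof (intro exI[of _ "\<Union>t\<in>L. X t"] conjI ballI)
      show "open (\<Union>t\<in>L. X t)" using X by blast
      show "L \<subseteq> (\<Union>t\<in>L. X t)" using X by blast
      show "tv t (\<phi> i) \<le> 3 * \<epsilon>" if "t \<in> (\<Union>t\<in>L. X t) \<inter> F" for t using X F(2) that by blast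
    qed
  qed
  define ok :: "nat set \<times> nat set \<times> (nat \<Rightarrow> real) \<times> (nat \<Rightarrow> real) \<times> 'k set \<Rightarrow> bool" where
    "ok = (\<lambda>(J, Q, a, b, X). finite J \<and> open X \<and> L \<subseteq> X)"
  \<comment> \<open>The premise on \<open>xs\<close> makes the choice possible after every list;
    that it holds for the lists which actually arise is recovered by induction in
    \<open>okg\<close>.\<close>
  define P where "P xs = (\<lambda>(J, Q, a, b, X). (\<forall>y\<in>set xs. ok y) \<longrightarrow>
      ok (J, Q, a, b, X) \<and> J \<subseteq> {N0..} \<and> (\<forall>(J', Q', a', b', X')\<in>set xs. \<forall>j\<in>J'. \<forall>j'\<in>J. j < j') \<and>
      weighted Q a b \<tau>2 \<and> composite W A B \<kappa> J Q a b \<tau>2 \<and> (\<forall>i\<in>Q. \<forall>t\<in>X \<inter> F. tv t (\<phi> i) \<le> 3 * \<epsilon>) \<and>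
      (\<forall>(J', Q', a', b', X')\<in>set xs. \<forall>t\<in>F - X'. excess \<epsilon> t Q b \<le> \<tau>2))"
    for xs :: "(nat set \<times> nat set \<times> (nat \<Rightarrow> real) \<times> (nat \<Rightarrow> real) \<times> 'k set) list"
  have "\<exists>x. P xs x" for xs
  proof (cases "\<forall>y\<in>set xs. ok y")
    case False
    then show ?thesis by (intro exI[of _ "({}, {}, \<lambda>_. 0, \<lambda>_. 0, {})"]) (auto simp: P_def)
  next
    case True
    have fin: "finite (\<Union>y\<in>set xs. fst y)" using True by (auto simp: ok_def)
    obtain N1 where N1: "N0 \<le> N1" "\<And>j. j \<in> (\<Union>y\<in>set xs. fst y) \<Longrightarrow> j < N1"
    proof (rule that[of "max N0 (Suc (Max (\<Union>y\<in>set xs. fst y)))"])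
      show "j < max N0 (Suc (Max (\<Union>y\<in>set xs. fst y)))" if "j \<in> (\<Union>y\<in>set xs. fst y)" for j
        using Max_ge[OF fin that] by simp
    qed simp
    \<comment> \<open>The points that miss at least one earlier neighbourhood. For the empty list
      the intersection is the whole space and \<open>F'\<close> is empty, so the first composite is
      unconstrained.\<close>
    define F' where "F' = F - (\<Inter>y\<in>set xs. snd (snd (snd (snd y))))"
    have "open (\<Inter>y\<in>set xs. snd (snd (snd (snd y))))" using True by (intro open_INT) (auto simp: ok_def)
    then have "closed F'" unfolding F'_def using F(1) by (simp add: closed_Diff)
    moreover have "F' \<subseteq> D \<inter> U"
    proof
      fix t assume t: "t \<in> F'"
      then have "t \<notin> L" using True unfolding F'_def ok_def by fastforce
      then show "t \<in> D \<inter> U" using t F(2) unfolding F'_def L_def by blast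
    qed
    ultimately have tF': "tame \<epsilon> F'" by (rule U(2))
    obtain J Q a b where J: "J \<subseteq> {N1..}" and W: "weighted Q a b \<tau>2" and c: "composite W A B \<kappa> J Q a b \<tau>2"
      and e: "\<forall>t\<in>F'. excess \<epsilon> t Q b \<le> \<tau>2"
      using tameD[OF tF' s \<tau>2(1), of N1] by (elim exE conjE) (rule that, assumption+)
    have "i0 \<le> i" if i: "i \<in> Q" for i
    proof -
      obtain j where "j \<in> J" "i \<in> W j" using compositeD(2)[OF c i] by (elim bexE)
      then have "N1 \<le> j" "j \<le> i" using J supplies_index_le[OF s] by auto
      then show ?thesis using N1(1) unfolding N0_def by linarith
    qed
    then have "\<forall>i\<in>Q. \<exists>X. open X \<and> L \<subseteq> X \<and> (\<forall>t\<in>X \<inter> F. tv t (\<phi> i) \<le> 3 * \<epsilon>)" using nbhd by blast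
    then obtain X where X: "\<And>i. i \<in> Q \<Longrightarrow> open (X i) \<and> L \<subseteq> X i \<and> (\<forall>t\<in>X i \<inter> F. tv t (\<phi> i) \<le> 3 * \<epsilon>)"
      by metis
    have "P xs (J, Q, a, b, \<Inter>i\<in>Q. X i)"
      unfolding P_def prod.case
    proof (intro impI conjI)
      show "ok (J, Q, a, b, \<Inter>i\<in>Q. X i)"
        unfolding ok_def prod.case
      proof (intro conjI)
        show "finite J" by (rule compositeD(1)[OF c])
        show "open (\<Inter>i\<in>Q. X i)" using X weightedD(1)[OF W] by (intro open_INT) auto
        show "L \<subseteq> (\<Inter>i\<in>Q. X i)" using X by blast
      qed
      show "J \<subseteq> {N0..}" using J N1(1) by auto
      show "\<forall>(J', Q', a', b', X')\<in>set xs. \<forall>j\<in>J'. \<forall>j'\<in>J. j < j'"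
      proof (clarify, goal_cases)
        case (1 J' Q' a' b' X' j j')
        then have "j < N1" by (intro N1(2)) force
        then show ?case using J 1(3) by auto
      qed
      show "\<forall>i\<in>Q. \<forall>t\<in>(\<Inter>i\<in>Q. X i) \<inter> F. tv t (\<phi> i) \<le> 3 * \<epsilon>" using X by blast
      show "\<forall>(J', Q', a', b', X')\<in>set xs. \<forall>t\<in>F - X'. excess \<epsilon> t Q b \<le> \<tau>2"
      proof (clarify, goal_cases)
        case (1 J' Q' a' b' X' t)
        then have "t \<in> F'" unfolding F'_def by force
        then show ?case using e by blast
      qed
    qed (use W c in auto)
    then show ?thesis by blast
  qed
  then obtain g where g: "\<And>i. P (map g [0..<i]) (g i)" by (rule history_choice[of P]) (rule that; assumption)
  define J where "J i = fst (g i)" for i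
  define Q where "Q i = fst (snd (g i))" for i
  define a where "a i = fst (snd (snd (g i)))" for i
  define b where "b i = fst (snd (snd (snd (g i))))" for i
  define X where "X i = snd (snd (snd (snd (g i))))" for i
  have g_eq: "g i = (J i, Q i, a i, b i, X i)" for i
    unfolding J_def Q_def a_def b_def X_def by simp
  have okg: "ok (g i)" for i
  proof (induction i rule: less_induct)
    case (less i)
    then have "\<forall>y\<in>set (map g [0..<i]). ok y" by auto
    then show ?case using g[of i] unfolding P_def by (simp add: g_eq)
  qed
  then have allok: "\<forall>y\<in>set (map g [0..<i]). ok y" for i by auto
  have finJ: "finite (J i)" for i using okg[of i] unfolding ok_def g_eq by simp
  have JN: "J i \<subseteq> {N0..}" and Wg: "weighted (Q i) (a i) (b i) \<tau>2" and cg: "composite W A B \<kappa> (J i) (Q i) (a i) (b i) \<tau>2"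
    and Xg: "\<And>k t. k \<in> Q i \<Longrightarrow> t \<in> X i \<inter> F \<Longrightarrow> tv t (\<phi> k) \<le> 3 * \<epsilon>" for i
    using g[of i] allok[of i] unfolding P_def g_eq prod.case by blast+
  have Jlt: "j < j'" and eg: "t \<in> F - X k \<Longrightarrow> excess \<epsilon> t (Q l) (b l) \<le> \<tau>2"
    if "k < l" "j \<in> J k" "j' \<in> J l" for k l j j' t
  proof -
    have "(J k, Q k, a k, b k, X k) \<in> set (map g [0..<l])" using that(1) by (force simp flip: g_eq)
    then show "j < j'" "t \<in> F - X k \<Longrightarrow> excess \<epsilon> t (Q l) (b l) \<le> \<tau>2"
      using g[of l] allok[of l] that(2,3) unfolding P_def g_eq prod.case by blast+
  qed
  have Jne: "\<exists>j. j \<in> J i" for i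
    using compositeD(2)[OF cg[of i]] weighted_nonempty[OF Wg[of i]] by (meson ex_in_conv)
  have QW: "\<exists>j\<in>J l. i \<in> W j \<and> j \<le> i" if "i \<in> Q l" for i l
    using compositeD(2)[OF cg[of l] that] supplies_index_le[OF s] by blast
  have suc: "successive m Q"
    unfolding successive_def
  proof (intro conjI allI impI ballI)
    show "finite (Q l)" for l by (rule weightedD(1)[OF Wg])
    show "i < i'" if kl: "k < l" "i \<in> Q k" "i' \<in> Q l" for k l i i'
    proof -
      obtain j where j: "j \<in> J k" "i \<in> W j" using QW[OF kl(2)] by (elim bexE conjE)
      obtain j' where j': "j' \<in> J l" "i' \<in> W j'" using QW[OF kl(3)] by (elim bexE conjE)
      show ?thesis by (rule suppliesD(2)[OF s Jlt[OF kl(1) j(1) j'(1)] j(2) j'(2)])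
    qed
    show "m \<le> i" if i: "i \<in> Q l" for l i
    proof -
      obtain j where "j \<in> J l" "j \<le> i" using QW[OF i] by (elim bexE conjE)
      then show ?thesis using JN[of l] unfolding N0_def by auto
    qed
  qed
  obtain Q' a' b' where Q': "Q' \<subseteq> (\<Union>l<m. Q l)" "weighted Q' a' b' \<tau>"
    and ab: "\<And>l i. l < m \<Longrightarrow> i \<in> Q' \<inter> Q l \<Longrightarrow> a' i \<le> a l i / (w * real m) \<and> b' i \<le> b l i / (w * real m)"
    using av[rule_format, OF \<open>0 < m\<close> suc weighted_mono[OF Wg \<tau>2(2)]] by (elim exE conjE) (rule that, auto)
  have wm: "0 < w * real m" using w \<open>0 < m\<close> by simp
  have nn: "0 \<le> a l i" "0 \<le> b l i" if "i \<in> Q l" for l i using weightedD(2,3)[OF Wg[of l] that] by auto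
  show "\<exists>J Q a b. J \<subseteq> {N..} \<and> weighted Q a b \<tau>' \<and> composite W A B \<kappa> J Q a b \<tau>' \<and> (\<forall>t\<in>F. excess \<epsilon> t Q b \<le> \<tau>')"
  proof (intro exI conjI)
    show "(\<Union>l<m. J l) \<subseteq> {N..}" using JN unfolding N0_def by fastforce
    show "weighted Q' a' b' \<tau>'" by (rule weighted_mono[OF Q'(2) \<tau>(3)])
    show "composite W A B \<kappa> (\<Union>l<m. J l) Q' a' b' \<tau>'"
      unfolding composite_def
    proof (intro conjI allI impI)
      show "finite (\<Union>l<m. J l)" using finJ by simp
      show "Q' \<subseteq> (\<Union>j\<in>(\<Union>l<m. J l). W j)" using Q'(1) QW by blast
      fix f h :: "nat \<Rightarrow> real"
      assume nn': "\<forall>i. 0 \<le> f i \<and> 0 \<le> h i"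
        and le: "\<forall>j\<in>\<Union>l<m. J l. (\<Sum>i\<in>W j. A j i * f i + B j i * h i) \<le> \<kappa> j"
      have q: "(\<Sum>i\<in>Q l. a l i * f i + b l i * h i) \<le> \<tau>2" if "l < m" for l
        by (rule compositeD(3)[OF cg[of l] nn']) (use le that in blast)
      have "(\<Sum>i\<in>Q'. a' i * f i + b' i * h i) = (\<Sum>i\<in>Q'. a' i * f i) + (\<Sum>i\<in>Q'. b' i * h i)"
        by (rule sum.distrib)
      also have "\<dots> \<le> (\<Sum>l<m. \<Sum>i\<in>Q l. a l i * f i) / (w * real m) + (\<Sum>l<m. \<Sum>i\<in>Q l. b l i * h i) / (w * real m)"
        by (intro add_mono sum_le_average[OF suc Q'(1) wm]) (use nn nn' ab in auto)
      also have "\<dots> = (\<Sum>l<m. \<Sum>i\<in>Q l. a l i * f i + b l i * h i) / (w * real m)"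
        by (simp add: sum.distrib add_divide_distrib)
      also have "\<dots> \<le> (\<Sum>l<m. \<tau>2) / (w * real m)"
        using q wm by (intro divide_right_mono sum_mono) auto
      also have "\<dots> = \<tau>2 / w" using \<open>0 < m\<close> by simp
      also have "\<dots> \<le> w * \<tau> / 2 / w" using \<tau>2(3) w(1) by (intro divide_right_mono) auto
      also have "\<dots> \<le> \<tau>'" using w \<tau> by simp
      finally show "(\<Sum>i\<in>Q'. a' i * f i + b' i * h i) \<le> \<tau>'" .
    qed
    show "\<forall>t\<in>F. excess \<epsilon> t Q' b' \<le> \<tau>'"
    proof
      fix t assume t: "t \<in> F"
      \<comment> \<open>If t lies in every \<open>X l\<close>, this k is unspecified; that is
        harmless, as one term may always be estimated by the norm of T.\<close>
      define k where "k = (LEAST l. t \<notin> X l)"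
      have ex: "excess \<epsilon> t (Q l) (b l) \<le> (if l = k then norm T else \<tau>2)" for l
      proof -
        consider "l = k" | "t \<in> X l" | "t \<notin> X l" "l \<noteq> k" by blast
        then show ?thesis
        proof cases
          case 1
          then show ?thesis using excess_le_norm[OF Wg \<epsilon>] by simp
        next
          case 2
          then have "excess \<epsilon> t (Q l) (b l) = 0" using t Xg by (intro excess_zero) auto
          then show ?thesis using \<tau>2(1) by simp
        next
          case 3
          have "t \<notin> X k" unfolding k_def by (rule LeastI[of "\<lambda>l. t \<notin> X l"]) (rule 3)
          moreover have "k \<le> l" unfolding k_def by (rule Least_le) (rule 3)
          then have "k < l" using 3(2) by simp
          moreover obtain j j' where "j \<in> J k" "j' \<in> J l" using Jne by blast
          ultimately have "excess \<epsilon> t (Q l) (b l) \<le> \<tau>2" using eg t by blast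
          then show ?thesis using 3(2) by simp
        qed
      qed
      have "excess \<epsilon> t Q' b' \<le> (\<Sum>l<m. excess \<epsilon> t (Q l) (b l)) / (w * real m)"
        unfolding excess_def by (rule sum_le_average[OF suc Q'(1) wm]) (use nn ab in auto)
      also have "\<dots> \<le> (norm T + real m * \<tau>2) / (w * real m)"
      proof (intro divide_right_mono)
        have "(\<Sum>l<m. excess \<epsilon> t (Q l) (b l)) \<le> (\<Sum>l<m. (if l = k then norm T else 0) + \<tau>2)"
          using ex \<tau>2(1) by (intro sum_mono) (smt (verit) norm_ge_zero)
        also have "\<dots> = (\<Sum>l<m. if l = k then norm T else 0) + real m * \<tau>2" by (simp add: sum.distrib)
        also have "(\<Sum>l<m. if l = k then norm T else 0) \<le> norm T" by (simp add: sum.delta)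
        finally show "(\<Sum>l<m. excess \<epsilon> t (Q l) (b l)) \<le> norm T + real m * \<tau>2" by simp
      qed (use wm in simp)
      also have "\<dots> \<le> \<tau>"
      proof -
        have "real m * \<tau>2 \<le> real m * (w * \<tau> / 2)" by (rule mult_left_mono[OF \<tau>2(3)]) simp
        then have "norm T + real m * \<tau>2 \<le> \<tau> * (w * real m)" using Tm by (simp add: algebra_simps)
        then show ?thesis using wm by (simp add: pos_divide_le_eq)
      qed
      finally show "excess \<epsilon> t Q' b' \<le> \<tau>'" using \<tau>(3) by simp
    qed
  qed
qed

text \<open>Tameness of all closed subsets passes to unions of chains because a closed set is
  compact and hence contained in one member; no limit of averages has to be formed.\<close>

lemma tame_of_thin:
  assumes \<epsilon>: "0 < \<epsilon>"
    and null: "\<And>t. t \<in> R \<Longrightarrow> (\<lambda>i. tv t (\<phi> i)) \<longlonglongrightarrow> 0"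
    and usc: "\<And>t i. t \<in> D \<Longrightarrow> \<exists>U. open U \<and> t \<in> U \<and> (\<forall>t'\<in>U \<inter> D. tv t' (\<phi> i) \<le> tv t (\<phi> i) + \<epsilon>)"
    and thin: "\<And>L. L \<noteq> {} \<Longrightarrow> L \<subseteq> D \<Longrightarrow> \<exists>V S \<kappa>. open V \<and> V \<inter> L \<noteq> {} \<and> S \<subseteq> R \<and> thin \<epsilon> (V \<inter> L) S \<kappa>"
    and F: "closed F" "F \<subseteq> D"
  shows "tame \<epsilon> F"
proof -
  have "\<exists>U. open U \<and> (\<forall>F. closed F \<longrightarrow> F \<subseteq> D \<inter> U \<longrightarrow> tame \<epsilon> F) \<and> D \<subseteq> U"
  proof (rule open_exhaustion[of "\<lambda>U. \<forall>F. closed F \<longrightarrow> F \<subseteq> D \<inter> U \<longrightarrow> tame \<epsilon> F" D])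
    show "\<forall>F. closed F \<longrightarrow> F \<subseteq> D \<inter> {} \<longrightarrow> tame \<epsilon> F" using tame_empty by simp
  next
    fix \<C> assume ne: "\<C> \<noteq> {}" and ch: "subset.chain {U. open U \<and> (\<forall>F. closed F \<longrightarrow> F \<subseteq> D \<inter> U \<longrightarrow> tame \<epsilon> F)} \<C>"
    show "\<forall>F. closed F \<longrightarrow> F \<subseteq> D \<inter> \<Union>\<C> \<longrightarrow> tame \<epsilon> F"
    proof (intro allI impI)
      fix F assume F: "closed F" "F \<subseteq> D \<inter> \<Union>\<C>"
      have "compact F" using F(1) compact_UNIV by (metis closed_Int_compact inf_top.right_neutral)
      then obtain X where X: "X \<in> \<C>" "F \<subseteq> X" using compact_subset_chain[OF _ _ ne ch, of F] F(2) by (meson inf.boundedE)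
      then have "\<forall>F. closed F \<longrightarrow> F \<subseteq> D \<inter> X \<longrightarrow> tame \<epsilon> F" using ch unfolding subset.chain_def by (elim conjE) (drule (1) subsetD, simp)
      then show "tame \<epsilon> F" using F X by simp
    qed
  next
    fix U assume U: "open U" "\<forall>F. closed F \<longrightarrow> F \<subseteq> D \<inter> U \<longrightarrow> tame \<epsilon> F" "D - U \<noteq> {}"
    obtain V S \<kappa> where V: "open V" "V \<inter> (D - U) \<noteq> {}" "S \<subseteq> R" "thin \<epsilon> (V \<inter> (D - U)) S \<kappa>"
      using thin[OF U(3) Diff_subset] by (elim exE conjE) (rule that, auto)
    have "tame \<epsilon> F" if "closed F" "F \<subseteq> D \<inter> (U \<union> V)" for F
      by (rule tame_step[OF \<epsilon> null usc U(1) _ V(1,3,4) that]) (use U(2) in auto)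
    then show "\<exists>V. open V \<and> V \<inter> (D - U) \<noteq> {} \<and> (\<forall>F. closed F \<longrightarrow> F \<subseteq> D \<inter> (U \<union> V) \<longrightarrow> tame \<epsilon> F)"
      using V(1,2) by (intro exI[of _ V]) simp
  next
    fix U assume "open U" "\<forall>F. closed F \<longrightarrow> F \<subseteq> D \<inter> U \<longrightarrow> tame \<epsilon> F" "D \<subseteq> U"
    then show "\<exists>U. open U \<and> (\<forall>F. closed F \<longrightarrow> F \<subseteq> D \<inter> U \<longrightarrow> tame \<epsilon> F) \<and> D \<subseteq> U" by (intro exI[of _ U]) simp
  qed
  then show ?thesis using F by (elim exE conjE) (simp add: inf.absorb1)
qed

end

subsection \<open>Combining the strata\<close>

context ck_operator
begin

lemma closed_tvnorm_le: "closed {t. tvnorm t \<le> c}"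
proof -
  have "- {t. tvnorm t \<le> c} = {t. c < tv t (\<lambda>_. 1)}" by (auto simp: tvnorm_def)
  moreover have "open {t. c < tv t (\<lambda>_. 1)}" by (rule open_tv_gt) auto
  ultimately show ?thesis by (simp add: closed_def)
qed

text \<open>Total variation is only lower semicontinuous, but where the total mass is almost constant
  lower semicontinuity on \<open>1 - f\<close> gives upper semicontinuity on \<open>f\<close>.\<close>

lemma tv_almost_usc:
  assumes f: "test f" and t: "c < tvnorm t" and e: "0 < e"
  shows "\<exists>U. open U \<and> t \<in> U \<and> (\<forall>t'\<in>U. tvnorm t' \<le> c + e \<longrightarrow> tv t' f \<le> tv t f + 2 * e)"
proof -
  have c: "continuous_on UNIV (\<lambda>x. 1 - f x)" "0 \<le> 1 - f x" for x
    using testD[OF f] by (auto intro!: continuous_intros)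
  have d: "tv s (\<lambda>x. 1 - f x) = tvnorm s - tv s f" for s
    unfolding tvnorm_def by (rule tv_diff) (use testD[OF f] in auto)
  let ?U = "{s. tv t (\<lambda>x. 1 - f x) - e < tv s (\<lambda>x. 1 - f x)}"
  have "open ?U" by (rule open_tv_gt[OF c])
  moreover have "t \<in> ?U" using e by simp
  moreover have "tv s f \<le> tv t f + 2 * e" if "s \<in> ?U" "tvnorm s \<le> c + e" for s
    using that t unfolding d by simp
  ultimately show ?thesis by (intro exI[of _ ?U]) simp
qed

end

section \<open>From one stratum to the next\<close>

context l1_blocks
begin

text \<open>The cost of replacing the functional at t by the one at s, plus the excess at s. It has
  the form of a sum a f + b g with f, g \<ge> 0, exactly what \<open>composite\<close> passes
  on.\<close>

definition deviation :: "real \<Rightarrow> 'k \<Rightarrow> 'k \<Rightarrow> nat set \<Rightarrow> (nat \<Rightarrow> real) \<Rightarrow> (nat \<Rightarrow> real) \<Rightarrow> real" where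
  "deviation \<epsilon> t s Q a b = (\<Sum>i\<in>Q. a i * \<bar>T (z i) t - T (z i) s\<bar> + b i * max 0 (tv s (\<phi> i) - 3 * \<epsilon>))"

text \<open>At each point of \<open>F\<close> the sequence splits, after removing at most \<open>n\<close> terms, into at most
  \<open>n + 1\<close> runs, and on each run the functional at \<open>t\<close> may be replaced by one at a point \<open>\<theta> j\<close>, common
  to the run, that gives almost no mass to the large values.\<close>

definition controls :: "real \<Rightarrow> nat \<Rightarrow> (nat \<Rightarrow> nat set) \<Rightarrow> (nat \<Rightarrow> nat \<Rightarrow> real) \<Rightarrow> (nat \<Rightarrow> nat \<Rightarrow> real) \<Rightarrow>
    (nat \<Rightarrow> real) \<Rightarrow> 'k set \<Rightarrow> bool" where
  "controls \<epsilon> n W A B \<kappa> F \<longleftrightarrow> (\<forall>t\<in>F. \<exists>c \<theta>. finite c \<and> card c \<le> n \<and>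
     (\<forall>j. j \<notin> c \<longrightarrow> deviation \<epsilon> t (\<theta> j) (W j) (A j) (B j) \<le> \<kappa> j) \<and>
     (\<forall>j j'. j \<le> j' \<longrightarrow> {j..j'} \<inter> c = {} \<longrightarrow> \<theta> j = \<theta> j'))"

lemma controlsD:
  assumes "controls \<epsilon> n W A B \<kappa> F" "t \<in> F"
  obtains c \<theta> where "finite c" "card c \<le> n" "\<And>j. j \<notin> c \<Longrightarrow> deviation \<epsilon> t (\<theta> j) (W j) (A j) (B j) \<le> \<kappa> j"
    "\<And>j j'. j \<le> j' \<Longrightarrow> {j..j'} \<inter> c = {} \<Longrightarrow> \<theta> j = \<theta> j'"
proof -
  have "\<exists>c \<theta>. finite c \<and> card c \<le> n \<and> (\<forall>j. j \<notin> c \<longrightarrow> deviation \<epsilon> t (\<theta> j) (W j) (A j) (B j) \<le> \<kappa> j) \<and>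
     (\<forall>j j'. j \<le> j' \<longrightarrow> {j..j'} \<inter> c = {} \<longrightarrow> \<theta> j = \<theta> j')"
    using assms(1)[unfolded controls_def, rule_format, OF assms(2)] .
  then obtain c \<theta> where c: "finite c" "card c \<le> n" "\<forall>j. j \<notin> c \<longrightarrow> deviation \<epsilon> t (\<theta> j) (W j) (A j) (B j) \<le> \<kappa> j"
     "\<forall>j j'. j \<le> j' \<longrightarrow> {j..j'} \<inter> c = {} \<longrightarrow> \<theta> j = \<theta> j'" by (elim exE conjE)
  show ?thesis by (rule that[of c \<theta>, OF c(1,2)]) (use c(3,4) in auto)
qed

lemma deviation_composite:
  assumes c: "composite W A B \<kappa> J Q a b \<eta>" and d: "\<And>l. l \<in> J \<Longrightarrow> deviation \<epsilon> t s (W l) (A l) (B l) \<le> \<kappa> l"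
  shows "deviation \<epsilon> t s Q a b \<le> \<eta>"
  unfolding deviation_def by (rule compositeD(3)[OF c]) (use d in \<open>auto simp: deviation_def\<close>)

lemma deviation_self: "deviation \<epsilon> t t Q a b = excess \<epsilon> t Q b"
  unfolding deviation_def excess_def by simp

lemma deviation_triangle:
  assumes "\<And>i. i \<in> Q \<Longrightarrow> 0 \<le> a i"
  shows "deviation \<epsilon> t u Q a b \<le> (\<Sum>i\<in>Q. a i * \<bar>T (z i) t - T (z i) s\<bar>) + deviation \<epsilon> s u Q a b"
  unfolding deviation_def sum.distrib[symmetric]
proof (rule sum_mono)
  fix i assume "i \<in> Q"
  then have "a i * \<bar>T (z i) t - T (z i) u\<bar> \<le> a i * (\<bar>T (z i) t - T (z i) s\<bar> + \<bar>T (z i) s - T (z i) u\<bar>)"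
    using assms by (intro mult_left_mono) auto
  then show "a i * \<bar>T (z i) t - T (z i) u\<bar> + b i * max 0 (tv u (\<phi> i) - 3 * \<epsilon>)
    \<le> a i * \<bar>T (z i) t - T (z i) s\<bar> + (a i * \<bar>T (z i) s - T (z i) u\<bar> + b i * max 0 (tv u (\<phi> i) - 3 * \<epsilon>))"
    by (simp add: distrib_left)
qed

text \<open>Each composite comes with an open set U k containing K0. Outside U k points of K' have
  small excess for all later composites, because K' - U k is closed and misses K0. Inside U k the
  composites up to k see t as if it were some point s of K0, by continuity of the functions T (z i).
  Removing from U k the k-th piece of an exhaustion of the complement of K0 by closed sets forces
  every point outside K0 to leave.\<close>

lemma stratum_sequence:
  assumes met: "metrizable_space (euclidean :: 'k topology)" and \<epsilon>: "0 < \<epsilon>"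
    and tame: "\<And>F. closed F \<Longrightarrow> F \<subseteq> K' - K0 \<Longrightarrow> tame \<epsilon> F"
    and K: "closed K0" "closed K'"
    and s: "supplies W A B \<kappa>"
  obtains J Q a b U where
    "\<And>l. J l \<noteq> {}" "\<And>k l j j'. k < l \<Longrightarrow> j \<in> J k \<Longrightarrow> j' \<in> J l \<Longrightarrow> j < j'"
    "\<And>l. weighted (Q l) (a l) (b l) (1/2^l)" "\<And>l. composite W A B \<kappa> (J l) (Q l) (a l) (b l) (1/2^l)"
    "\<And>k l t. k < l \<Longrightarrow> t \<in> K' - U k \<Longrightarrow> excess \<epsilon> t (Q l) (b l) \<le> 1/2^l"
    "\<And>k t. t \<in> U k \<Longrightarrow> \<exists>s\<in>K0. \<forall>l\<le>k. (\<Sum>i\<in>Q l. a l i * \<bar>T (z i) t - T (z i) s\<bar>) \<le> 1/2^k"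
    "\<And>t. t \<notin> K0 \<Longrightarrow> \<exists>k. t \<notin> U k"
proof -
  have "open (- K0)" using K by auto
  then obtain C :: "nat \<Rightarrow> 'k set" where C: "\<And>n. closed (C n)" "\<And>n. C n \<subseteq> C (Suc n)" "(\<Union>n. C n) = - K0"
    by (rule open_ascending_closed[OF met]) (rule that; assumption)
  have CK: "C n \<inter> K0 = {}" for n
  proof -
    have "C n \<subseteq> - K0" unfolding C(3)[symmetric] by (rule UN_upper) simp
    then show ?thesis by auto
  qed
  define near where "near k y t x = ((\<Sum>i\<in>fst (snd y). fst (snd (snd y)) i * \<bar>T (z i) t - T (z i) x\<bar>) < 1/2^k)"
    for k :: nat and y :: "nat set \<times> nat set \<times> (nat \<Rightarrow> real) \<times> (nat \<Rightarrow> real) \<times> 'k set" and t x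
  have open_near: "open {t. near k y t x}" for k y x
    unfolding near_def
    by (intro open_Collect_less continuous_intros continuous_on_apply_bcontfun)
  have near_refl: "near k y x x" for k y x unfolding near_def by simp
  define ok :: "nat set \<times> nat set \<times> (nat \<Rightarrow> real) \<times> (nat \<Rightarrow> real) \<times> 'k set \<Rightarrow> bool" where
    "ok y \<longleftrightarrow> finite (fst y) \<and> open (snd (snd (snd (snd y)))) \<and> K0 \<subseteq> snd (snd (snd (snd y)))" for y
  define nice where "nice xs x \<longleftrightarrow> (case x of (J, Q, a, b, X) \<Rightarrow>
      (\<forall>y\<in>set xs. \<forall>j\<in>fst y. \<forall>j'\<in>J. j < j') \<and>
      weighted Q a b (1/2^length xs) \<and> composite W A B \<kappa> J Q a b (1/2^length xs) \<and>
      (\<forall>y\<in>set xs. \<forall>t\<in>K' - snd (snd (snd (snd y))). excess \<epsilon> t Q b \<le> 1/2^length xs) \<and>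
      X = (\<Union>s\<in>K0. \<Inter>y\<in>set (xs @ [(J, Q, a, b, {})]). {t. near (length xs) y t s}) - C (length xs))"
    for xs :: "(nat set \<times> nat set \<times> (nat \<Rightarrow> real) \<times> (nat \<Rightarrow> real) \<times> 'k set) list" and x
  define P where "P xs x \<longleftrightarrow> ((\<forall>y\<in>set xs. ok y) \<longrightarrow> ok x \<and> nice xs x)"
    for xs :: "(nat set \<times> nat set \<times> (nat \<Rightarrow> real) \<times> (nat \<Rightarrow> real) \<times> 'k set) list" and x
  have half_pos: "(0::real) < 1/2^n" for n by simp
  have "\<exists>x. P xs x" for xs
  proof (cases "\<forall>y\<in>set xs. ok y")
    case False
    then have "P xs x" for x unfolding P_def by (rule impI[OF notE])
    then show ?thesis by (rule exI)
  next
    case True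
    let ?k = "length xs"
    have fin: "finite (\<Union>y\<in>set xs. fst y)" using True by (simp add: ok_def)
    define N1 where "N1 = Suc (Max (\<Union>y\<in>set xs. fst y))"
    have N1: "j < N1" if "j \<in> (\<Union>y\<in>set xs. fst y)" for j
      unfolding N1_def using Max_ge[OF fin that] by simp
    define F' where "F' = K' - (\<Inter>y\<in>set xs. snd (snd (snd (snd y))))"
    have "open (\<Inter>y\<in>set xs. snd (snd (snd (snd y))))" using True by (intro open_INT) (simp_all add: ok_def)
    then have "closed F'" unfolding F'_def using K(2) by (simp add: closed_Diff)
    moreover have "K0 \<subseteq> (\<Inter>y\<in>set xs. snd (snd (snd (snd y))))" using True by (intro INT_greatest) (simp add: ok_def)
    then have "F' \<subseteq> K' - K0" unfolding F'_def by blast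
    ultimately have tF': "tame \<epsilon> F'" by (rule tame)
    obtain J Q a b where J: "J \<subseteq> {N1..}" and W: "weighted Q a b (1/2^?k)" and c: "composite W A B \<kappa> J Q a b (1/2^?k)"
      and e: "\<forall>t\<in>F'. excess \<epsilon> t Q b \<le> 1/2^?k"
      using tameD[OF tF' s half_pos[of ?k], of N1] by (elim exE conjE) (rule that, assumption+)
    \<comment> \<open>The last entry is the composite just chosen; its fifth component is a
      placeholder that \<open>near\<close> does not inspect.\<close>
    define X where "X = (\<Union>s\<in>K0. \<Inter>y\<in>set (xs @ [(J, Q, a, b, {})]). {t. near ?k y t s}) - C ?k"
    have "open X" unfolding X_def
      by (intro open_Diff open_UN ballI open_INT open_near C(1)) simp_all
    moreover have "K0 \<subseteq> X"
    proof
      fix x assume x: "x \<in> K0"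
      then have "x \<notin> C ?k" using CK[of ?k] by (meson disjoint_iff)
      then show "x \<in> X" unfolding X_def using x near_refl by (intro DiffI UN_I INT_I) auto
    qed
    ultimately have "ok (J, Q, a, b, X)" unfolding ok_def using compositeD(1)[OF c] by simp
    moreover have "nice xs (J, Q, a, b, X)"
      unfolding nice_def prod.case
    proof (intro conjI ballI)
      fix y j j' assume y: "y \<in> set xs" "j \<in> fst y" "j' \<in> J"
      have "j < N1" by (rule N1) (use y in auto)
      moreover have "N1 \<le> j'" using J y(3) by auto
      ultimately show "j < j'" by simp
    next
      fix y t assume "y \<in> set xs" "t \<in> K' - snd (snd (snd (snd y)))"
      then have "t \<in> F'" unfolding F'_def by blast
      then show "excess \<epsilon> t Q b \<le> 1/2^?k" using e by (rule bspec[rotated])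
    qed (use W c X_def in simp_all)
    ultimately show ?thesis unfolding P_def by (intro exI[of _ "(J, Q, a, b, X)"]) simp
  qed
  then obtain g where g: "\<And>i. P (map g [0..<i]) (g i)" by (rule history_choice[of P]) (rule that; assumption)
  have okg: "ok (g i)" for i
  proof (induction i rule: less_induct)
    case (less i)
    then have "\<forall>y\<in>set (map g [0..<i]). ok y" by simp
    then show ?case using g[of i] unfolding P_def by simp
  qed
  have niceg: "nice (map g [0..<i]) (g i)" for i
  proof -
    have "\<forall>y\<in>set (map g [0..<i]). ok y" using okg by simp
    then show ?thesis using g[of i] unfolding P_def by simp
  qed
  define J where "J i = fst (g i)" for i
  define Q where "Q i = fst (snd (g i))" for i
  define a where "a i = fst (snd (snd (g i)))" for i
  define b where "b i = fst (snd (snd (snd (g i))))" for i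
  define X where "X i = snd (snd (snd (snd (g i))))" for i
  have g_eq: "g i = (J i, Q i, a i, b i, X i)" for i
    unfolding J_def Q_def a_def b_def X_def by simp
  note n = niceg[unfolded nice_def g_eq prod.case length_map length_upt diff_zero]
  have Wg: "weighted (Q i) (a i) (b i) (1/2^i)" and cg: "composite W A B \<kappa> (J i) (Q i) (a i) (b i) (1/2^i)"
    and Xg: "X i = (\<Union>s\<in>K0. \<Inter>y\<in>set (map g [0..<i] @ [(J i, Q i, a i, b i, {})]). {t. near i y t s}) - C i" for i
    using n[of i] unfolding g_eq by simp_all
  have Jlt: "j < j'" if "k < l" "j \<in> J k" "j' \<in> J l" for k l j j'
  proof -
    have "(J k, Q k, a k, b k, X k) \<in> set (map g [0..<l])" using that(1) by (force simp flip: g_eq)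
    with n[of l] have "\<forall>j\<in>fst (J k, Q k, a k, b k, X k). \<forall>j'\<in>J l. j < j'"
      unfolding g_eq by (elim conjE) (drule (1) bspec)
    then show ?thesis using that(2,3) by simp
  qed
  have eg: "excess \<epsilon> t (Q l) (b l) \<le> 1/2^l" if "k < l" "t \<in> K' - X k" for k l t
  proof -
    have "(J k, Q k, a k, b k, X k) \<in> set (map g [0..<l])" using that(1) by (force simp flip: g_eq)
    with n[of l] have "\<forall>t\<in>K' - snd (snd (snd (snd (J k, Q k, a k, b k, X k)))). excess \<epsilon> t (Q l) (b l) \<le> 1/2^l"
      unfolding g_eq by (elim conjE) (drule (1) bspec, drule (1) bspec)
    then show ?thesis using that(2) by simp
  qed
  show ?thesis
  proof (rule that[of J Q a b X])
    show "J l \<noteq> {}" for l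
    proof
      assume "J l = {}"
      then have "Q l = {}" using compositeD(2)[OF cg[of l]] by fastforce
      then show False using weighted_nonempty[OF Wg] by simp
    qed
    show "\<exists>s\<in>K0. \<forall>l\<le>k. (\<Sum>i\<in>Q l. a l i * \<bar>T (z i) t - T (z i) s\<bar>) \<le> 1/2^k" if tX: "t \<in> X k" for k t
    proof -
      obtain x where x: "x \<in> K0" "\<forall>y\<in>set (map g [0..<k] @ [(J k, Q k, a k, b k, {})]). near k y t x"
        using tX unfolding Xg[of k] by (elim DiffE UN_E) (rule that, simp_all)
      have "(\<Sum>i\<in>Q l. a l i * \<bar>T (z i) t - T (z i) x\<bar>) \<le> 1/2^k" if l: "l \<le> k" for l
      proof (cases "l = k")
        case True
        have "near k (J k, Q k, a k, b k, {}) t x" using x(2) by simp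
        then show ?thesis using True unfolding near_def by simp
      next
        case False
        then have "near k (g l) t x" using x(2) l by simp
        then show ?thesis unfolding near_def g_eq by simp
      qed
      then show ?thesis using x(1) by blast
    qed
    show "\<exists>k. t \<notin> X k" if "t \<notin> K0" for t
    proof -
      have "t \<in> (\<Union>n. C n)" unfolding C(3) using that by simp
      then obtain k where "t \<in> C k" by (elim UN_E)
      then have "t \<notin> X k" unfolding Xg by simp
      then show ?thesis by blast
    qed
  qed (use Jlt Wg cg eg in simp_all)
qed

text \<open>For t in K' - K0 let k be the first index with t outside U k. Terms before k follow a
  point of K0 with its runs, since t \<in> U (k - 1); terms after k are controlled at t itself; term
  k is given up. So one removed term and one run are added.\<close>

lemma stratum_step:
  assumes met: "metrizable_space (euclidean :: 'k topology)" and \<epsilon>: "0 < \<epsilon>"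
    and tame: "\<And>F. closed F \<Longrightarrow> F \<subseteq> K' - K0 \<Longrightarrow> tame \<epsilon> F"
    and K: "closed K0" "closed K'"
    and s: "supplies W A B \<kappa>" and ctl: "controls \<epsilon> n W A B \<kappa> K0"
  shows "\<exists>W A B \<kappa>. supplies W A B \<kappa> \<and> controls \<epsilon> (Suc n) W A B \<kappa> K'"
proof -
  obtain J Q a b U where
    Jne: "\<And>l. J l \<noteq> {}" and Jlt: "\<And>k l j j'. k < l \<Longrightarrow> j \<in> J k \<Longrightarrow> j' \<in> J l \<Longrightarrow> j < j'"
    and W: "\<And>l. weighted (Q l) (a l) (b l) (1/2^l)" and cm: "\<And>l. composite W A B \<kappa> (J l) (Q l) (a l) (b l) (1/2^l)"
    and ex: "\<And>k l t. k < l \<Longrightarrow> t \<in> K' - U k \<Longrightarrow> excess \<epsilon> t (Q l) (b l) \<le> 1/2^l"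
    and nr: "\<And>k t. t \<in> U k \<Longrightarrow> \<exists>s\<in>K0. \<forall>l\<le>k. (\<Sum>i\<in>Q l. a l i * \<bar>T (z i) t - T (z i) s\<bar>) \<le> 1/2^k"
    and esc: "\<And>t. t \<notin> K0 \<Longrightarrow> \<exists>k. t \<notin> U k"
    by (rule stratum_sequence[OF met \<epsilon> tame K s]; (assumption | (rule that; assumption)))
  define M where "M l = Max (J l)" for l
  have finJ: "finite (J l)" for l by (rule compositeD(1)[OF cm])
  have MJ: "M l \<in> J l" and JM: "j \<in> J l \<Longrightarrow> j \<le> M l" for l j
    unfolding M_def using finJ Jne by simp_all
  have Mlt: "k < l \<Longrightarrow> M k < M l" for k l by (rule Jlt[OF _ MJ MJ])
  have Mle: "k \<le> l \<Longrightarrow> M k \<le> M l" for k l using Mlt[of k l] by (cases "k = l") auto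
  have Mge: "l \<le> M l" for l
  proof (induction l)
    case (Suc l)
    then show ?case using Mlt[of l "Suc l"] by simp
  qed simp
  \<comment> \<open>This sends an old index to the new term that it can affect, indices in gaps
    being assigned to the next term. As r is monotone, runs of old indices become runs of new ones,
    and the image of the removed indices is no larger than before.\<close>
  define r where "r j = (LEAST l. j \<le> M l)" for j
  have r1: "j \<le> M (r j)" for j unfolding r_def using Mge by (rule LeastI)
  have r2: "r j \<le> l" if "j \<le> M l" for j l unfolding r_def using that by (rule Least_le)
  have rJ: "r j = l" if "j \<in> J l" for j l
  proof -
    have "r j \<le> l" by (rule r2[OF JM[OF that]])
    moreover have "\<not> r j < l"
    proof
      assume "r j < l"
      then have "M (r j) < j" by (rule Jlt[OF _ MJ that])
      then show False using r1[of j] by simp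
    qed
    ultimately show ?thesis by simp
  qed
  have rM: "r (M l) = l" for l by (rule rJ[OF MJ])
  have rmono: "j \<le> j' \<Longrightarrow> r j \<le> r j'" for j j' by (rule r2[OF order_trans[OF _ r1]])
  have inner: "\<exists>c \<theta>. finite c \<and> card c \<le> n \<and> (\<forall>l. l \<notin> c \<longrightarrow> deviation \<epsilon> t (\<theta> l) (Q l) (a l) (b l) \<le> 1/2^l) \<and>
      (\<forall>l l'. l \<le> l' \<longrightarrow> {l..l'} \<inter> c = {} \<longrightarrow> \<theta> l = \<theta> l')" if t: "t \<in> K0" for t
  proof -
    obtain c \<theta> where c: "finite c" "card c \<le> n" and dev: "\<And>j. j \<notin> c \<Longrightarrow> deviation \<epsilon> t (\<theta> j) (W j) (A j) (B j) \<le> \<kappa> j"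
      and const: "\<And>j j'. j \<le> j' \<Longrightarrow> {j..j'} \<inter> c = {} \<Longrightarrow> \<theta> j = \<theta> j'"
      by (rule controlsD[OF ctl t]) (rule that; assumption)
    show ?thesis
    proof (intro exI[of _ "r ` c"] exI[of _ "\<lambda>l. \<theta> (M l)"] conjI allI impI)
      show "finite (r ` c)" using c by simp
      show "card (r ` c) \<le> n" using c card_image_le[of c r] by simp
      show "deviation \<epsilon> t (\<theta> (M l)) (Q l) (a l) (b l) \<le> 1/2^l" if l: "l \<notin> r ` c" for l
      proof (rule deviation_composite[OF cm])
        fix j assume j: "j \<in> J l"
        have "p \<notin> c" if "j \<le> p" "p \<le> M l" for p
        proof
          assume "p \<in> c"
          moreover have "r p = l" using rmono[OF that(1)] rmono[OF that(2)] rJ[OF j] rM[of l] by simp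
          ultimately show False using l by blast
        qed
        then have "{j..M l} \<inter> c = {}" "j \<notin> c" using JM[OF j] by auto
        then show "deviation \<epsilon> t (\<theta> (M l)) (W j) (A j) (B j) \<le> \<kappa> j"
          using const[OF JM[OF j]] dev[of j] by simp
      qed
      show "\<theta> (M l) = \<theta> (M l')" if l: "l \<le> l'" "{l..l'} \<inter> r ` c = {}" for l l'
      proof (rule const[OF Mle[OF l(1)]])
        show "{M l..M l'} \<inter> c = {}"
        proof (rule ccontr)
          assume "{M l..M l'} \<inter> c \<noteq> {}"
          then obtain p where p: "M l \<le> p" "p \<le> M l'" "p \<in> c" by auto
          then have "l \<le> r p" "r p \<le> l'" using rmono[OF p(1)] rmono[OF p(2)] rM by simp_all
          then show False using l(2) p(3) by auto
        qed
      qed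
    qed
  qed
  have nn: "0 \<le> a l i" if "i \<in> Q l" for l i by (rule weightedD(2)[OF W that])
  \<comment> \<open>The factor 2 absorbs the comparison with a nearby point of K0: for l \<le> k'
    its cost 1/2^k' is at most 1/2^l.\<close>
  have "supplies Q a b (\<lambda>l. 2 * (1/2^l))"
    unfolding supplies_def
  proof (intro conjI allI impI ballI)
    show "weighted (Q l) (a l) (b l) (2 * (1/2^l))" for l
      by (rule weighted_mono[OF W]) (simp add: divide_right_mono)
    show "i < i'" if kl: "k < l" "i \<in> Q k" "i' \<in> Q l" for k l i i'
    proof -
      obtain j where j: "j \<in> J k" "i \<in> W j" using compositeD(2)[OF cm kl(2)] by (elim bexE)
      obtain j' where j': "j' \<in> J l" "i' \<in> W j'" using compositeD(2)[OF cm kl(3)] by (elim bexE)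
      show ?thesis by (rule suppliesD(2)[OF s Jlt[OF kl(1) j(1) j'(1)] j(2) j'(2)])
    qed
    have "(\<lambda>l. 2 * (1/2)^l :: real) \<longlonglongrightarrow> 2 * 0" by (intro tendsto_mult tendsto_const LIMSEQ_power_zero) simp
    then show "(\<lambda>l. 2 * (1/2^l) :: real) \<longlonglongrightarrow> 0" by (simp add: power_one_over)
  qed
  moreover have "controls \<epsilon> (Suc n) Q a b (\<lambda>l. 2 * (1/2^l)) K'"
    unfolding controls_def
  proof
    fix t assume t: "t \<in> K'"
    show "\<exists>c \<theta>. finite c \<and> card c \<le> Suc n \<and> (\<forall>l. l \<notin> c \<longrightarrow> deviation \<epsilon> t (\<theta> l) (Q l) (a l) (b l) \<le> 2 * (1/2^l)) \<and>
      (\<forall>l l'. l \<le> l' \<longrightarrow> {l..l'} \<inter> c = {} \<longrightarrow> \<theta> l = \<theta> l')"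
    proof (cases "t \<in> K0")
      case True
      obtain c \<theta> where c: "finite c" "card c \<le> n" and dev: "\<forall>l. l \<notin> c \<longrightarrow> deviation \<epsilon> t (\<theta> l) (Q l) (a l) (b l) \<le> 1/2^l"
        and const: "\<forall>l l'. l \<le> l' \<longrightarrow> {l..l'} \<inter> c = {} \<longrightarrow> \<theta> l = \<theta> l'" using inner[OF True] by (elim exE conjE)
      have "deviation \<epsilon> t (\<theta> l) (Q l) (a l) (b l) \<le> 2 * (1/2^l)" if "l \<notin> c" for l
      proof -
        have "deviation \<epsilon> t (\<theta> l) (Q l) (a l) (b l) \<le> 1/2^l" using dev that by simp
        moreover have "(0::real) \<le> 1/2^l" by simp
        ultimately show ?thesis by linarith
      qed
      then show ?thesis using c const by (intro exI[of _ c] exI[of _ \<theta>]) simp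
    next
      case False
      define k where "k = (LEAST k. t \<notin> U k)"
      have k: "t \<notin> U k" unfolding k_def by (rule LeastI_ex[OF esc[OF False]])
      have klt: "t \<in> U l" if "l < k" for l using not_less_Least[of l "\<lambda>k. t \<notin> U k"] that unfolding k_def by blast
      have late: "deviation \<epsilon> t t (Q l) (a l) (b l) \<le> 2 * (1/2^l)" if "k < l" for l
      proof -
        have "excess \<epsilon> t (Q l) (b l) \<le> 1/2^l" using ex[OF that] t k by simp
        moreover have "(0::real) \<le> 1/2^l" by simp
        ultimately show ?thesis unfolding deviation_self by linarith
      qed
      show ?thesis
      proof (cases k)
        case 0
        then show ?thesis using late
          by (intro exI[of _ "{0}"] exI[of _ "\<lambda>_. t"]) auto
      next
        case (Suc k')
        obtain x where x: "x \<in> K0" and near: "\<And>l. l \<le> k' \<Longrightarrow> (\<Sum>i\<in>Q l. a l i * \<bar>T (z i) t - T (z i) x\<bar>) \<le> 1/2^k'"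
          using nr[OF klt[of k']] Suc by blast
        obtain c \<theta> where c: "finite c" "card c \<le> n" and dev: "\<forall>l. l \<notin> c \<longrightarrow> deviation \<epsilon> x (\<theta> l) (Q l) (a l) (b l) \<le> 1/2^l"
          and const: "\<forall>l l'. l \<le> l' \<longrightarrow> {l..l'} \<inter> c = {} \<longrightarrow> \<theta> l = \<theta> l'" using inner[OF x] by (elim exE conjE)
        show ?thesis
        proof (intro exI[of _ "insert k c"] exI[of _ "\<lambda>l. if l < k then \<theta> l else t"] conjI allI impI)
          show "finite (insert k c)" using c by simp
          show "card (insert k c) \<le> Suc n" using c by (simp add: card_insert_if)
          show "deviation \<epsilon> t (if l < k then \<theta> l else t) (Q l) (a l) (b l) \<le> 2 * (1/2^l)" if l: "l \<notin> insert k c" for l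
          proof (cases "l < k")
            case True
            have "deviation \<epsilon> t (\<theta> l) (Q l) (a l) (b l)
              \<le> (\<Sum>i\<in>Q l. a l i * \<bar>T (z i) t - T (z i) x\<bar>) + deviation \<epsilon> x (\<theta> l) (Q l) (a l) (b l)"
              by (rule deviation_triangle[OF nn])
            moreover have "deviation \<epsilon> x (\<theta> l) (Q l) (a l) (b l) \<le> 1/2^l" using dev l by simp
            moreover have "(\<Sum>i\<in>Q l. a l i * \<bar>T (z i) t - T (z i) x\<bar>) \<le> 1/2^k'" using near True Suc by simp
            moreover have "(1::real)/2^k' \<le> 1/2^l" using True Suc by (intro divide_left_mono power_increasing) auto
            ultimately have "deviation \<epsilon> t (\<theta> l) (Q l) (a l) (b l) \<le> 2 * (1/2^l)" by linarith
            then show ?thesis using True by simp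
          next
            case F: False
            then show ?thesis using late[of l] l by simp
          qed
          show "(if l < k then \<theta> l else t) = (if l' < k then \<theta> l' else t)"
            if l: "l \<le> l'" "{l..l'} \<inter> insert k c = {}" for l l'
          proof -
            have "\<theta> l = \<theta> l'" using const l by auto
            moreover have "k \<notin> {l..l'}" using l(2) by blast
            ultimately show ?thesis using l(1) by auto
          qed
        qed
      qed
    qed
  qed
  ultimately show ?thesis by blast
qed

text \<open>Induction over the sublevel sets of the total mass, closed by lower semicontinuity,
  whose successive differences are the strata. Where the mass is at most 0 the single blocks have no
  excess, and finitely many steps reach the norm of T.\<close>

lemma exists_controls:
  assumes met: "metrizable_space (euclidean :: 'k topology)" and \<epsilon>: "0 < \<epsilon>"
    and null: "\<And>t. t \<in> R \<Longrightarrow> (\<lambda>i. tv t (\<phi> i)) \<longlonglongrightarrow> 0"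
    and thin: "\<And>r L. L \<noteq> {} \<Longrightarrow> L \<subseteq> {t. real r * (\<epsilon>/100) < tvnorm t \<and> tvnorm t \<le> (real r + 1) * (\<epsilon>/100)} \<Longrightarrow>
      \<exists>V S \<kappa>. open V \<and> V \<inter> L \<noteq> {} \<and> S \<subseteq> R \<and> thin \<epsilon> (V \<inter> L) S \<kappa>"
  shows "\<exists>W A B \<kappa> n. supplies W A B \<kappa> \<and> controls \<epsilon> n W A B \<kappa> UNIV"
proof -
  define e where "e = \<epsilon>/100"
  have e: "0 < e" "2 * e \<le> \<epsilon>" unfolding e_def using \<epsilon> by auto
  have "\<exists>W A B \<kappa>. supplies W A B \<kappa> \<and> controls \<epsilon> r W A B \<kappa> {t. tvnorm t \<le> real r * e}" for r
  proof (induction r)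
    case 0
    have "supplies (\<lambda>j. {j}) (\<lambda>_ _. 1) (\<lambda>_ _. 1) \<xi>"
      unfolding supplies_def
    proof (intro conjI allI impI ballI)
      show "\<xi> \<longlonglongrightarrow> 0" unfolding \<xi>_def using LIMSEQ_inverse_real_of_nat by (simp add: inverse_eq_divide add.commute)
    qed (auto intro: weighted_singleton)
    moreover have "controls \<epsilon> 0 (\<lambda>j. {j}) (\<lambda>_ _. 1) (\<lambda>_ _. 1) \<xi> {t. tvnorm t \<le> real 0 * e}"
      unfolding controls_def
    proof
      fix t assume "t \<in> {t. tvnorm t \<le> real 0 * e}"
      then have "tvnorm t \<le> 0" by simp
      then have "tv t (\<phi> i) \<le> 3 * \<epsilon>" for i
        using tv_le_tvnorm[of "\<phi> i" t] testD(2,3)[OF test_\<phi>] \<epsilon> by force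
      then have "deviation \<epsilon> t t {j} (\<lambda>_. 1) (\<lambda>_. 1) \<le> \<xi> j" for j
        unfolding deviation_self using \<xi>_pos[of j] by (subst excess_zero) auto
      then show "\<exists>c \<theta>. finite c \<and> card c \<le> 0 \<and> (\<forall>j. j \<notin> c \<longrightarrow> deviation \<epsilon> t (\<theta> j) {j} (\<lambda>_. 1) (\<lambda>_. 1) \<le> \<xi> j) \<and>
        (\<forall>j j'. j \<le> j' \<longrightarrow> {j..j'} \<inter> c = {} \<longrightarrow> \<theta> j = \<theta> j')"
        by (intro exI[of _ "{}"] exI[of _ "\<lambda>_. t"]) simp
    qed
    ultimately show ?case by blast
  next
    case (Suc r)
    then obtain W A B \<kappa> where W: "supplies W A B \<kappa>" "controls \<epsilon> r W A B \<kappa> {t. tvnorm t \<le> real r * e}"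
      by (elim exE conjE)
    let ?D = "{t. tvnorm t \<le> real (Suc r) * e} - {t. tvnorm t \<le> real r * e}"
    have D: "?D = {t. real r * (\<epsilon>/100) < tvnorm t \<and> tvnorm t \<le> (real r + 1) * (\<epsilon>/100)}"
      unfolding e_def of_nat_Suc add.commute[of 1] by auto
    have "tame \<epsilon> F" if F: "closed F" "F \<subseteq> ?D" for F
    proof (rule tame_of_thin[OF \<epsilon> null _ _ F])
      fix t i assume t: "t \<in> ?D"
      then have "real r * e < tvnorm t" by simp
      from tv_almost_usc[OF test_\<phi> this e(1), of i] obtain U where U: "open U" "t \<in> U"
        "\<forall>t'\<in>U. tvnorm t' \<le> real r * e + e \<longrightarrow> tv t' (\<phi> i) \<le> tv t (\<phi> i) + 2 * e" by (elim exE conjE)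
      have "tv t' (\<phi> i) \<le> tv t (\<phi> i) + \<epsilon>" if "t' \<in> U \<inter> ?D" for t'
      proof -
        have "tvnorm t' \<le> real r * e + e" "t' \<in> U" using that by (auto simp: algebra_simps)
        then show ?thesis using U(3) e(2) by force
      qed
      then show "\<exists>U. open U \<and> t \<in> U \<and> (\<forall>t'\<in>U \<inter> ?D. tv t' (\<phi> i) \<le> tv t (\<phi> i) + \<epsilon>)"
        using U(1,2) by (intro exI[of _ U]) simp
    next
      fix L assume "L \<noteq> {}" "L \<subseteq> ?D"
      then show "\<exists>V S \<kappa>. open V \<and> V \<inter> L \<noteq> {} \<and> S \<subseteq> R \<and> thin \<epsilon> (V \<inter> L) S \<kappa>"
        unfolding D by (rule thin)
    qed
    then show ?case
      by (rule stratum_step[OF met \<epsilon> _ closed_tvnorm_le closed_tvnorm_le W])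
  qed
  moreover obtain r :: nat where "norm T / e < real r" using reals_Archimedean2 by blast
  then have "norm T \<le> real r * e" using e by (simp add: pos_divide_less_eq)
  then have "{t. tvnorm t \<le> real r * e} = UNIV" using tvnorm_le order_trans by blast
  ultimately show ?thesis by metis
qed

text \<open>A last average u of m late families. At t at most n families are bad, each of weight at
  most 1/(w m). The others form at most n + 1 runs, on each of which T u may be evaluated at one
  point with masses at most 3 \<epsilon>, up to the deviation. The main terms 6 \<epsilon> b(P l)
  sum to at most 6 \<epsilon> whatever n is, since b has total weight 1; only the error \<tau> is
  multiplied by the number of runs.\<close>

lemma controls_contradiction:
  assumes \<delta>: "0 < \<delta>" and \<epsilon>: "\<epsilon> = \<delta> / 20"
    and low: "\<And>Q a. finite Q \<Longrightarrow> \<delta> * norm (\<Sum>i\<in>Q. a i *\<^sub>R z i) \<le> norm (T (\<Sum>i\<in>Q. a i *\<^sub>R z i))"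
    and s: "supplies W A B \<kappa>" and ctl: "controls \<epsilon> n W A B \<kappa> UNIV"
  shows False
proof -
  have \<epsilon>0: "0 < \<epsilon>" using \<delta> \<epsilon> by simp
  define M where "M = norm T + 1"
  have M: "0 < M" "norm T \<le> M" unfolding M_def by (auto simp: add_nonneg_pos)
  \<comment> \<open>Chosen after n, so that n + 1 errors of size \<tau> M cost at most \<delta>/20.
    Likewise \<sigma> bounds the total deviation after division by w, and m makes the weight of n
    bad families negligible.\<close>
  define \<tau> where "\<tau> = min 1 (\<delta> / (20 * (real n + 1) * M))"
  have \<tau>: "0 < \<tau>" "\<tau> \<le> 1" "\<tau> \<le> \<delta> / (20 * (real n + 1) * M)" unfolding \<tau>_def using \<delta> M by auto
  have nM: "0 < (real n + 1) * M" using M by simp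
  have \<tau>n: "(real n + 1) * (\<tau> * M) \<le> \<delta> / 20"
  proof -
    have "((real n + 1) * M) * \<tau> \<le> ((real n + 1) * M) * (\<delta> / (20 * (real n + 1) * M))"
      using \<tau>(3) nM by (intro mult_left_mono) auto
    also have "\<dots> = \<delta> / 20" using nM by (simp add: field_simps)
    finally show ?thesis by (simp add: mult_ac)
  qed
  obtain w \<tau>1 where w: "0 < w" "w \<le> 1" "0 < \<tau>1" and av: "\<forall>m Q a b. 0 < m \<longrightarrow> successive m Q \<longrightarrow>
      (\<forall>l<m. weighted (Q l) (a l) (b l) \<tau>1) \<longrightarrow>
      (\<exists>Q' a' b'. Q' \<subseteq> (\<Union>l<m. Q l) \<and> weighted Q' a' b' \<tau> \<and>
        (\<forall>l<m. \<forall>i\<in>Q' \<inter> Q l. a' i \<le> a l i / (w * real m) \<and> b' i \<le> b l i / (w * real m)))"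
    by (rule average[OF \<tau>(1,2)])
  define \<sigma> where "\<sigma> = min \<tau>1 (w * \<delta> / 20)"
  have \<sigma>: "0 < \<sigma>" "\<sigma> \<le> \<tau>1" "\<sigma> \<le> w * \<delta> / 20" unfolding \<sigma>_def using w \<delta> by auto
  obtain m :: nat where m: "20 * (real n + 1) * M / (w * \<delta>) < real m" using reals_Archimedean2 by blast
  moreover have "0 \<le> 20 * (real n + 1) * M / (w * \<delta>)"
    using w \<delta> M by (intro divide_nonneg_pos mult_nonneg_nonneg mult_pos_pos) auto
  ultimately have m0: "0 < m" by (metis of_nat_0_less_iff order_le_less_trans)
  have wm: "0 < w * real m" using w m0 by simp
  have nm: "real n * M / (w * real m) \<le> \<delta> / 20"
  proof -
    have "20 * (real n + 1) * M < real m * (w * \<delta>)" using m w \<delta> by (simp add: pos_divide_less_eq)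
    then have "20 * (real n * M) \<le> \<delta> * (w * real m)" using M by (simp add: algebra_simps)
    then show ?thesis using wm by (simp add: pos_divide_le_eq)
  qed
  have "\<forall>\<^sub>F j in sequentially. \<kappa> j < \<sigma>" by (rule order_tendstoD(2)[OF suppliesD(3)[OF s] \<sigma>(1)])
  then obtain N1 where N1: "\<And>j. N1 \<le> j \<Longrightarrow> \<kappa> j < \<sigma>" unfolding eventually_sequentially by blast
  define N where "N = max N1 m"
  have N: "N1 \<le> N" "m \<le> N" unfolding N_def by auto
  have \<kappa>N: "\<kappa> (N + l) \<le> \<sigma>" for l using N1[of "N + l"] N(1) by simp
  define V where "V l = W (N + l)" for l
  have suc: "successive m V"
    unfolding successive_def V_def
  proof (intro conjI allI impI ballI)
    show "finite (W (N + l))" for l by (rule weightedD(1)[OF suppliesD(1)[OF s]])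
    show "i < i'" if "k < l" "i \<in> W (N + k)" "i' \<in> W (N + l)" for k l i i'
      by (rule suppliesD(2)[OF s _ that(2,3)]) (use that(1) in simp)
    show "m \<le> i" if "i \<in> W (N + l)" for l i
      using supplies_index_le[OF s that] N(2) by simp
  qed
  have WV: "weighted (V l) (A (N + l)) (B (N + l)) \<tau>1" for l
    unfolding V_def by (rule weighted_mono[OF suppliesD(1)[OF s]]) (use \<kappa>N[of l] \<sigma>(2) in simp)
  obtain Q a b where Q: "Q \<subseteq> (\<Union>l<m. V l)" "weighted Q a b \<tau>"
    and ab: "\<forall>l<m. \<forall>i\<in>Q \<inter> V l. a i \<le> A (N + l) i / (w * real m) \<and> b i \<le> B (N + l) i / (w * real m)"
    using av[rule_format, OF m0 suc WV] by (elim exE conjE) (rule that, auto)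
  have finQ: "finite Q" and nn: "\<And>i. i \<in> Q \<Longrightarrow> 0 \<le> a i" "\<And>i. i \<in> Q \<Longrightarrow> 0 \<le> b i" and b1: "sum b Q = 1"
    using weightedD[OF Q(2)] by auto
  define u where "u = (\<Sum>i\<in>Q. a i *\<^sub>R z i)"
  have nu: "norm u = 1" using Q(2) unfolding u_def weighted_def by (elim conjE)
  define P where "P l = Q \<inter> V l" for l
  have finP: "finite (P l)" for l unfolding P_def using finQ by simp
  have Pdisj: "P k \<inter> P l = {}" if "k < m" "l < m" "k \<noteq> l" for k l
    using successive_disjoint[OF suc that] unfolding P_def by auto
  have bP: "sum b (P l) \<le> 1 / (w * real m)" if l: "l < m" for l
  proof -
    have "sum b (P l) \<le> (\<Sum>i\<in>P l. B (N + l) i / (w * real m))"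
      using ab l by (intro sum_mono) (simp add: P_def)
    also have "\<dots> \<le> (\<Sum>i\<in>V l. B (N + l) i / (w * real m))"
      by (rule sum_mono2) (use weightedD(1,3)[OF WV[of l]] wm in \<open>auto simp: P_def\<close>)
    also have "\<dots> = 1 / (w * real m)"
      using weightedD(4)[OF WV[of l]] by (simp flip: sum_divide_distrib)
    finally show ?thesis .
  qed
  have bsum: "(\<Sum>l<m. sum b (P l)) = 1"
    using sum_successive[OF suc Q(1), of b] b1 unfolding P_def by simp
  have main: "\<bar>T u t\<bar> \<le> 3 * \<delta> / 4" for t
  proof -
    obtain c \<theta> where c: "finite c" "card c \<le> n" and dev: "\<And>j. j \<notin> c \<Longrightarrow> deviation \<epsilon> t (\<theta> j) (W j) (A j) (B j) \<le> \<kappa> j"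
      and const: "\<And>j j'. j \<le> j' \<Longrightarrow> {j..j'} \<inter> c = {} \<Longrightarrow> \<theta> j = \<theta> j'"
      by (rule controlsD[OF ctl UNIV_I[of t]]) (rule that; assumption)
    define x where "x l = T (\<Sum>i\<in>P l. a i *\<^sub>R z i) t" for l
    define bad where "bad = {l. l < m \<and> N + l \<in> c}"
    define good where "good = {l. l < m \<and> N + l \<notin> c}"
    have fin: "finite bad" "finite good" unfolding bad_def good_def by auto
    have "T u t = (\<Sum>l<m. x l)"
      unfolding u_def x_def P_def sum_successive[OF suc Q(1)]
      by (simp add: blinfun.sum_right apply_sum_bcontfun)
    also have "\<dots> = sum x bad + sum x good"
    proof -
      have "{..<m} = bad \<union> good" "bad \<inter> good = {}" unfolding bad_def good_def by auto
      then show ?thesis using fin by (simp add: sum.union_disjoint)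
    qed
    finally have Tu: "T u t = sum x bad + sum x good" .
    have "\<bar>sum x bad\<bar> \<le> (\<Sum>l\<in>bad. M * (2 / (w * real m) + \<tau>))"
    proof (rule order_trans[OF sum_abs], rule sum_mono)
      fix l assume "l \<in> bad"
      then have l: "l < m" unfolding bad_def by simp
      have "\<bar>x l\<bar> \<le> norm T * norm (\<Sum>i\<in>P l. a i *\<^sub>R z i)" unfolding x_def by (rule abs_T_le)
      also have "\<dots> \<le> M * (2 / (w * real m) + \<tau>)"
      proof (rule mult_mono)
        have "norm (\<Sum>i\<in>P l. a i *\<^sub>R z i) \<le> 2 * sum b (P l) + \<tau>"
          using Q(2) unfolding weighted_def P_def by (elim conjE) simp
        then show "norm (\<Sum>i\<in>P l. a i *\<^sub>R z i) \<le> 2 / (w * real m) + \<tau>" using bP[OF l] by simp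
      qed (use M in auto)
      finally show "\<bar>x l\<bar> \<le> M * (2 / (w * real m) + \<tau>)" .
    qed
    also have "\<dots> \<le> real n * (M * (2 / (w * real m) + \<tau>))"
    proof -
      have "card bad \<le> card c"
        by (rule card_inj_on_le[of "\<lambda>l. N + l"]) (use c in \<open>auto simp: bad_def inj_on_def\<close>)
      then have "card bad \<le> n" using c by simp
      then show ?thesis using M wm \<tau> by (simp add: mult_right_mono)
    qed
    also have "\<dots> = 2 * (real n * M / (w * real m)) + real n * (\<tau> * M)" by (simp add: algebra_simps)
    also have "\<dots> \<le> 2 * (\<delta> / 20) + \<delta> / 20"
    proof -
      have "real n * (\<tau> * M) \<le> (real n + 1) * (\<tau> * M)" using \<tau> M by (intro mult_right_mono) auto
      then show ?thesis using nm \<tau>n by linarith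
    qed
    finally have badle: "\<bar>sum x bad\<bar> \<le> 3 * \<delta> / 20" by simp
    \<comment> \<open>Good terms with the same number of removed indices before them have no removed
      index between them; hence this number labels the runs.\<close>
    define comp where "comp l = card {p \<in> c. p < N + l}" for l
    have comp_le: "comp l \<le> n" for l
    proof -
      have "comp l \<le> card c" unfolding comp_def using c by (intro card_mono) auto
      then show ?thesis using c by simp
    qed
    have same: "\<theta> (N + k) = \<theta> (N + l)" if kl: "k \<in> good" "l \<in> good" "comp k = comp l" "k \<le> l" for k l
    proof (rule const)
      have e: "{p \<in> c. p < N + k} = {p \<in> c. p < N + l}"
        by (rule card_subset_eq) (use c kl in \<open>auto simp: comp_def\<close>)
      have nl: "N + l \<notin> c" using kl unfolding good_def by simp
      show "{N + k..N + l} \<inter> c = {}"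
      proof (rule ccontr)
        assume "{N + k..N + l} \<inter> c \<noteq> {}"
        then obtain p where p: "N + k \<le> p" "p \<le> N + l" "p \<in> c" by auto
        then have "p \<noteq> N + l" using nl by auto
        then have "p \<in> {p \<in> c. p < N + l}" using p by simp
        then show False using p(1) unfolding e[symmetric] by simp
      qed
    qed (use kl in simp)
    define D where "D l = (\<Sum>i\<in>P l. a i * \<bar>T (z i) t - T (z i) (\<theta> (N + l))\<bar> + b i * max 0 (tv (\<theta> (N + l)) (\<phi> i) - 3 * \<epsilon>))" for l
    have Dle: "D l \<le> \<sigma> / (w * real m)" if l: "l \<in> good" for l
    proof -
      have lm: "l < m" and lc: "N + l \<notin> c" using l unfolding good_def by auto
      have "D l \<le> (\<Sum>i\<in>P l. (A (N + l) i * \<bar>T (z i) t - T (z i) (\<theta> (N + l))\<bar> + B (N + l) i * max 0 (tv (\<theta> (N + l)) (\<phi> i) - 3 * \<epsilon>)) / (w * real m))"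
        unfolding D_def
      proof (rule sum_mono)
        fix i assume "i \<in> P l"
        then have "a i \<le> A (N + l) i / (w * real m)" "b i \<le> B (N + l) i / (w * real m)"
          using ab lm unfolding P_def by auto
        then have "a i * \<bar>T (z i) t - T (z i) (\<theta> (N + l))\<bar> + b i * max 0 (tv (\<theta> (N + l)) (\<phi> i) - 3 * \<epsilon>)
          \<le> A (N + l) i / (w * real m) * \<bar>T (z i) t - T (z i) (\<theta> (N + l))\<bar> + B (N + l) i / (w * real m) * max 0 (tv (\<theta> (N + l)) (\<phi> i) - 3 * \<epsilon>)"
          by (intro add_mono mult_right_mono) auto
        then show "a i * \<bar>T (z i) t - T (z i) (\<theta> (N + l))\<bar> + b i * max 0 (tv (\<theta> (N + l)) (\<phi> i) - 3 * \<epsilon>)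
          \<le> (A (N + l) i * \<bar>T (z i) t - T (z i) (\<theta> (N + l))\<bar> + B (N + l) i * max 0 (tv (\<theta> (N + l)) (\<phi> i) - 3 * \<epsilon>)) / (w * real m)"
          by (simp add: add_divide_distrib)
      qed
      also have "\<dots> \<le> (\<Sum>i\<in>V l. (A (N + l) i * \<bar>T (z i) t - T (z i) (\<theta> (N + l))\<bar> + B (N + l) i * max 0 (tv (\<theta> (N + l)) (\<phi> i) - 3 * \<epsilon>)) / (w * real m))"
      proof (rule sum_mono2)
        fix i assume "i \<in> V l - P l"
        then have "0 \<le> A (N + l) i" "0 \<le> B (N + l) i" using weightedD(2,3)[OF WV[of l]] by auto
        then show "0 \<le> (A (N + l) i * \<bar>T (z i) t - T (z i) (\<theta> (N + l))\<bar> + B (N + l) i * max 0 (tv (\<theta> (N + l)) (\<phi> i) - 3 * \<epsilon>)) / (w * real m)"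
          using wm by (intro divide_nonneg_pos add_nonneg_nonneg mult_nonneg_nonneg) auto
      qed (use weightedD(1)[OF WV[of l]] in \<open>auto simp: P_def\<close>)
      also have "\<dots> = deviation \<epsilon> t (\<theta> (N + l)) (W (N + l)) (A (N + l)) (B (N + l)) / (w * real m)"
        unfolding deviation_def V_def by (rule sum_divide_distrib[symmetric])
      also have "\<dots> \<le> \<sigma> / (w * real m)"
        using dev[OF lc] \<kappa>N[of l] wm by (intro divide_right_mono) auto
      finally show ?thesis .
    qed
    have run: "\<bar>\<Sum>l\<in>{l\<in>good. comp l = p}. x l\<bar> \<le> 2 * \<tau> * M + (\<Sum>l\<in>{l\<in>good. comp l = p}. 6 * \<epsilon> * sum b (P l) + 2 * D l)" for p
    proof (cases "{l\<in>good. comp l = p} = {}")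
      case True
      show ?thesis unfolding True using \<tau> M by simp
    next
      case False
      define G where "G = {l\<in>good. comp l = p}"
      have "G \<noteq> {}" using False unfolding G_def .
      then obtain l0 where l0: "l0 \<in> G" by (meson ex_in_conv)
      define s where "s = \<theta> (N + l0)"
      have th: "\<theta> (N + l) = s" if "l \<in> G" for l
      proof -
        have g: "l \<in> good" "l0 \<in> good" "comp l = comp l0" using that l0 unfolding G_def by simp_all
        show ?thesis
        proof (cases "l \<le> l0")
          case True
          show ?thesis unfolding s_def by (rule same[OF g True])
        next
          case False
          then have "l0 \<le> l" by simp
          show ?thesis unfolding s_def by (rule same[OF g(2,1) g(3)[symmetric] \<open>l0 \<le> l\<close>, symmetric])
        qed
      qed
      have finG: "finite G" and Gm: "\<And>l. l \<in> G \<Longrightarrow> l < m" unfolding G_def using fin by (auto simp: good_def)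
      define E where "E = (\<Union>l\<in>G. P l)"
      have EQ: "E \<subseteq> Q" unfolding E_def P_def by auto
      have split: "sum f E = (\<Sum>l\<in>G. sum f (P l))" for f :: "nat \<Rightarrow> real"
        unfolding E_def by (rule sum.UNION_disjoint) (use finG finP Pdisj Gm in auto)
      have splitv: "sum f E = (\<Sum>l\<in>G. sum f (P l))" for f :: "nat \<Rightarrow> 'k \<Rightarrow>\<^sub>C real"
        unfolding E_def by (rule sum.UNION_disjoint) (use finG finP Pdisj Gm in auto)
      have nnE: "0 \<le> a i" "0 \<le> b i" if "i \<in> E" for i using nn subsetD[OF EQ that] by auto
      have Tsum: "T (\<Sum>i\<in>E. a i *\<^sub>R z i) v = (\<Sum>i\<in>E. a i * T (z i) v)" for v
        by (simp add: blinfun.sum_right blinfun.scaleR_right apply_sum_bcontfun)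
      have "(\<Sum>l\<in>G. x l) = T (\<Sum>i\<in>E. a i *\<^sub>R z i) t"
        unfolding splitv x_def by (simp add: blinfun.sum_right apply_sum_bcontfun)
      also have "\<bar>\<dots>\<bar> \<le> \<bar>T (\<Sum>i\<in>E. a i *\<^sub>R z i) s\<bar> + (\<Sum>i\<in>E. a i * \<bar>T (z i) t - T (z i) s\<bar>)"
      proof -
        have "T (\<Sum>i\<in>E. a i *\<^sub>R z i) t - T (\<Sum>i\<in>E. a i *\<^sub>R z i) s = (\<Sum>i\<in>E. a i * (T (z i) t - T (z i) s))"
          unfolding Tsum by (simp add: right_diff_distrib flip: sum_subtractf)
        also have "\<bar>\<dots>\<bar> \<le> (\<Sum>i\<in>E. a i * \<bar>T (z i) t - T (z i) s\<bar>)"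
          by (rule order_trans[OF sum_abs]) (intro sum_mono, use nnE in \<open>simp add: abs_mult\<close>)
        finally show ?thesis by linarith
      qed
      also have "\<bar>T (\<Sum>i\<in>E. a i *\<^sub>R z i) s\<bar> \<le> 2 * (\<Sum>i\<in>E. b i * tv s (\<phi> i)) + 2 * \<tau> * norm T"
        by (rule weighted_T_le[OF Q(2) EQ]) (use \<tau> in simp)
      also have "2 * \<tau> * norm T \<le> 2 * \<tau> * M" using M \<tau> by simp
      also have "(\<Sum>i\<in>E. b i * tv s (\<phi> i)) \<le> (\<Sum>i\<in>E. 3 * \<epsilon> * b i + b i * max 0 (tv s (\<phi> i) - 3 * \<epsilon>))"
      proof (rule sum_mono)
        fix i assume "i \<in> E"
        have "b i * tv s (\<phi> i) \<le> b i * (3 * \<epsilon> + max 0 (tv s (\<phi> i) - 3 * \<epsilon>))"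
          using nnE(2)[OF \<open>i \<in> E\<close>] by (intro mult_left_mono) auto
        then show "b i * tv s (\<phi> i) \<le> 3 * \<epsilon> * b i + b i * max 0 (tv s (\<phi> i) - 3 * \<epsilon>)"
          by (simp add: distrib_left mult.commute mult.left_commute)
      qed
      finally have "\<bar>\<Sum>l\<in>G. x l\<bar> \<le> 2 * (\<Sum>i\<in>E. 3 * \<epsilon> * b i + b i * max 0 (tv s (\<phi> i) - 3 * \<epsilon>)) + 2 * \<tau> * M
        + (\<Sum>i\<in>E. a i * \<bar>T (z i) t - T (z i) s\<bar>)" by simp
      \<comment> \<open>Doubling this sum lets the two parts of the deviation be collected with the
        common factor 2.\<close>
      moreover have "(\<Sum>i\<in>E. a i * \<bar>T (z i) t - T (z i) s\<bar>) \<le> 2 * (\<Sum>i\<in>E. a i * \<bar>T (z i) t - T (z i) s\<bar>)"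
      proof -
        have "0 \<le> (\<Sum>i\<in>E. a i * \<bar>T (z i) t - T (z i) s\<bar>)" using nnE by (intro sum_nonneg) simp
        then show ?thesis by simp
      qed
      moreover have "2 * (\<Sum>i\<in>E. 3 * \<epsilon> * b i + b i * max 0 (tv s (\<phi> i) - 3 * \<epsilon>)) + 2 * (\<Sum>i\<in>E. a i * \<bar>T (z i) t - T (z i) s\<bar>)
        = (\<Sum>i\<in>E. 6 * \<epsilon> * b i + 2 * (a i * \<bar>T (z i) t - T (z i) s\<bar> + b i * max 0 (tv s (\<phi> i) - 3 * \<epsilon>)))"
        by (simp add: sum.distrib sum_distrib_left distrib_left mult.assoc)
      moreover have "\<dots> = (\<Sum>l\<in>G. 6 * \<epsilon> * sum b (P l) + 2 * D l)"
        unfolding split D_def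
        by (rule sum.cong[OF refl]) (simp add: sum.distrib sum_distrib_left th)
      ultimately show ?thesis unfolding G_def[symmetric] by linarith
    qed
    have "sum x good = (\<Sum>p\<in>{..n}. \<Sum>l\<in>{l\<in>good. comp l = p}. x l)"
      by (rule sum.group[symmetric]) (use fin comp_le in auto)
    also have "\<bar>\<dots>\<bar> \<le> (\<Sum>p\<in>{..n}. 2 * \<tau> * M + (\<Sum>l\<in>{l\<in>good. comp l = p}. 6 * \<epsilon> * sum b (P l) + 2 * D l))"
      by (rule order_trans[OF sum_abs]) (intro sum_mono run)
    also have "\<dots> = 2 * ((real n + 1) * (\<tau> * M)) + (\<Sum>p\<in>{..n}. \<Sum>l\<in>{l\<in>good. comp l = p}. 6 * \<epsilon> * sum b (P l) + 2 * D l)"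
      by (simp add: sum.distrib algebra_simps)
    also have "(\<Sum>p\<in>{..n}. \<Sum>l\<in>{l\<in>good. comp l = p}. 6 * \<epsilon> * sum b (P l) + 2 * D l) = (\<Sum>l\<in>good. 6 * \<epsilon> * sum b (P l) + 2 * D l)"
      by (rule sum.group) (use fin comp_le in auto)
    also have "\<dots> \<le> (\<Sum>l\<in>good. 6 * \<epsilon> * sum b (P l) + 2 * (\<sigma> / (w * real m)))"
      by (intro sum_mono add_left_mono mult_left_mono Dle) auto
    also have "\<dots> \<le> (\<Sum>l<m. 6 * \<epsilon> * sum b (P l) + 2 * (\<sigma> / (w * real m)))"
    proof (rule sum_mono2)
      show "good \<subseteq> {..<m}" unfolding good_def by auto
      fix l assume "l \<in> {..<m} - good"
      have "0 \<le> sum b (P l)" using nn(2) by (intro sum_nonneg) (simp add: P_def)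
      then show "0 \<le> 6 * \<epsilon> * sum b (P l) + 2 * (\<sigma> / (w * real m))"
        using \<epsilon>0 \<sigma>(1) wm by (intro add_nonneg_nonneg) auto
    qed simp
    also have "\<dots> = 6 * \<epsilon> * (\<Sum>l<m. sum b (P l)) + 2 * (\<sigma> / w)"
      using m0 by (simp add: sum.distrib sum_distrib_left)
    also have "\<dots> \<le> 6 * \<epsilon> + 2 * (\<delta> / 20)"
    proof -
      have "\<sigma> / w \<le> (w * \<delta> / 20) / w" using \<sigma>(3) w by (intro divide_right_mono) auto
      also have "\<dots> = \<delta> / 20" using w by simp
      finally show ?thesis unfolding bsum by linarith
    qed
    finally have "\<bar>sum x good\<bar> \<le> 2 * (\<delta> / 20) + (6 * \<epsilon> + 2 * (\<delta> / 20))" using \<tau>n by linarith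
    \<comment> \<open>The contributions are 3 \<delta>/20 from the bad families, 2 \<delta>/20 from
      \<tau>, 6 \<delta>/20 from the masses and 2 \<delta>/20 from the deviations.\<close>
    then show ?thesis using badle unfolding Tu \<epsilon> by linarith
  qed
  have "\<delta> * norm u \<le> norm (T u)" unfolding u_def by (rule low[OF finQ])
  moreover have "norm (T u) \<le> 3 * \<delta> / 4" by (rule norm_bcontfun_le[OF main])
  ultimately show False using nu \<delta> by simp
qed

end

subsection \<open>Choice of the blocks\<close>

text \<open>A basis-free form, stable under isomorphic embeddings; coefficients may vanish, only the
  block sums must not.\<close>

definition asymptotic_l1_seq :: "real \<Rightarrow> (nat \<Rightarrow> 'a::real_normed_vector) \<Rightarrow> bool" where
  "asymptotic_l1_seq C Y \<longleftrightarrow> (\<forall>m F c. successive m F \<longrightarrow> (\<forall>l<m. (\<Sum>i\<in>F l. c i *\<^sub>R Y i) \<noteq> 0) \<longrightarrow>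
     C * (\<Sum>l<m. norm (\<Sum>i\<in>F l. c i *\<^sub>R Y i)) \<le> norm (\<Sum>l<m. \<Sum>i\<in>F l. c i *\<^sub>R Y i))"

context ck_operator
begin

lemma continuous_on_bcontfun_square:
  fixes f :: "'k \<Rightarrow>\<^sub>C real"
  shows "continuous_on UNIV (\<lambda>x. (f x)\<^sup>2)"
  by (intro continuous_on_power continuous_on_apply_bcontfun)

text \<open>By the parallelogram identity the quadratic form h \<mapsto> \<open>tvs S\<close> of h^2
  has, averaged over the two signs of a new vector, the sum of the two values; one sign does no
  worse. So the form grows only linearly in m.\<close>

lemma random_signs:
  fixes y :: "nat \<Rightarrow> 'k \<Rightarrow>\<^sub>C real"
  assumes y: "\<And>l. norm (y l) \<le> 1"
  shows "\<exists>s. (\<forall>l. \<bar>s l\<bar> = 1) \<and> tvs S (\<lambda>x. ((\<Sum>l<m. s l *\<^sub>R y l) x)\<^sup>2) \<le> real m * (real (card S) * norm T)"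
proof (induction m)
  case 0
  show ?case by (intro exI[of _ "\<lambda>_. 1"]) (simp add: tvs_def)
next
  case (Suc m)
  then obtain s :: "nat \<Rightarrow> real" where s: "\<And>l. \<bar>s l\<bar> = 1"
    "tvs S (\<lambda>x. ((\<Sum>l<m. s l *\<^sub>R y l) x)\<^sup>2) \<le> real m * (real (card S) * norm T)"
    by (elim exE conjE) (rule that, auto)
  define f where "f = (\<Sum>l<m. s l *\<^sub>R y l)"
  let ?q = "\<lambda>h :: 'k \<Rightarrow>\<^sub>C real. tvs S (\<lambda>x. (h x)\<^sup>2)"
  have par: "?q (f + y m) + ?q (f - y m) = 2 * (?q f + ?q (y m))"
  proof -
    have "tv t (\<lambda>x. ((f + y m) x)\<^sup>2) + tv t (\<lambda>x. ((f - y m) x)\<^sup>2) = 2 * (tv t (\<lambda>x. (f x)\<^sup>2) + tv t (\<lambda>x. (y m x)\<^sup>2))" for t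
    proof -
      have c: "continuous_on UNIV (\<lambda>x. (f x)\<^sup>2 + (y m x)\<^sup>2)"
        by (intro continuous_on_add continuous_on_bcontfun_square)
      have "tv t (\<lambda>x. ((f + y m) x)\<^sup>2) + tv t (\<lambda>x. ((f - y m) x)\<^sup>2) = tv t (\<lambda>x. ((f + y m) x)\<^sup>2 + ((f - y m) x)\<^sup>2)"
        by (rule tv_add[symmetric]) (rule continuous_on_bcontfun_square zero_le_power2)+
      also have "(\<lambda>x. ((f + y m) x)\<^sup>2 + ((f - y m) x)\<^sup>2) = (\<lambda>x. 2 * ((f x)\<^sup>2 + (y m x)\<^sup>2))"
        by (auto simp: power2_eq_square algebra_simps)
      also have "tv t \<dots> = 2 * tv t (\<lambda>x. (f x)\<^sup>2 + (y m x)\<^sup>2)"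
        by (rule tv_scale) (use c in auto)
      also have "tv t (\<lambda>x. (f x)\<^sup>2 + (y m x)\<^sup>2) = tv t (\<lambda>x. (f x)\<^sup>2) + tv t (\<lambda>x. (y m x)\<^sup>2)"
        by (rule tv_add) (auto intro: continuous_on_bcontfun_square)
      finally show ?thesis .
    qed
    then show ?thesis unfolding tvs_def sum.distrib[symmetric] sum_distrib_left by simp
  qed
  have "?q (y m) \<le> (\<Sum>t\<in>S. norm T)"
    unfolding tvs_def
  proof (rule sum_mono)
    fix t
    have "(y m x)\<^sup>2 \<le> 1" for x
      using order_trans[OF abs_le_norm_bcontfun[of "y m" x] y] by (simp add: abs_square_le_1)
    then show "tv t (\<lambda>x. (y m x)\<^sup>2) \<le> norm T" using tv_bound[of "\<lambda>x. (y m x)\<^sup>2" 1 t] by simp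
  qed
  then have ym: "?q (y m) \<le> real (card S) * norm T" by simp
  have "?q (f + y m) \<le> real (Suc m) * (real (card S) * norm T) \<or> ?q (f - y m) \<le> real (Suc m) * (real (card S) * norm T)"
    using par ym s(2) unfolding f_def[symmetric] by (auto simp: algebra_simps)
  then obtain \<sigma> :: real where \<sigma>: "\<bar>\<sigma>\<bar> = 1" "?q (f + \<sigma> *\<^sub>R y m) \<le> real (Suc m) * (real (card S) * norm T)"
    by (metis abs_minus_cancel abs_one scaleR_minus1_left scaleR_one diff_conv_add_uminus)
  have "(\<Sum>l<Suc m. (s(m := \<sigma>)) l *\<^sub>R y l) = f + \<sigma> *\<^sub>R y m"
    unfolding f_def by simp
  then show ?case using s(1) \<sigma> by (intro exI[of _ "s(m := \<sigma>)"]) simp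
qed

text \<open>The norm of a signed sum of m unit vectors is at least C m, while the quadratic form is
  at most m B; after normalization it is at most B/(C^2 m). Starting at p \<ge> m makes the m
  vectors admissible.\<close>

lemma small_block:
  fixes Y :: "nat \<Rightarrow> 'k \<Rightarrow>\<^sub>C real"
  assumes Y: "asymptotic_l1_seq C Y" "0 < C" "\<And>j. Y j \<noteq> 0" and e: "0 < e"
  obtains p q c where "N \<le> p" "norm (\<Sum>i=p..<q. c i *\<^sub>R Y i) = 1"
    "tvs S (\<lambda>x. ((\<Sum>i=p..<q. c i *\<^sub>R Y i) x)\<^sup>2) \<le> e"
proof -
  define B where "B = real (card S) * norm T"
  have B: "0 \<le> B" unfolding B_def by simp
  obtain m :: nat where m: "B / (C\<^sup>2 * e) < real m" using reals_Archimedean2 by blast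
  have "0 \<le> B / (C\<^sup>2 * e)" using B e by simp
  then have m0: "0 < m" using m by (metis of_nat_0_less_iff order_le_less_trans)
  have Bm: "B \<le> C\<^sup>2 * e * real m" using m e Y(2) by (simp add: pos_divide_less_eq mult.commute)
  define p where "p = max N m"
  define y where "y l = (1 / norm (Y (p + l))) *\<^sub>R Y (p + l)" for l
  have ny: "norm (y l) = 1" for l unfolding y_def using Y(3)[of "p + l"] by simp
  obtain s :: "nat \<Rightarrow> real" where s: "\<And>l. \<bar>s l\<bar> = 1" "tvs S (\<lambda>x. ((\<Sum>l<m. s l *\<^sub>R y l) x)\<^sup>2) \<le> real m * B"
    using random_signs[of y S m] ny unfolding B_def by auto
  define d where "d i = s (i - p) / norm (Y i)" for i
  define v where "v = (\<Sum>l<m. s l *\<^sub>R y l)"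
  have single: "(\<Sum>i\<in>{p + l}. d i *\<^sub>R Y i) = s l *\<^sub>R y l" for l unfolding d_def y_def by simp
  have "successive m (\<lambda>l. {p + l})" unfolding successive_def p_def by auto
  moreover have ns: "norm (s l *\<^sub>R y l) = 1" for l using s(1) ny by simp
  then have "\<forall>l<m. (\<Sum>i\<in>{p + l}. d i *\<^sub>R Y i) \<noteq> 0" unfolding single by (metis norm_zero zero_neq_one)
  ultimately have "C * (\<Sum>l<m. norm (\<Sum>i\<in>{p + l}. d i *\<^sub>R Y i)) \<le> norm (\<Sum>l<m. \<Sum>i\<in>{p + l}. d i *\<^sub>R Y i)"
    using Y(1)[unfolded asymptotic_l1_seq_def, rule_format, of m "\<lambda>l. {p + l}" d] by simp
  then have nv: "C * real m \<le> norm v" unfolding single ns v_def by simp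
  have Cm: "0 < C * real m" using Y(2) m0 by simp
  have vsum: "v = (\<Sum>i=p..<p+m. d i *\<^sub>R Y i)"
    unfolding v_def single[symmetric]
    using sum.shift_bounds_nat_ivl[of "\<lambda>i. d i *\<^sub>R Y i" 0 p m] by (simp add: lessThan_atLeast0 add.commute)
  show ?thesis
  proof (rule that[of p "\<lambda>i. d i / norm v" "p + m"])
    show "N \<le> p" unfolding p_def by simp
    have eq: "(\<Sum>i=p..<p+m. (d i / norm v) *\<^sub>R Y i) = (1 / norm v) *\<^sub>R v"
      unfolding vsum by (simp add: scaleR_sum_right)
    have pos: "0 < norm v" using nv Cm by linarith
    then show "norm (\<Sum>i=p..<p+m. (d i / norm v) *\<^sub>R Y i) = 1" unfolding eq by simp
    have "tvs S (\<lambda>x. (((1 / norm v) *\<^sub>R v) x)\<^sup>2) = (1 / norm v)\<^sup>2 * tvs S (\<lambda>x. (v x)\<^sup>2)"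
      unfolding tvs_def sum_distrib_left
    proof (rule sum.cong[OF refl])
      fix t
      have "tv t (\<lambda>x. (((1 / norm v) *\<^sub>R v) x)\<^sup>2) = tv t (\<lambda>x. (1 / norm v)\<^sup>2 * (v x)\<^sup>2)"
        by (simp add: power_divide)
      also have "\<dots> = (1 / norm v)\<^sup>2 * tv t (\<lambda>x. (v x)\<^sup>2)"
        by (rule tv_scale) (auto intro: continuous_on_bcontfun_square)
      finally show "tv t (\<lambda>x. (((1 / norm v) *\<^sub>R v) x)\<^sup>2) = (1 / norm v)\<^sup>2 * tv t (\<lambda>x. (v x)\<^sup>2)" .
    qed
    also have "\<dots> \<le> (1 / norm v)\<^sup>2 * (real m * B)" using s(2) unfolding v_def by (intro mult_left_mono) auto
    also have "\<dots> \<le> (1 / (C * real m))\<^sup>2 * (real m * B)"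
      using nv Cm B mult_pos_pos[OF pos Cm] by (intro mult_right_mono power_mono divide_left_mono) auto
    also have "\<dots> \<le> (1 / (C * real m))\<^sup>2 * (real m * (C\<^sup>2 * e * real m))"
      using Bm by (intro mult_left_mono) auto
    also have "\<dots> = e" using Y(2) m0 by (simp add: power2_eq_square)
    finally show "tvs S (\<lambda>x. ((\<Sum>i=p..<p+m. (d i / norm v) *\<^sub>R Y i) x)\<^sup>2) \<le> e" unfolding eq .
  qed
qed

text \<open>The i-th block is chosen with quadratic form at most \<xi> i ^ 3 on the first points of
  R. As \<phi> i is at most (z i / \<xi> i)^2, its mass at those points is at most \<xi> i.\<close>

lemma exists_blocks:
  fixes Y :: "nat \<Rightarrow> 'k \<Rightarrow>\<^sub>C real"
  assumes Y: "asymptotic_l1_seq C Y" "0 < C" "C \<le> 1" "\<And>j. Y j \<noteq> 0" and R: "countable R"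
  obtains z where "l1_blocks z C" "\<And>i. z i \<in> span (range Y)"
    "\<And>t. t \<in> R \<Longrightarrow> (\<lambda>i. tv t (l1_blocks.\<phi> z i)) \<longlonglongrightarrow> 0"
proof -
  \<comment> \<open>An initial segment of an enumeration of R; that the enumeration repeats points
    when R is finite does no harm.\<close>
  define S where "S i = from_nat_into R ` {..i}" for i :: nat
  define r :: "nat \<Rightarrow> real" where "r i = 1 / (real i + 1)" for i
  have r: "0 < r i" for i unfolding r_def by simp
  define P :: "(nat \<times> nat \<times> (nat \<Rightarrow> real)) list \<Rightarrow> nat \<times> nat \<times> (nat \<Rightarrow> real) \<Rightarrow> bool" where
    "P xs g \<longleftrightarrow> length xs \<le> fst g \<and> (\<forall>g'\<in>set xs. fst (snd g') \<le> fst g) \<and>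
       norm (\<Sum>i=fst g..<fst (snd g). snd (snd g) i *\<^sub>R Y i) = 1 \<and>
       tvs (S (length xs)) (\<lambda>x. ((\<Sum>i=fst g..<fst (snd g). snd (snd g) i *\<^sub>R Y i) x)\<^sup>2) \<le> r (length xs) ^ 3"
    for xs g
  have "\<exists>g. P xs g" for xs
  proof -
    define N where "N = Max (insert (length xs) ((fst \<circ> snd) ` set xs))"
    obtain p q c where pqc: "N \<le> p" "norm (\<Sum>i=p..<q. c i *\<^sub>R Y i) = 1"
      "tvs (S (length xs)) (\<lambda>x. ((\<Sum>i=p..<q. c i *\<^sub>R Y i) x)\<^sup>2) \<le> r (length xs) ^ 3"
      by (rule small_block[OF Y(1,2,4), of "r (length xs) ^ 3" N "S (length xs)"])
        (use r in simp, rule that, assumption+)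
    have "length xs \<le> N" "\<forall>g'\<in>set xs. fst (snd g') \<le> N"
      unfolding N_def by (auto intro!: Max_ge)
    then have "P xs (p, q, c)" using pqc unfolding P_def by auto
    then show ?thesis by blast
  qed
  then obtain g where g: "\<And>i. P (map g [0..<i]) (g i)"
    by (rule history_choice[of P]) (rule that; assumption)
  define p where "p i = fst (g i)" for i
  define q where "q i = fst (snd (g i))" for i
  define c where "c i = snd (snd (g i))" for i
  define z where "z i = (\<Sum>j=p i..<q i. c i j *\<^sub>R Y j)" for i
  have pq: "i \<le> p i" "\<forall>k<i. q k \<le> p i" and nz: "norm (z i) = 1"
    and small: "tvs (S i) (\<lambda>x. (z i x)\<^sup>2) \<le> r i ^ 3" for i
    using g[of i] unfolding P_def z_def p_def q_def c_def by auto
  \<comment> \<open>The blocks occupy disjoint intervals, so an index determines its block; this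
    turns combinations of blocks into combinations of \<open>Y\<close>. Since p i \<ge> i,
    admissibility is inherited.\<close>
  have "\<exists>f. \<forall>i. \<forall>j\<in>{p i..<q i}. f j = i"
  proof (intro exI allI ballI)
    fix i j assume j: "j \<in> {p i..<q i}"
    show "(SOME i. j \<in> {p i..<q i}) = i"
    proof (rule some_equality[where P = "\<lambda>i. j \<in> {p i..<q i}", OF j])
      fix k assume k: "j \<in> {p k..<q k}"
      show "k = i"
      proof (rule ccontr)
        assume "k \<noteq> i"
        then have "k < i \<or> i < k" by auto
        then have "q k \<le> p i \<or> q i \<le> p k" using pq(2) by blast
        then show False using j k by auto
      qed
    qed
  qed
  then obtain f where f: "\<And>i j. j \<in> {p i..<q i} \<Longrightarrow> f j = i" by blast
  interpret l1_blocks T z C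
  proof
    fix m Q a assume Q: "successive m Q" and n1: "\<And>l. l < m \<Longrightarrow> norm (\<Sum>i\<in>Q l. a i *\<^sub>R z i) = 1"
    define F where "F l = (\<Union>i\<in>Q l. {p i..<q i})" for l
    define d where "d j = a (f j) * c (f j) j" for j
    have finQ: "finite (Q l)" if "l < m" for l using Q that unfolding successive_def by blast
    have eq: "(\<Sum>j\<in>F l. d j *\<^sub>R Y j) = (\<Sum>i\<in>Q l. a i *\<^sub>R z i)" if l: "l < m" for l
    proof -
      have "(\<Sum>j\<in>F l. d j *\<^sub>R Y j) = (\<Sum>i\<in>Q l. \<Sum>j=p i..<q i. d j *\<^sub>R Y j)"
        unfolding F_def
      proof (rule sum.UNION_disjoint[OF finQ[OF l]])
        show "\<forall>i\<in>Q l. \<forall>k\<in>Q l. i \<noteq> k \<longrightarrow> {p i..<q i} \<inter> {p k..<q k} = {}"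
        proof (intro ballI impI)
          fix i k :: nat assume "i \<noteq> k"
          show "{p i..<q i} \<inter> {p k..<q k} = {}"
          proof (rule equals0I)
            fix j assume "j \<in> {p i..<q i} \<inter> {p k..<q k}"
            then have "f j = i" "f j = k" using f by blast+
            then show False using \<open>i \<noteq> k\<close> by simp
          qed
        qed
      qed simp
      also have "\<dots> = (\<Sum>i\<in>Q l. a i *\<^sub>R z i)"
      proof (rule sum.cong[OF refl])
        fix i
        have "(\<Sum>j=p i..<q i. d j *\<^sub>R Y j) = (\<Sum>j=p i..<q i. a i *\<^sub>R (c i j *\<^sub>R Y j))"
          by (rule sum.cong[OF refl]) (use f[of _ i] in \<open>simp add: d_def\<close>)
        then show "(\<Sum>j=p i..<q i. d j *\<^sub>R Y j) = a i *\<^sub>R z i" unfolding z_def by (simp add: scaleR_sum_right)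
      qed
      finally show ?thesis .
    qed
    have "successive m F"
      unfolding successive_def
    proof (intro conjI allI impI ballI)
      show "finite (F l)" if "l < m" for l unfolding F_def using finQ[OF that] by simp
      show "i < j" if kl: "k < l" "l < m" and i: "i \<in> F k" and j: "j \<in> F l" for k l i j :: nat
      proof -
        obtain i' j' where i': "i' \<in> Q k" "i < q i'" and j': "j' \<in> Q l" "p j' \<le> j" using i j unfolding F_def by auto
        have "i' < j'" using Q kl i'(1) j'(1) unfolding successive_def by blast
        then have "q i' \<le> p j'" using pq(2) by blast
        then show ?thesis using i' j' by linarith
      qed
      show "m \<le> j" if l: "l < m" and j: "j \<in> F l" for l j
      proof -
        obtain i where i: "i \<in> Q l" "p i \<le> j" using j unfolding F_def by auto
        have "m \<le> i" using Q l i(1) unfolding successive_def by blast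
        then show ?thesis using i(2) pq(1)[of i] by linarith
      qed
    qed
    moreover have "\<forall>l<m. (\<Sum>j\<in>F l. d j *\<^sub>R Y j) \<noteq> 0"
      using eq n1 by (metis norm_zero zero_neq_one)
    ultimately have "C * (\<Sum>l<m. norm (\<Sum>j\<in>F l. d j *\<^sub>R Y j)) \<le> norm (\<Sum>l<m. \<Sum>j\<in>F l. d j *\<^sub>R Y j)"
      using Y(1)[unfolded asymptotic_l1_seq_def, rule_format, of m F d] by simp
    then show "C * real m \<le> norm (\<Sum>l<m. \<Sum>i\<in>Q l. a i *\<^sub>R z i)" by (simp add: eq n1)
  qed (use nz Y in auto)
  show ?thesis
  proof (rule that[of z])
    show "l1_blocks z C" by (rule l1_blocks_axioms)
    show "z i \<in> span (range Y)" for i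
      unfolding z_def by (intro span_sum span_scale span_base) simp
    fix t assume "t \<in> R"
    then obtain k where k: "from_nat_into R k = t" using from_nat_into_surj[OF R] by blast
    show "(\<lambda>i. tv t (\<phi> i)) \<longlonglongrightarrow> 0"
    proof (rule tendsto_sandwich[where f = "\<lambda>_. 0" and h = r])
      show "\<forall>\<^sub>F i in sequentially. 0 \<le> tv t (\<phi> i)"
        using test_\<phi> by (intro always_eventually allI tv_nonneg) (auto dest: testD)
      have "tv t (\<phi> i) \<le> r i" if "k \<le> i" for i
      proof -
        have c: "continuous_on UNIV (\<lambda>x. (1 / r i)\<^sup>2 * (z i x)\<^sup>2)"
          by (intro continuous_intros continuous_on_bcontfun_square)
        have "tv t (\<phi> i) \<le> tv t (\<lambda>x. (1 / r i)\<^sup>2 * (z i x)\<^sup>2)"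
          by (rule tv_mono[OF c]) (auto simp: \<phi>_def \<xi>_def r_def power_divide power_mult_distrib mult.commute)
        also have "\<dots> = (1 / r i)\<^sup>2 * tv t (\<lambda>x. (z i x)\<^sup>2)"
          by (rule tv_scale) (auto intro: continuous_on_bcontfun_square)
        finally have le: "tv t (\<phi> i) \<le> (1 / r i)\<^sup>2 * tv t (\<lambda>x. (z i x)\<^sup>2)" .
        have "tv t (\<lambda>x. (z i x)\<^sup>2) \<le> tvs (S i) (\<lambda>x. (z i x)\<^sup>2)"
          unfolding tvs_def
        proof (rule member_le_sum)
          show "t \<in> S i" unfolding S_def using k that by blast
          show "finite (S i)" unfolding S_def by simp
        qed (auto intro!: tv_nonneg continuous_on_bcontfun_square)
        also have "\<dots> \<le> r i ^ 3" by (rule small)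
        finally have "(1 / r i)\<^sup>2 * tv t (\<lambda>x. (z i x)\<^sup>2) \<le> (1 / r i)\<^sup>2 * r i ^ 3" by (intro mult_left_mono) auto
        also have "\<dots> = r i" using r[of i] by (simp add: power2_eq_square power3_eq_cube)
        finally show ?thesis using le by linarith
      qed
      then show "\<forall>\<^sub>F i in sequentially. tv t (\<phi> i) \<le> r i" unfolding eventually_sequentially by blast
      show "r \<longlonglongrightarrow> 0" unfolding r_def using LIMSEQ_inverse_real_of_nat by (simp add: inverse_eq_divide add.commute)
    qed simp
  qed
qed

end

subsection \<open>Conclusion\<close>

text \<open>Continuity of the inverse at 0 gives a radius d within which images come from vectors of
  norm below 1; by scaling, d is a lower bound for f.\<close>

lemma linear_into_isomorphism_lower:
  fixes f :: "'a::real_normed_vector \<Rightarrow> 'b::real_normed_vector"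
  assumes f: "linear f" and S: "subspace S" and iso: "into_isomorphism_on S f"
  obtains c where "0 < c" "\<And>x. x \<in> S \<Longrightarrow> c * norm x \<le> norm (f x)"
proof -
  obtain g where g: "homeomorphism S (f ` S) f g" using iso unfolding into_isomorphism_on_def by blast
  have gf: "\<And>x. x \<in> S \<Longrightarrow> g (f x) = x" and cont: "continuous_on (f ` S) g"
    using g unfolding homeomorphism_def by blast+
  have f0: "f 0 = 0" by (rule linear_0[OF f])
  have S0: "0 \<in> S" by (rule subspace_0[OF S])
  have "\<exists>d>0. \<forall>y\<in>f ` S. dist y 0 < d \<longrightarrow> dist (g y) (g 0) < 1"
    using cont[unfolded continuous_on_iff, rule_format, of 0 1] S0 f0 by (metis image_eqI zero_less_one)
  then obtain d where d: "0 < d" "\<And>y. y \<in> f ` S \<Longrightarrow> norm y < d \<Longrightarrow> norm (g y) < 1"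
    using gf[OF S0] f0 by auto
  have "d * norm x \<le> norm (f x)" if x: "x \<in> S" for x
  proof (rule ccontr)
    assume "\<not> ?thesis"
    then have less: "norm (f x) < d * norm x" by simp
    then have "0 < d * norm x" using norm_ge_zero[of "f x"] by linarith
    then have pos: "0 < norm x" using d(1) by (simp add: zero_less_mult_iff)
    define y where "y = (1 / norm x) *\<^sub>R x"
    have y: "y \<in> S" "norm y = 1" unfolding y_def using subspace_mul[OF S x] pos by auto
    have "norm (f y) = norm (f x) / norm x" unfolding y_def using linear_scale[OF f] pos by simp
    also have "\<dots> < d" using less pos by (simp add: pos_divide_less_eq)
    finally have "norm (g (f y)) < 1" using d(2)[of "f y"] y(1) by blast
    then show False using gf[OF y(1)] y(2) by simp
  qed
  then show ?thesis using that d(1) by blast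
qed

lemma linear_continuous_upper:
  fixes f :: "'a::real_normed_vector \<Rightarrow> 'b::real_normed_vector"
  assumes f: "linear f" and cont: "continuous_on UNIV f"
  obtains c where "0 < c" "\<And>x. norm (f x) \<le> c * norm x"
proof -
  have f0: "f 0 = 0" by (rule linear_0[OF f])
  have "\<exists>d>0. \<forall>x\<in>UNIV. dist x 0 < d \<longrightarrow> dist (f x) (f 0) < 1"
    using cont[unfolded continuous_on_iff, rule_format, of 0 1] by simp
  then obtain d where d: "0 < d" "\<And>x. norm x < d \<Longrightarrow> norm (f x) < 1"
    using f0 by auto
  have "norm (f x) \<le> (2 / d) * norm x" for x
  proof (cases "x = 0")
    case False
    define r where "r = d / (2 * norm x)"
    have r: "0 < r" unfolding r_def using d(1) False by simp
    have "norm (r *\<^sub>R x) = d / 2" using r False d(1) unfolding r_def by simp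
    then have "norm (f (r *\<^sub>R x)) < 1" using d by simp
    then have "r * norm (f x) < 1" using linear_scale[OF f] r by simp
    then have "norm (f x) < 1 / r" using r by (simp add: pos_less_divide_eq mult.commute)
    then show ?thesis unfolding r_def by simp
  qed (simp add: f0)
  then show ?thesis using that[of "2 / d"] d(1) by simp
qed

lemma schauder_basis_nonzero:
  assumes "schauder_basis e"
  shows "e j \<noteq> 0"
proof
  assume "e j = 0"
  then have "(\<lambda>n. (if n = j then 1 else 0) *\<^sub>R e n) = (\<lambda>n. 0)" by auto
  then have one: "(\<lambda>n. (if n = j then 1 else 0 :: real) *\<^sub>R e n) sums 0" by simp
  have zero: "(\<lambda>n. (0 :: real) *\<^sub>R e n) sums 0" by simp
  have "\<exists>!a :: nat \<Rightarrow> real. (\<lambda>n. a n *\<^sub>R e n) sums 0"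
    using assms unfolding schauder_basis_def by (rule spec)
  then obtain a :: "nat \<Rightarrow> real" where a: "\<forall>b. (\<lambda>n. b n *\<^sub>R e n) sums 0 \<longrightarrow> b = a"
    by (rule ex1E) (rule that, assumption)
  have "(\<lambda>n. if n = j then 1 else 0) = (\<lambda>_. 0 :: real)"
    using a[rule_format, of "\<lambda>n. if n = j then 1 else 0", OF one] a[rule_format, of "\<lambda>_. 0", OF zero] by simp
  from fun_cong[OF this, of j] show False by simp
qed

text \<open>Block bases have supports with nonzero coefficients only, so indices with vanishing
  coefficient are first removed. The condition m \<le> i on all indices implies the admissibility
  condition with its shift by one.\<close>

lemma asymptotic_l1_wrt_seq:
  assumes "asymptotic_l1_wrt e"
  obtains C where "0 < C" "asymptotic_l1_seq C e"
proof -
  obtain C where C: "C > 0" and low: "\<And>m F u. 1 \<le> m \<Longrightarrow> block_basis e m F u \<Longrightarrow> m \<le> Suc (Min (F 0)) \<Longrightarrow>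
      C * (\<Sum>i<m. norm (u i)) \<le> norm (\<Sum>i<m. u i)"
    using assms unfolding asymptotic_l1_wrt_def by blast
  have "asymptotic_l1_seq C e"
    unfolding asymptotic_l1_seq_def
  proof (intro allI impI)
    fix m F c assume suc: "successive m F" and nz: "\<forall>l<m. (\<Sum>i\<in>F l. c i *\<^sub>R e i) \<noteq> 0"
    show "C * (\<Sum>l<m. norm (\<Sum>i\<in>F l. c i *\<^sub>R e i)) \<le> norm (\<Sum>l<m. \<Sum>i\<in>F l. c i *\<^sub>R e i)"
    proof (cases "m = 0")
      case False
      define F' where "F' l = {i\<in>F l. c i \<noteq> 0}" for l
      have fin: "finite (F l)" if "l < m" for l using suc that unfolding successive_def by blast
      have fin': "finite (F' l)" if "l < m" for l unfolding F'_def using fin[OF that] by simp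
      have eq: "(\<Sum>i\<in>F l. c i *\<^sub>R e i) = (\<Sum>i\<in>F' l. c i *\<^sub>R e i)" if "l < m" for l
        by (rule sum.mono_neutral_right) (use fin[OF that] in \<open>auto simp: F'_def\<close>)
      have ne: "F' l \<noteq> {}" if "l < m" for l
      proof
        assume "F' l = {}"
        then show False using nz[rule_format, OF that] eq[OF that] by simp
      qed
      have "block_basis e m F' (\<lambda>l. \<Sum>i\<in>F l. c i *\<^sub>R e i)"
        unfolding block_basis_def
      proof (intro conjI allI impI)
        show "Max (F' i) < Min (F' (Suc i))" if i: "Suc i < m" for i
        proof -
          have "i < m" using i by simp
          have "Max (F' i) \<in> F i" "Min (F' (Suc i)) \<in> F (Suc i)"
            using Max_in[OF fin' ne] Min_in[OF fin' ne] i \<open>i < m\<close> unfolding F'_def by blast+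
          then show ?thesis using suc i unfolding successive_def by (meson lessI)
        qed
        show "\<exists>ca. \<forall>i<m. (\<forall>j\<in>F' i. ca j \<noteq> 0) \<and> (\<Sum>i\<in>F i. c i *\<^sub>R e i) = (\<Sum>j\<in>F' i. ca j *\<^sub>R e j) \<and>
            (\<Sum>i\<in>F i. c i *\<^sub>R e i) \<noteq> 0"
          by (intro exI[of _ c] allI impI conjI) (use eq nz in \<open>auto simp: F'_def\<close>)
      qed (use fin' ne in auto)
      moreover have "m \<le> Suc (Min (F' 0))"
      proof -
        have "Min (F' 0) \<in> F 0" using Min_in[OF fin' ne] False unfolding F'_def by blast
        then have "m \<le> Min (F' 0)" using suc False unfolding successive_def by blast
        then show ?thesis by simp
      qed
      ultimately show ?thesis using low[of m F'] False by simp
    qed simp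
  qed
  then show ?thesis using that C by blast
qed

lemma asymptotic_l1_seq_image:
  fixes J :: "'a::real_normed_vector \<Rightarrow> 'b::real_normed_vector"
  assumes J: "linear J" and \<alpha>: "0 < \<alpha>" "\<And>x. \<alpha> * norm x \<le> norm (J x)"
    and K: "0 < K" "\<And>x. norm (J x) \<le> K * norm x"
    and e: "asymptotic_l1_seq D e" and D: "0 < D" and C: "C \<le> \<alpha> * D / K"
  shows "asymptotic_l1_seq C (\<lambda>j. J (e j))"
  unfolding asymptotic_l1_seq_def
proof (intro allI impI)
  fix m F c assume suc: "successive m F" and nz: "\<forall>l<m. (\<Sum>i\<in>F l. c i *\<^sub>R J (e i)) \<noteq> 0"
  define u where "u l = (\<Sum>i\<in>F l. c i *\<^sub>R e i)" for l
  have Ju: "(\<Sum>i\<in>F l. c i *\<^sub>R J (e i)) = J (u l)" for l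
    unfolding u_def by (simp add: linear_sum[OF J] linear_scale[OF J])
  have "\<forall>l<m. u l \<noteq> 0" using nz linear_0[OF J] unfolding Ju by metis
  then have eu: "D * (\<Sum>l<m. norm (u l)) \<le> norm (\<Sum>l<m. u l)"
    using e suc unfolding asymptotic_l1_seq_def u_def by blast
  have "C * (\<Sum>l<m. norm (J (u l))) \<le> (\<alpha> * D / K) * (\<Sum>l<m. norm (J (u l)))"
    using C by (intro mult_right_mono sum_nonneg) auto
  also have "\<dots> \<le> (\<alpha> * D / K) * (\<Sum>l<m. K * norm (u l))"
    using K \<alpha>(1) D by (intro mult_left_mono sum_mono) auto
  also have "\<dots> = \<alpha> * (D * (\<Sum>l<m. norm (u l)))"
    using K(1) by (simp flip: sum_distrib_left)
  also have "\<dots> \<le> \<alpha> * norm (\<Sum>l<m. u l)" using eu \<alpha>(1) by (intro mult_left_mono) auto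
  also have "\<dots> \<le> norm (J (\<Sum>l<m. u l))" by (rule \<alpha>(2))
  finally show "C * (\<Sum>l<m. norm (\<Sum>i\<in>F l. c i *\<^sub>R J (e i))) \<le> norm (\<Sum>l<m. \<Sum>i\<in>F l. c i *\<^sub>R J (e i))"
    unfolding Ju linear_sum[OF J] .
qed

text \<open>The order of choices matters: \<delta> fixes \<epsilon> and the strata, the failure to
  preserve C(K) then yields the countable set R of witnesses, and only afterwards are blocks chosen
  that are null on R.\<close>

lemma (in ck_operator) asymptotic_l1_seq_fixes_CK:
  fixes Y :: "nat \<Rightarrow> 'k \<Rightarrow>\<^sub>C real"
  assumes met: "metrizable_space (euclidean :: 'k topology)"
    and Y: "asymptotic_l1_seq C Y" "0 < C" "C \<le> 1" "\<And>j. Y j \<noteq> 0"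
    and \<delta>: "0 < \<delta>" "\<And>y. y \<in> span (range Y) \<Longrightarrow> \<delta> * norm y \<le> norm (T y)"
  shows "preserves_copy T TYPE('k \<Rightarrow>\<^sub>C real)"
proof (rule ccontr)
  assume np: "\<not> ?thesis"
  define \<epsilon> where "\<epsilon> = \<delta> / 20"
  have \<epsilon>: "0 < \<epsilon>" unfolding \<epsilon>_def using \<delta> by simp
  define D where "D r = {t. real r * (\<epsilon>/100) < tvnorm t \<and> tvnorm t \<le> (real r + 1) * (\<epsilon>/100)}" for r :: nat
  have "\<exists>R. countable R \<and> (\<forall>L. L \<noteq> {} \<longrightarrow> L \<subseteq> D r \<longrightarrow>
    (\<exists>V S \<kappa>. open V \<and> V \<inter> L \<noteq> {} \<and> S \<subseteq> R \<and> thin \<epsilon> (V \<inter> L) S \<kappa>))" for r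
  proof -
    have th: "\<exists>V S \<kappa>. open V \<and> V \<inter> L \<noteq> {} \<and> thin \<epsilon> (V \<inter> L) S \<kappa>" if "L \<noteq> {}" "L \<subseteq> D r" for L
    proof (rule exists_thin_part[OF met np \<epsilon> that(1)])
      fix t assume "t \<in> L"
      then have "t \<in> D r" using that(2) by blast
      then show "real r * (\<epsilon>/100) < tvnorm t \<and> tvnorm t \<le> real r * (\<epsilon>/100) + \<epsilon>/100"
        unfolding D_def by (simp add: distrib_right)
    qed
    obtain R where "countable R" "\<And>L. L \<noteq> {} \<Longrightarrow> L \<subseteq> D r \<Longrightarrow>
      \<exists>V S \<kappa>. open V \<and> V \<inter> L \<noteq> {} \<and> S \<subseteq> R \<and> thin \<epsilon> (V \<inter> L) S \<kappa>"
    proof (rule countable_thin_witnesses[OF met, of "D r" \<epsilon>])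
      show "\<exists>V S \<kappa>. open V \<and> V \<inter> L \<noteq> {} \<and> thin \<epsilon> (V \<inter> L) S \<kappa>" if "L \<noteq> {}" "L \<subseteq> D r" for L
        by (rule th[OF that])
    qed (rule that; assumption)
    then show ?thesis by (intro exI[of _ R]) simp
  qed
  then obtain R where R: "\<And>r. countable (R r)" "\<And>r L. L \<noteq> {} \<Longrightarrow> L \<subseteq> D r \<Longrightarrow>
    \<exists>V S \<kappa>. open V \<and> V \<inter> L \<noteq> {} \<and> S \<subseteq> R r \<and> thin \<epsilon> (V \<inter> L) S \<kappa>" by metis
  have "countable (\<Union>r. R r)" using R(1) by simp
  then obtain z where z: "l1_blocks z C" "\<And>i. z i \<in> span (range Y)"
    and null: "\<And>t. t \<in> (\<Union>r. R r) \<Longrightarrow> (\<lambda>i. tv t (l1_blocks.\<phi> z i)) \<longlonglongrightarrow> 0"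
    by (rule exists_blocks[OF Y]) (rule that; assumption)
  interpret l1_blocks T z C
    using z(1) by (intro l1_blocks.intro ck_operator_axioms) (simp add: l1_blocks_def)
  have "\<exists>W A B \<kappa> n. supplies W A B \<kappa> \<and> controls \<epsilon> n W A B \<kappa> UNIV"
  proof (rule exists_controls[OF met \<epsilon> null])
    fix r L assume "L \<noteq> {}" "L \<subseteq> {t. real r * (\<epsilon>/100) < tvnorm t \<and> tvnorm t \<le> (real r + 1) * (\<epsilon>/100)}"
    then have "\<exists>V S \<kappa>. open V \<and> V \<inter> L \<noteq> {} \<and> S \<subseteq> R r \<and> thin \<epsilon> (V \<inter> L) S \<kappa>"
      by (intro R(2)) (simp_all add: D_def)
    then obtain V S \<kappa> where "open V" "V \<inter> L \<noteq> {}" "S \<subseteq> R r" "thin \<epsilon> (V \<inter> L) S \<kappa>" by (elim exE conjE)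
    then show "\<exists>V S \<kappa>. open V \<and> V \<inter> L \<noteq> {} \<and> S \<subseteq> (\<Union>r. R r) \<and> thin \<epsilon> (V \<inter> L) S \<kappa>"
      by (intro exI[of _ V] exI[of _ S] exI[of _ \<kappa>]) auto
  qed
  then obtain W A B \<kappa> n where W: "supplies W A B \<kappa>" "controls \<epsilon> n W A B \<kappa> UNIV" by (elim exE conjE)
  show False
  proof (rule controls_contradiction[OF \<delta>(1) \<epsilon>_def _ W])
    show "\<delta> * norm (\<Sum>i\<in>Q. a i *\<^sub>R z i) \<le> norm (T (\<Sum>i\<in>Q. a i *\<^sub>R z i))" for Q a
      by (intro \<delta>(2) span_sum span_scale z(2))
  qed
qed

theorem theorem1p1:
  fixes T :: "('k::topological_space \<Rightarrow>\<^sub>C real) \<Rightarrow>\<^sub>L ('k \<Rightarrow>\<^sub>C real)"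
  assumes "compact (UNIV :: 'k set)"
    and "metrizable_space (euclidean :: 'k topology)"
    and "asymptotic_l1_space TYPE('z::banach)"
    and "preserves_copy T TYPE('z)"
  shows "preserves_copy T TYPE('k \<Rightarrow>\<^sub>C real)"
proof -
  interpret ck_operator T by standard (rule assms(1))
  obtain S where S: "subspace S" "isomorphic_to_subspace TYPE('z) S" "into_isomorphism_on S (blinfun_apply T)"
    using assms(4) unfolding preserves_copy_def by blast
  obtain J :: "'z \<Rightarrow> 'k \<Rightarrow>\<^sub>C real" where J: "linear J" "range J = S" "into_isomorphism_on UNIV J"
    using S(2) unfolding isomorphic_to_subspace_def by blast
  obtain \<alpha> where \<alpha>: "0 < \<alpha>" "\<And>x. \<alpha> * norm x \<le> norm (J x)"
    by (rule linear_into_isomorphism_lower[OF J(1) subspace_UNIV J(3)]) (rule that, assumption, simp)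
  have "continuous_on UNIV J" using J(3) unfolding into_isomorphism_on_def homeomorphism_def by blast
  then obtain K where K: "0 < K" "\<And>x. norm (J x) \<le> K * norm x"
    using linear_continuous_upper[OF J(1)] by blast
  obtain \<delta> where \<delta>: "0 < \<delta>" "\<And>y. y \<in> S \<Longrightarrow> \<delta> * norm y \<le> norm (T y)"
    by (rule linear_into_isomorphism_lower[OF blinfun.bounded_linear_right[THEN bounded_linear.linear] S(1,3)])
      (rule that; assumption)
  obtain e :: "nat \<Rightarrow> 'z" where e: "asymptotic_l1_wrt e"
    using assms(3) unfolding asymptotic_l1_space_def by blast
  obtain D where D: "0 < D" "asymptotic_l1_seq D e" by (rule asymptotic_l1_wrt_seq[OF e])
  \<comment> \<open>\<alpha> D/K is the constant D after distortion by J; the minimum with 1 meets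
    the normalization C \<le> 1 of the blocks.\<close>
  define C where "C = min 1 (\<alpha> * D / K)"
  have C: "0 < C" "C \<le> 1" unfolding C_def using \<alpha>(1) D(1) K(1) by auto
  show ?thesis
  proof (rule asymptotic_l1_seq_fixes_CK[OF assms(2) _ C _ \<delta>(1)])
    show "asymptotic_l1_seq C (\<lambda>j. J (e j))"
      by (rule asymptotic_l1_seq_image[OF J(1) \<alpha> K D(2,1)]) (simp add: C_def)
    have "schauder_basis e" using e unfolding asymptotic_l1_wrt_def by blast
    then have "e j \<noteq> 0" for j by (rule schauder_basis_nonzero)
    then have "0 < \<alpha> * norm (e j)" for j using \<alpha>(1) by simp
    then have "0 < norm (J (e j))" for j using \<alpha>(2) by (rule less_le_trans)
    then show "J (e j) \<noteq> 0" for j by simp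
    have "span (range (\<lambda>j. J (e j))) \<subseteq> S"
      by (rule span_minimal) (use J(2) S(1) in auto)
    then show "\<delta> * norm y \<le> norm (T y)" if "y \<in> span (range (\<lambda>j. J (e j)))" for y
      using that \<delta>(2) by blast
  qed
qed

end
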